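(* Let $d>2$ be an integer and let $F:\mathbb{Z}^d\to\mathbb{R}$ be a $\mathbb{Z}^d$-symmetric function for which there are $K_1,K_2>0$ and $\rho>\max\{\frac{d-8}{2},0\}$ such that for all $x\in\mathbb{Z}^d$ and $k\in\mathbb{T}^d$, $$|F(x)|\le \frac{K_1}{(\max\{|x|,1\})^{d+2+\rho}},\qquad \hat F(0)\ge 0,\qquad \hat F(k)-\hat F(0)\ge K_2|k|^2 .$$ Define $$\lambda=\frac{1}{\hat F(0)-\sum_{x\in\mathbb{Z}^d}|x|^2F(x)},\qquad \mu=1-\lambda\hat F(0)$$ (the $\mathbb{Z}^d$-symmetry of $F$, the decay bound on $|F(x)|$, and the bounds $\hat F(0)\ge 0$ and $\hat F(k)-\hat F(0)\ge K_2|k|^2$ imply that $-\sum_x|x|^2F(x)\in[2dK_2,\infty)$, so $\lambda>0$ and $\mu\in(0,1]$). Then the solution $G$ to $F*G=\delta$ given by the absolutely convergent Fourier integral $$G(x)=\int_{\mathbb{T}^d}\frac{e^{-ik\cdot x}}{\hat F(k)}\frac{dk}{(2\pi)^d}\qquad(x\in\mathbb{Z}^d)$$ satisfies $$G(x)=\lambda C_\mu(x)+O\left(\frac{1}{(\max\{|x|,1\})^{d-2+s}}\right)\qquad (x\in\mathbb{Z}^d)$$ for any power $s$ which obeys $$s<\min\{\rho,2\}\quad\text{if }2<d\le 8,\qquad s<\min\{\rho-\tfrac{d-8}{2},\,2\}\quad\text{if }d>8.$$ The constant in the error estimate depends only on $d,K_1,K_2,\rho,s$.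
   Context: $|x|$ is the Euclidean norm. $\mathbb{T}^d=(\mathbb{R}/2\pi\mathbb{Z})^d$ is identified with $(-\pi,\pi]^d\subset\mathbb{R}^d$, and $|k|$ is the Euclidean norm under this identification. The Fourier transform of a summable $f:\mathbb{Z}^d\to\mathbb{R}$ is $\hat f(k)=\sum_{x\in\mathbb{Z}^d}f(x)e^{ik\cdot x}$. The convolution is $(f*g)(x)=\sum_{y\in\mathbb{Z}^d}f(y)g(x-y)$, and $\delta(x)=\delta_{0,x}$ is the Kronecker delta. A function on $\mathbb{Z}^d$ is $\mathbb{Z}^d$-symmetric if it is invariant under reflection in coordinate hyperplanes and rotation by $\pi/2$ (i.e., under permutations and sign changes of the coordinates). For $\mu\in(0,1]$ and $d>2$, the lattice Green function is $$C_\mu(x)=\int_{\mathbb{T}^d}\frac{e^{-ik\cdot x}}{1-\mu\hat D(k)}\frac{dk}{(2\pi)^d},\qquad D(x)=\tfrac{1}{2d}\mathbf{1}_{|x|=1},\quad \hat D(k)=d^{-1}\sum_{j=1}^d\cos k_j .$$ *)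

theory Defs
  imports "HOL-Analysis.Analysis"
begin

text \<open>The lattice of dimension \<open>d = CARD('d)\<close> is the type \<open>int ^ 'd\<close>;
  \<open>emb\<close> embeds it into Euclidean space, which provides norms and inner products.\<close>

definition emb :: "int ^ 'd \<Rightarrow> real ^ 'd" where
  "emb x = (\<chi> i. real_of_int (x $ i))"

text \<open>The torus, identified with its fundamental domain \<open>(-\<pi>, \<pi>]\<close> in each coordinate.\<close>

definition torus :: "(real ^ 'd) set" where
  "torus = {k. \<forall>i. - pi < k $ i \<and> k $ i \<le> pi}"

definition lattice_symmetric :: "(int ^ 'd \<Rightarrow> 'a) \<Rightarrow> bool" where
  "lattice_symmetric f \<longleftrightarrow>
     (\<forall>p e x. p permutes (UNIV :: 'd set) \<longrightarrow> (\<forall>i. e i \<in> {1, - 1}) \<longrightarrow>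
        f (\<chi> i. e i * x $ p i) = f x)"

text \<open>The Fourier transform is complex-valued in general; it is real for symmetric
  functions (see \<open>fourier_symmetric_real\<close> below).\<close>

definition fourier :: "(int ^ 'd \<Rightarrow> real) \<Rightarrow> real ^ 'd \<Rightarrow> complex" where
  "fourier f k = (\<Sum>\<^sub>\<infinity>x. of_real (f x) * exp (\<i> * of_real (k \<bullet> emb x)))"

definition conv :: "(int ^ 'd \<Rightarrow> complex) \<Rightarrow> (int ^ 'd \<Rightarrow> complex) \<Rightarrow> int ^ 'd \<Rightarrow> complex" where
  "conv f g x = (\<Sum>\<^sub>\<infinity>y. f y * g (x - y))"

definition kron :: "int ^ 'd \<Rightarrow> complex" where
  "kron x = (if x = 0 then 1 else 0)"

definition inv_fourier_integrand ::
    "(real ^ 'd \<Rightarrow> complex) \<Rightarrow> int ^ 'd \<Rightarrow> real ^ 'd \<Rightarrow> complex" where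
  "inv_fourier_integrand h x k =
     exp (- \<i> * of_real (k \<bullet> emb x)) * h k / of_real ((2 * pi) ^ CARD('d))"

definition inv_fourier :: "(real ^ 'd \<Rightarrow> complex) \<Rightarrow> int ^ 'd \<Rightarrow> complex" where
  "inv_fourier h x = (LINT k:torus|lborel. inv_fourier_integrand h x k)"

definition step_dist :: "int ^ 'd \<Rightarrow> real" where
  "step_dist x = (if norm (emb x) = 1 then 1 / (2 * real CARD('d)) else 0)"

definition lattice_green :: "real \<Rightarrow> int ^ 'd \<Rightarrow> complex" where
  "lattice_green \<mu> = inv_fourier (\<lambda>k. 1 / (1 - of_real \<mu> * fourier step_dist k))"

definition second_moment :: "(int ^ 'd \<Rightarrow> real) \<Rightarrow> real" where
  "second_moment f = (\<Sum>\<^sub>\<infinity>x. (norm (emb x))\<^sup>2 * f x)"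

definition lam :: "(int ^ 'd \<Rightarrow> real) \<Rightarrow> real" where
  "lam F = 1 / (Re (fourier F 0) - second_moment F)"

definition mu :: "(int ^ 'd \<Rightarrow> real) \<Rightarrow> real" where
  "mu F = 1 - lam F * Re (fourier F 0)"

definition green :: "(int ^ 'd \<Rightarrow> real) \<Rightarrow> int ^ 'd \<Rightarrow> complex" where
  "green F = inv_fourier (\<lambda>k. 1 / fourier F k)"

lemma emb_uminus: "emb (- x) = - emb x"
  by (simp add: emb_def vec_eq_iff)

lemma lattice_symmetric_even:
  assumes "lattice_symmetric f"
  shows "f (- x) = f x"
proof -
  have "f (\<chi> i. (- 1) * x $ id i) = f x"
    using assms permutes_id[of UNIV] unfolding lattice_symmetric_def
    by (auto elim!: allE[of _ id] allE[of _ "\<lambda>_. - 1"])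
  moreover have "(\<chi> i. (- 1) * x $ id i) = - x"
    by (simp add: vec_eq_iff)
  ultimately show ?thesis by simp
qed

lemma fourier_symmetric_real:
  assumes "lattice_symmetric f"
  shows "fourier f k = of_real (Re (fourier f k))"
proof -
  let ?g = "\<lambda>x. of_real (f x) * exp (\<i> * of_real (k \<bullet> emb x)) :: complex"
  have "cnj (fourier f k) = (\<Sum>\<^sub>\<infinity>x. cnj (?g x))"
    by (simp only: fourier_def infsum_cnj)
  also have "\<dots> = (\<Sum>\<^sub>\<infinity>x. ?g (- x))"
    by (rule infsum_cong)
      (simp add: emb_uminus lattice_symmetric_even[OF assms] exp_cnj)
  also have "\<dots> = fourier f k"
    unfolding fourier_def
    by (rule infsum_reindex_bij_witness[where i = uminus and j = uminus]) auto
  finally show ?thesis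
    by (metis Reals_cnj_iff of_real_Re)
qed

lemma norm_emb_eq_1_iff:
  "norm (emb x) = 1 \<longleftrightarrow> (\<exists>j. x = axis j 1 \<or> x = axis j (- 1))"
proof
  assume "norm (emb x) = 1"
  hence "real_of_int (\<Sum>i\<in>UNIV. (x $ i)\<^sup>2) = real_of_int 1"
    by (simp add: norm_vec_def L2_set_def emb_def)
  hence s: "(\<Sum>i\<in>UNIV. (x $ i)\<^sup>2) = 1"
    by linarith
  obtain j where j: "x $ j \<noteq> 0"
    using s by (metis (no_types, lifting) sum.neutral zero_neq_one power_zero_numeral)
  have split: "(x $ j)\<^sup>2 + (\<Sum>i\<in>UNIV - {j}. (x $ i)\<^sup>2) = 1"
    using s by (simp add: sum.remove[of UNIV j])
  have nn: "(\<Sum>i\<in>UNIV - {j}. (x $ i)\<^sup>2) \<ge> 0"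
    by (rule sum_nonneg) simp
  have pos: "(x $ j)\<^sup>2 \<ge> 1"
    using j by (simp add: int_one_le_iff_zero_less)
  have one: "(x $ j)\<^sup>2 = 1" and zero: "(\<Sum>i\<in>UNIV - {j}. (x $ i)\<^sup>2) = 0"
    using split nn pos by linarith+
  have z: "x $ i = 0" if "i \<noteq> j" for i
    using zero that by (simp add: sum_nonneg_eq_0_iff)
  have "x $ j = 1 \<or> x $ j = - 1"
    using one by (simp add: power2_eq_1_iff)
  thus "\<exists>j. x = axis j 1 \<or> x = axis j (- 1)"
    using z by (intro exI[of _ j]) (auto simp: vec_eq_iff axis_def)
next
  assume "\<exists>j. x = axis j 1 \<or> x = axis j (- 1)"
  then obtain j where "x = axis j 1 \<or> x = axis j (- 1)" by blast
  hence "emb x = axis j 1 \<or> emb x = axis j (- 1)"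
    by (auto simp: emb_def axis_def vec_eq_iff)
  thus "norm (emb x) = 1"
    by (auto simp: norm_eq_1 inner_axis_axis)
qed

lemma fourier_step_dist:
  "fourier step_dist (k :: real ^ 'd) = of_real ((\<Sum>j\<in>UNIV. cos (k $ j)) / real CARD('d))"
proof -
  let ?g = "\<lambda>x. of_real (step_dist x) * exp (\<i> * of_real (k \<bullet> emb x)) :: complex"
  let ?A = "range (\<lambda>j :: 'd. axis j (1 :: int))"
  let ?B = "range (\<lambda>j :: 'd. axis j (- 1 :: int))"
  have emb_axis: "emb (axis j a) = axis j (real_of_int a)" for j :: 'd and a
    by (auto simp: emb_def axis_def vec_eq_iff)
  have inj: "inj (\<lambda>j :: 'd. axis j a)" if "a \<noteq> 0" for a :: int
    using that by (auto simp: inj_on_def axis_eq_axis)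
  have val: "?g (axis j a) = exp (\<i> * of_real (k $ j * of_int a)) / of_nat (2 * CARD('d))"
    if "a = 1 \<or> a = - 1" for j a
  proof -
    have "norm (emb (axis j a)) = 1"
      using that norm_emb_eq_1_iff by blast
    thus ?thesis
      by (simp add: step_dist_def emb_axis inner_axis)
  qed
  have "fourier step_dist k = infsum ?g (?A \<union> ?B)"
    unfolding fourier_def
    by (rule infsum_cong_neutral) (auto simp: step_dist_def norm_emb_eq_1_iff)
  also have "\<dots> = sum ?g (?A \<union> ?B)"
    by (rule infsum_finite) simp
  also have "\<dots> = sum ?g ?A + sum ?g ?B"
    by (rule sum.union_disjoint) (auto simp: axis_eq_axis)
  also have "\<dots> = (\<Sum>j\<in>UNIV. ?g (axis j 1)) + (\<Sum>j\<in>UNIV. ?g (axis j (- 1)))"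
    by (subst (1 2) sum.reindex) (auto simp: inj)
  also have "\<dots> = (\<Sum>j\<in>UNIV. ?g (axis j 1) + ?g (axis j (- 1)))"
    by (rule sum.distrib[symmetric])
  also have "\<dots> = (\<Sum>j\<in>UNIV. of_real (cos (k $ j)) / of_nat CARD('d))"
  proof (rule sum.cong)
    fix j :: 'd
    have "exp (\<i> * of_real (k $ j)) + exp (\<i> * of_real (- (k $ j))) = 2 * of_real (cos (k $ j))"
      by (simp add: complex_eq_iff Re_exp Im_exp)
    moreover have "?g (axis j 1) = exp (\<i> * of_real (k $ j)) / of_nat (2 * CARD('d))"
      using val[of 1 j] by simp
    moreover have "?g (axis j (- 1)) = exp (\<i> * of_real (- (k $ j))) / of_nat (2 * CARD('d))"
      using val[of "- 1" j] by simp
    ultimately have "?g (axis j 1) + ?g (axis j (- 1))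
        = 2 * of_real (cos (k $ j)) / of_nat (2 * CARD('d))"
      by (simp only: add_divide_distrib[symmetric])
    thus "?g (axis j 1) + ?g (axis j (- 1)) = of_real (cos (k $ j)) / of_nat CARD('d)"
      by simp
  qed simp
  finally show ?thesis
    by (simp add: sum_divide_distrib)
qed

end

theory Submission
  imports Defs
begin

text \<open>
  Write \<open>A = \<delta> - \<mu> D\<close>, \<open>C\<close> for the lattice Green function, so \<open>A * C = \<delta>\<close>, and
  \<open>E = A - \<lambda> F\<close>. The choice of \<open>\<lambda>\<close> and \<open>\<mu>\<close> makes the zeroth and second moments of \<open>E\<close>
  vanish, while odd moments vanish by symmetry. A discrete Taylor expansion to fourth order therefore
  shows that \<open>h = E * C\<close> decays like \<open>\<bar>x\<bar> powr - (d + s)\<close>. Now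
  \<open>\<delta> - h = \<lambda> F * C\<close> has the transform \<open>\<lambda> F^ / A^\<close>, which is real and bounded away from
  \<open>0\<close> and infinity, so by a quantitative Wiener lemma it has a convolution inverse
  \<open>\<delta> + h'\<close> with the same decay. Hence \<open>G - \<lambda> C = \<lambda> h' * C\<close>, and since \<open>h'\<close> has
  mean zero this gains \<open>s\<close> powers of decay over \<open>C\<close>. The bounds on \<open>C\<close> and its second and
  fourth differences, uniform in \<open>\<mu>\<close>, come from \<open>1 / A^ = \<integral> exp (- t A^) dt\<close>: the integrand
  factorizes into one-dimensional heat kernels, and summing over scales \<open>t\<close> replaces any analysis
  of the singularity of \<open>1 / A^\<close>.
  All arguments lose an arbitrarily small power, which the strict bound on \<open>s\<close> absorbs; this lets
  every lattice sum be controlled by the single convergent sum \<open>jbsum\<close>.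
\<close>

section \<open>The weight on the lattice\<close>

text \<open>Decay with a non-integer exponent has no convenient description by derivatives of a
  transform, so decay is always proved on the lattice; transforms only serve for identities and
  spectral bounds. Two obstacles shape the rest. The Green function \<open>C\<close> is not summable
  and has no transform in the sense of \<open>cfourier\<close>, so identities involving it pair a
  summable kernel with an integrable symbol. And for \<mu> = 1 both \<open>A^\<close> and
  \<open>F^\<close> vanish at 0, so the quotient \<open>E^ / A^\<close> does not determine
  \<open>h^\<close> there; its value 0, which makes \<open>h'\<close> have mean zero, comes from
  continuity and an expansion along one axis. The Neumann series of \<open>\<delta> - h\<close> need
  not converge in l1, since only the spectrum is controlled; after division by an upper bound
  \<open>M\<close> of \<open>1 - h^\<close> the spectral radius is below 1 and iterated squaring
  works. The exponents form a chain s \<le> s1 < s2 < min \<rho> 2: the decay of \<open>h\<close>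
  costs the last gap, the convolution of \<open>h'\<close> with \<open>C\<close> the middle one.
  Every constant is chosen before F, from bounds on \<lambda> and \<mu> that involve only d, K1, K2
  and \<rho>.\<close>

definition jb :: "int ^ 'd \<Rightarrow> real" where
  "jb x = max (norm (emb x)) 1"

lemma emb_0 [simp]: "emb 0 = 0"
  by (simp add: emb_def vec_eq_iff)

lemma emb_add: "emb (x + y) = emb x + emb y"
  by (simp add: emb_def vec_eq_iff)

lemma emb_diff: "emb (x - y) = emb x - emb y"
  by (simp add: emb_def vec_eq_iff)

lemma emb_nth [simp]: "emb x $ i = real_of_int (x $ i)"
  by (simp add: emb_def)

lemma jb_ge_1: "jb x \<ge> 1" and jb_pos [simp]: "jb x > 0" and jb_nonneg [simp]: "jb x \<ge> 0"
  and norm_emb_le_jb: "norm (emb x) \<le> jb x"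
  by (auto simp: jb_def)

lemma jb_0 [simp]: "jb 0 = 1"
  by (simp add: jb_def)

lemma abs_nth_le_jb: "\<bar>real_of_int (x $ i)\<bar> \<le> jb x"
  using component_le_norm_cart[of "emb x" i] norm_emb_le_jb[of x] by simp

lemma jb_le_diff: "jb x \<le> jb y + jb (x - y)"
  using norm_triangle_ineq[of "emb y" "emb (x - y)"] by (auto simp: jb_def emb_diff max_def)

lemma jb_powr_mono: "a \<le> b \<Longrightarrow> jb x powr a \<le> jb x powr b"
  using jb_ge_1[of x] by (intro powr_mono) auto

lemma jb_powr_le_1: "a \<le> 0 \<Longrightarrow> jb x powr a \<le> 1"
  using jb_powr_mono[of a 0 x] jb_pos[of x] by (simp add: less_imp_neq[symmetric] del: jb_pos)

lemma summable_on_int_powr: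
  assumes "a > 0"
  shows "(\<lambda>m::int. max 1 \<bar>real_of_int m\<bar> powr - (1 + a)) summable_on UNIV"
proof -
  define g where "g = (\<lambda>m::int. max 1 \<bar>real_of_int m\<bar> powr - (1 + a))"
  have "summable (\<lambda>n. real n powr - (1 + a))"
    using assms by (simp add: summable_real_powr_iff)
  hence "summable (\<lambda>n. g (int n))"
    by (rule summable_comparison_test_ev[rotated])
      (auto simp: g_def eventually_sequentially max_def intro!: exI[of _ 1])
  hence s: "(\<lambda>n. g (int n)) summable_on UNIV"
    by (intro summable_nonneg_imp_summable_on) (auto simp: g_def)
  hence 1: "g summable_on range int"
    by (subst summable_on_reindex) (auto simp: o_def)
  have "(\<lambda>n. g (- int n)) summable_on UNIV"
    using s by (simp add: g_def)
  hence 2: "g summable_on range (\<lambda>n. - int n)"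
    by (subst summable_on_reindex) (auto simp: o_def inj_on_def)
  have "range int \<union> range (\<lambda>n. - int n) = UNIV"
    by (auto simp: image_iff) (metis int_cases2)
  thus ?thesis
    using summable_on_union[OF 1 2] by (simp add: g_def)
qed

text \<open>Every |x_j| is at most \<open>jb x\<close>, so the weight is dominated by a product of
  one-dimensional weights of exponent \<open>1 + e / D\<close>; finite partial sums are enlarged to
  boxes, where the product factorizes.\<close>

lemma summable_jb_powr:
  assumes "e > 0"
  shows "(\<lambda>x::int^'d. jb x powr - (real CARD('d) + e)) summable_on UNIV"
proof -
  define D where "D = real CARD('d)"
  have D: "D > 0" by (simp add: D_def)
  define g where "g = (\<lambda>m::int. max 1 \<bar>real_of_int m\<bar> powr - (1 + e / D))"
  define Z where "Z = infsum g UNIV"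
  have g0: "g m \<ge> 0" for m by (simp add: g_def)
  have sg: "g summable_on UNIV"
    unfolding g_def using assms D by (intro summable_on_int_powr) auto
  have le: "jb x powr - (D + e) \<le> (\<Prod>j\<in>UNIV. g (x $ j))" for x :: "int^'d"
  proof -
    have "jb x powr - (D + e) = jb x powr (- (1 + e / D) * D)"
    proof -
      have "- (D + e) = - (1 + e / D) * D" using D by (simp add: divide_simps algebra_simps)
      thus ?thesis by (rule arg_cong)
    qed
    also have "\<dots> = (\<Prod>j\<in>(UNIV::'d set). jb x powr - (1 + e / D))"
      by (simp add: powr_powr[symmetric] powr_realpow D_def less_imp_neq[symmetric])
    also have "\<dots> \<le> (\<Prod>j\<in>UNIV. g (x $ j))"
      using assms D abs_nth_le_jb[of x] jb_ge_1[of x]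
      by (intro prod_mono) (auto simp: g_def intro!: powr_mono2' order.trans[of "-1" 0 "e / D"])
    finally show ?thesis .
  qed
  have "(\<lambda>x::int^'d. \<Prod>j\<in>UNIV. g (x $ j)) summable_on UNIV"
  proof (rule nonneg_bdd_above_summable_on)
    show "bdd_above (sum (\<lambda>x::int^'d. \<Prod>j\<in>UNIV. g (x $ j)) ` {F. F \<subseteq> UNIV \<and> finite F})"
    proof (rule bdd_aboveI2)
      fix S :: "(int^'d) set" assume "S \<in> {F. F \<subseteq> UNIV \<and> finite F}"
      hence S: "finite S" by simp
      define T where "T = (\<Union>x\<in>S. range (\<lambda>j. x $ j))"
      have T: "finite T" using S by (auto simp: T_def)
      have "(\<Sum>x\<in>S. \<Prod>j\<in>UNIV. g (x $ j)) = (\<Sum>f\<in>($) ` S. \<Prod>j\<in>UNIV. g (f j))"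
        by (subst sum.reindex) (auto simp: inj_on_def vec_eq_iff)
      also have "\<dots> \<le> (\<Sum>f\<in>PiE (UNIV::'d set) (\<lambda>_. T). \<Prod>j\<in>UNIV. g (f j))"
      proof (rule sum_mono2)
        show "finite (PiE (UNIV::'d set) (\<lambda>_. T))" using T by (intro finite_PiE) auto
      qed (auto simp: T_def intro!: prod_nonneg g0)
      also have "\<dots> = (\<Prod>j\<in>(UNIV::'d set). \<Sum>m\<in>T. g m)"
        using T by (subst prod_sum_PiE) auto
      also have "\<dots> \<le> Z ^ CARD('d)"
        using T by (subst prod_constant)
          (auto intro!: power_mono sum_nonneg g0 finite_sum_le_infsum sg simp: Z_def)
      finally show "(\<Sum>x\<in>S. \<Prod>j\<in>UNIV. g (x $ j)) \<le> Z ^ CARD('d)" .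
    qed
  qed (auto intro!: prod_nonneg g0)
  hence "(\<lambda>x::int^'d. jb x powr - (D + e)) summable_on UNIV"
    by (rule summable_on_comparison_test) (use le in auto)
  thus ?thesis by (simp add: D_def)
qed

text \<open>The \<open>itself\<close> argument carries the dimension, which the real argument cannot
  determine.\<close>

definition jbsum :: "'d::finite itself \<Rightarrow> real \<Rightarrow> real" where
  "jbsum _ e = (\<Sum>\<^sub>\<infinity>x::int^'d. jb x powr - (real CARD('d) + e))"

lemma jbsum_nonneg: "jbsum TYPE('d::finite) e \<ge> 0"
  unfolding jbsum_def by (rule infsum_nonneg) auto

section \<open>Convolution and the Fourier transform\<close>

text \<open>Counterpart of \<open>fourier\<close> for complex kernels: the corrections and inverses
  below are produced by complex integrals.\<close>

definition cfourier :: "(int ^ 'd \<Rightarrow> complex) \<Rightarrow> real ^ 'd \<Rightarrow> complex" where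
  "cfourier f k = (\<Sum>\<^sub>\<infinity>x. f x * exp (\<i> * of_real (k \<bullet> emb x)))"

abbreviation l1 :: "(int ^ 'd \<Rightarrow> complex) \<Rightarrow> bool" where
  "l1 f \<equiv> (\<lambda>x. norm (f x)) summable_on UNIV"

lemma fourier_cfourier: "fourier f k = cfourier (\<lambda>x. of_real (f x)) k"
  by (simp add: fourier_def cfourier_def)

lemma norm_exp_i_real [simp]: "norm (exp (\<i> * of_real r)) = 1" "norm (exp (- (\<i> * of_real r))) = 1"
  using norm_exp_i_times[of r] norm_exp_i_times[of "-r"] by auto

lemma l1_summable: "l1 f \<Longrightarrow> f summable_on UNIV"
  by (rule abs_summable_summable)

lemma l1_char: "l1 f \<Longrightarrow> (\<lambda>x. f x * exp (\<i> * of_real (k \<bullet> emb x))) summable_on UNIV"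
  by (rule abs_summable_summable) (simp add: norm_mult)

lemma l1_bound:
  assumes "\<And>x::int^'d. norm (f x) \<le> B * jb x powr - (real CARD('d) + e)" "e > 0"
  shows "l1 f" "(\<Sum>\<^sub>\<infinity>x. norm (f x)) \<le> B * jbsum TYPE('d) e"
proof -
  have s: "(\<lambda>x::int^'d. B * jb x powr - (real CARD('d) + e)) summable_on UNIV"
    by (intro summable_on_cmult_right summable_jb_powr assms)
  show 1: "l1 f"
    by (rule summable_on_comparison_test[OF s]) (use assms in auto)
  have "(\<Sum>\<^sub>\<infinity>x. norm (f x)) \<le> (\<Sum>\<^sub>\<infinity>x::int^'d. B * jb x powr - (real CARD('d) + e))"
    by (rule infsum_mono[OF 1 s]) (use assms in auto)
  also have "\<dots> = B * jbsum TYPE('d) e"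
    by (simp add: infsum_cmult_right' jbsum_def)
  finally show "(\<Sum>\<^sub>\<infinity>x. norm (f x)) \<le> B * jbsum TYPE('d) e" .
qed

lemma norm_cfourier_le: "l1 f \<Longrightarrow> norm (cfourier f k) \<le> (\<Sum>\<^sub>\<infinity>x. norm (f x))"
  unfolding cfourier_def by (rule order.trans[OF norm_infsum_bound]) (auto simp: norm_mult)

lemma cfourier_0: "cfourier f 0 = infsum f UNIV"
  by (simp add: cfourier_def)

lemma cfourier_add: "l1 f \<Longrightarrow> l1 g \<Longrightarrow> cfourier (\<lambda>x. f x + g x) k = cfourier f k + cfourier g k"
  unfolding cfourier_def by (simp add: algebra_simps infsum_add l1_char)

lemma cfourier_cmult: "cfourier (\<lambda>x. c * f x) k = c * cfourier f k"
  unfolding cfourier_def by (simp add: mult.assoc infsum_cmult_right')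

lemma cfourier_kron: "cfourier kron k = 1"
proof -
  have "cfourier kron k = (\<Sum>\<^sub>\<infinity>x\<in>{0}. kron x * exp (\<i> * of_real (k \<bullet> emb x)))"
    unfolding cfourier_def by (rule infsum_cong_neutral) (auto simp: kron_def)
  thus ?thesis by (simp add: kron_def)
qed

lemma l1_kron: "l1 kron"
proof -
  have "(\<lambda>x. norm (kron x)) summable_on {0}" by simp
  thus ?thesis
    by (subst summable_on_cong_neutral[where T = "{0}"]) (auto simp: kron_def)
qed

text \<open>Tonelli: for fixed y the sum over x of \<open>norm (g (x - y))\<close> does not depend
  on y. This joint summability yields both that l1 is closed under convolution and the exchange of
  sums in the convolution theorem.\<close>

lemma conv_abs_summable_Sigma:
  fixes f g :: "int^'d \<Rightarrow> complex"
  assumes "l1 f" "l1 g"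
  shows "(\<lambda>(y, x). norm (f y * g (x - y))) summable_on UNIV \<times> UNIV"
proof -
  have "(\<lambda>p. norm (case p of (y, x) \<Rightarrow> f y * g (x - y))) summable_on Sigma UNIV (\<lambda>_. UNIV)"
  proof (subst Infinite_Sum.abs_summable_on_Sigma_iff, intro conjI ballI)
    have sh: "(\<lambda>x. norm (g (x - y))) summable_on UNIV" for y
      using assms(2) by (subst summable_on_reindex_bij_witness[where i = "\<lambda>x. x + y" and j = "\<lambda>x. x - y" and h = "\<lambda>x. norm (g x)" and T = UNIV]) auto
    show "(\<lambda>x. norm (case (y, x) of (y, x) \<Rightarrow> f y * g (x - y))) summable_on UNIV" for y
      by (simp add: norm_mult summable_on_cmult_right sh)
    have e: "(\<Sum>\<^sub>\<infinity>x. norm (g (x - y))) = (\<Sum>\<^sub>\<infinity>x. norm (g x))" for y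
      by (rule infsum_reindex_bij_witness[where i = "\<lambda>x. x + y" and j = "\<lambda>x. x - y"]) auto
    show "(\<lambda>y. norm (\<Sum>\<^sub>\<infinity>x. norm (case (y, x) of (y, x) \<Rightarrow> f y * g (x - y)))) summable_on UNIV"
      using assms(1) by (simp add: norm_mult infsum_cmult_right' e abs_mult infsum_nonneg summable_on_cmult_left)
  qed
  thus ?thesis by (simp add: case_prod_unfold)
qed

lemma l1_conv:
  fixes f g :: "int^'d \<Rightarrow> complex"
  assumes "l1 f" "l1 g"
  shows "l1 (conv f g)"
proof -
  have "(\<lambda>(y, x). norm (f y * g (x - y))) summable_on UNIV \<times> UNIV"
    by (rule conv_abs_summable_Sigma[OF assms])
  hence sw: "(\<lambda>(x, y). norm (f y * g (x - y))) summable_on UNIV \<times> UNIV"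
    by (subst (asm) summable_on_swap) simp
  hence "(\<lambda>x. \<Sum>\<^sub>\<infinity>y. norm (f y * g (x - y))) summable_on UNIV"
    by (rule summable_on_Sigma_banach)
  thus ?thesis
  proof (rule summable_on_comparison_test)
    fix x
    have "(\<lambda>y. norm (f y * g (x - y))) summable_on UNIV"
      using summable_on_SigmaD1[OF sw, of x] by simp
    thus "norm (conv f g x) \<le> (\<Sum>\<^sub>\<infinity>y. norm (f y * g (x - y)))"
      unfolding conv_def by (rule norm_infsum_bound)
  qed auto
qed

lemma cfourier_conv:
  fixes f g :: "int^'d \<Rightarrow> complex"
  assumes "l1 f" "l1 g"
  shows "cfourier (conv f g) k = cfourier f k * cfourier g k"
proof -
  let ?e = "\<lambda>x::int^'d. exp (\<i> * of_real (k \<bullet> emb x))"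
  have "(\<lambda>(y, x). f y * g (x - y) * ?e x) summable_on UNIV \<times> UNIV"
    by (rule abs_summable_summable)
      (use conv_abs_summable_Sigma[OF assms] in \<open>simp add: norm_mult case_prod_unfold\<close>)
  hence "(\<Sum>\<^sub>\<infinity>y. \<Sum>\<^sub>\<infinity>x. f y * g (x - y) * ?e x) = (\<Sum>\<^sub>\<infinity>x. \<Sum>\<^sub>\<infinity>y. f y * g (x - y) * ?e x)"
    by (rule infsum_swap_banach)
  also have "\<dots> = cfourier (conv f g) k"
    by (simp add: cfourier_def conv_def infsum_cmult_left')
  finally have "cfourier (conv f g) k = (\<Sum>\<^sub>\<infinity>y. \<Sum>\<^sub>\<infinity>x. f y * g (x - y) * ?e x)" ..
  also have "\<dots> = (\<Sum>\<^sub>\<infinity>y. f y * ?e y * cfourier g k)"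
  proof (rule infsum_cong)
    fix y
    have "(\<Sum>\<^sub>\<infinity>x. f y * g (x - y) * ?e x) = (\<Sum>\<^sub>\<infinity>x. f y * ?e y * (g x * ?e x))"
      by (rule infsum_reindex_bij_witness[where i = "\<lambda>x. x + y" and j = "\<lambda>x. x - y"])
        (auto simp: emb_diff inner_diff_right exp_diff algebra_simps)
    thus "(\<Sum>\<^sub>\<infinity>x. f y * g (x - y) * ?e x) = f y * ?e y * cfourier g k"
      by (simp add: infsum_cmult_right' cfourier_def)
  qed
  also have "\<dots> = cfourier f k * cfourier g k"
    by (simp add: infsum_cmult_left' cfourier_def)
  finally show ?thesis .
qed

text \<open>Weierstrass M-test over finite subsets. Continuity later fixes the value of a transform
  at 0, where a defining quotient degenerates.\<close>

lemma continuous_on_cfourier: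
  assumes "l1 f"
  shows "continuous_on UNIV (cfourier f)"
proof -
  have "uniform_limit UNIV (\<lambda>X k. \<Sum>x\<in>X. f x * exp (\<i> * of_real (k \<bullet> emb x)))
      (\<lambda>k. \<Sum>\<^sub>\<infinity>x. f x * exp (\<i> * of_real (k \<bullet> emb x))) (finite_subsets_at_top UNIV)"
    by (rule Weierstrass_m_test_general[OF _ assms]) (auto simp: norm_mult)
  hence "continuous_on UNIV (\<lambda>k. \<Sum>\<^sub>\<infinity>x. f x * exp (\<i> * of_real (k \<bullet> emb x)))"
    by (rule uniform_limit_theorem[rotated]) (auto intro!: always_eventually continuous_intros)
  thus ?thesis by (simp add: cfourier_def[abs_def])
qed

lemma borel_measurable_cfourier: "l1 f \<Longrightarrow> cfourier f \<in> borel_measurable borel"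
  using continuous_on_cfourier by (rule borel_measurable_continuous_onI)

section \<open>Integrals over the torus\<close>

text \<open>Fubini for product functions. Lebesgue measure on \<open>real^'d\<close> is the image of
  a product measure indexed by basis vectors, not by coordinates, so the factors are transported
  along the bijection from j to \<open>axis j 1\<close>.\<close>

lemma lborel_vec_prod:
  fixes f :: "'d::finite \<Rightarrow> real \<Rightarrow> complex"
  assumes "\<And>j. integrable lborel (f j)"
  shows "integrable lborel (\<lambda>k::real^'d. \<Prod>j\<in>UNIV. f j (k $ j))"
    and "(LINT k|lborel. (\<Prod>j\<in>UNIV. f j ((k::real^'d) $ j))) = (\<Prod>j\<in>UNIV. LINT t|lborel. f j t)"
proof -
  let ?B = "Basis :: (real^'d) set"
  let ?g = "\<lambda>f :: real^'d \<Rightarrow> real. \<Sum>b\<in>?B. f b *\<^sub>R b"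
  interpret product_sigma_finite "\<lambda>_::real^'d. lborel :: real measure"
    by unfold_locales
  have bij: "bij_betw (\<lambda>j::'d. axis j (1::real)) UNIV ?B"
    by (auto simp: bij_betw_def inj_on_def axis_eq_axis Basis_vec_def)
  define F where "F = (\<lambda>b. f (inv_into UNIV (\<lambda>j::'d. axis j (1::real)) b))"
  have F: "F (axis j 1) = f j" for j
    using bij unfolding F_def by (subst inv_into_f_f) (auto simp: bij_betw_def)
  have eq: "(\<Prod>j\<in>UNIV. f j (k $ j)) = (\<Prod>b\<in>?B. F b (k \<bullet> b))" for k :: "real^'d"
    by (subst prod.reindex_bij_betw[OF bij, symmetric]) (simp add: F cart_eq_inner_axis)
  have intF: "integrable lborel (F b)" for b
    using assms by (simp add: F_def)
  have meas: "(\<lambda>k::real^'d. \<Prod>b\<in>?B. F b (k \<bullet> b)) \<in> borel_measurable borel"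
  proof (rule borel_measurable_prod)
    fix b :: "real^'d"
    have "F b \<in> borel_measurable borel" using borel_measurable_integrable[OF intF, of b] by simp
    thus "(\<lambda>k. F b (k \<bullet> b)) \<in> borel_measurable borel" by measurable
  qed
  have g: "?g \<in> measurable (\<Pi>\<^sub>M b\<in>?B. lborel) borel" by measurable
  have c: "(\<Prod>b\<in>?B. F b (?g x \<bullet> b)) = (\<Prod>b\<in>?B. F b (x b))" for x
    by (rule prod.cong) (auto simp: inner_sum_left_Basis)
  show "integrable lborel (\<lambda>k::real^'d. \<Prod>j\<in>UNIV. f j (k $ j))"
    unfolding eq
    by (subst lborel_eq, subst integrable_distr_eq[OF g meas], subst c)
      (intro product_integrable_prod intF finite_Basis)
  have "(LINT k|lborel. (\<Prod>j\<in>UNIV. f j ((k::real^'d) $ j))) = (\<Prod>b\<in>?B. LINT t|lborel. F b t)"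
    unfolding eq
    by (subst lborel_eq, subst integral_distr[OF g meas], subst c)
      (intro product_integral_prod intF finite_Basis)
  also have "\<dots> = (\<Prod>j\<in>UNIV. LINT t|lborel. f j t)"
    by (subst prod.reindex_bij_betw[OF bij, symmetric]) (simp add: F)
  finally show "(LINT k|lborel. (\<Prod>j\<in>UNIV. f j ((k::real^'d) $ j))) = (\<Prod>j\<in>UNIV. LINT t|lborel. f j t)" .
qed

lemma indicator_torus: "indicator torus k = (\<Prod>j\<in>UNIV. indicator {- pi<..pi} (k $ j) :: 'a::comm_semiring_1)"
proof (cases "k \<in> torus")
  case True
  thus ?thesis by (auto simp: torus_def)
next
  case False
  then obtain j where "k $ j \<notin> {-pi<..pi}" by (auto simp: torus_def)
  hence "(\<Prod>j\<in>UNIV. indicator {- pi<..pi} (k $ j)) = (0::'a)"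
    by (intro prod_zero) (auto intro!: exI[of _ j])
  with False show ?thesis by simp
qed

lemma torus_vec_prod:
  fixes f :: "'d::finite \<Rightarrow> real \<Rightarrow> complex"
  assumes "\<And>j. set_integrable lborel {-pi<..pi} (f j)"
  shows "set_integrable lborel torus (\<lambda>k::real^'d. \<Prod>j\<in>UNIV. f j (k $ j))"
    and "(LINT k:torus|lborel. (\<Prod>j\<in>UNIV. f j ((k::real^'d) $ j)))
         = (\<Prod>j\<in>UNIV. LINT t:{-pi<..pi}|lborel. f j t)"
proof -
  have eq: "indicator torus k *\<^sub>R (\<Prod>j\<in>UNIV. f j (k $ j))
      = (\<Prod>j\<in>UNIV. indicator {-pi<..pi} (k $ j) *\<^sub>R f j (k $ j))" for k :: "real^'d"
    by (simp add: indicator_torus scaleR_conv_of_real prod.distrib)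
  show "set_integrable lborel torus (\<lambda>k::real^'d. \<Prod>j\<in>UNIV. f j (k $ j))"
    unfolding set_integrable_def eq
    by (rule lborel_vec_prod) (use assms in \<open>simp add: set_integrable_def\<close>)
  show "(LINT k:torus|lborel. (\<Prod>j\<in>UNIV. f j ((k::real^'d) $ j)))
         = (\<Prod>j\<in>UNIV. LINT t:{-pi<..pi}|lborel. f j t)"
    unfolding set_lebesgue_integral_def eq
    by (rule lborel_vec_prod) (use assms in \<open>simp add: set_integrable_def\<close>)
qed

lemma torus_borel [measurable]: "torus \<in> sets (borel :: (real^'d::finite) measure)"
proof -
  have "(\<lambda>k::real^'d. indicator torus k :: real) \<in> borel_measurable borel"
    unfolding indicator_torus by measurable
  thus ?thesis by (simp add: borel_measurable_indicator_iff)
qed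

lemma torus_set_integrable_const: "set_integrable lborel (torus :: (real^'d::finite) set) (\<lambda>_. c :: complex)"
proof -
  have "set_integrable lborel (torus :: (real^'d::finite) set) (\<lambda>_. \<Prod>j\<in>(UNIV::'d set). 1 :: complex)"
    by (rule torus_vec_prod) (auto simp: set_integrable_def)
  hence "set_integrable lborel (torus :: (real^'d::finite) set) (\<lambda>_. c * 1)"
    by (intro set_integrable_mult_right) simp
  thus ?thesis by simp
qed

lemma emeasure_torus_finite: "emeasure lborel (torus :: (real^'d::finite) set) < \<infinity>"
proof (rule emeasure_bounded_finite)
  have "torus \<subseteq> cbox ((\<chi> i. - pi) :: real^'d) (\<chi> i. pi)"
    by (auto simp: torus_def mem_box_cart less_imp_le)
  thus "bounded (torus :: (real^'d) set)" using bounded_cbox bounded_subset by blast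
qed

lemma set_integrable_bound_mult:
  fixes f \<phi> :: "real^'d::finite \<Rightarrow> complex"
  assumes "set_integrable lborel torus \<phi>" "f \<in> borel_measurable borel" "\<And>k. k \<in> torus \<Longrightarrow> norm (f k) \<le> B"
  shows "set_integrable lborel torus (\<lambda>k. f k * \<phi> k)"
proof (rule set_integrable_bound)
  show "set_integrable lborel torus (\<lambda>k. complex_of_real B * \<phi> k)"
    by (intro set_integrable_mult_right assms)
  have "(\<lambda>k. indicator torus k *\<^sub>R \<phi> k) \<in> borel_measurable borel"
    using assms(1) unfolding set_integrable_def by (simp add: borel_measurable_integrable)
  hence "(\<lambda>k. f k * (indicator torus k *\<^sub>R \<phi> k)) \<in> borel_measurable borel"
    using assms(2) by measurable
  thus "set_borel_measurable lborel torus (\<lambda>k. f k * \<phi> k)"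
    by (simp add: set_borel_measurable_def)
  show "AE k in lborel. k \<in> torus \<longrightarrow> norm (f k * \<phi> k) \<le> norm (complex_of_real B * \<phi> k)"
    using assms(3) by (intro AE_I2) (auto simp: norm_mult intro!: mult_right_mono order.trans[OF _ abs_ge_self])
qed

lemma set_integrable_torus_bounded:
  fixes f :: "real^'d::finite \<Rightarrow> complex"
  assumes "f \<in> borel_measurable borel" "\<And>k. k \<in> torus \<Longrightarrow> norm (f k) \<le> B"
  shows "set_integrable lborel torus f"
  using set_integrable_bound_mult[OF torus_set_integrable_const assms, of 1] by simp

lemma set_integrable_inv_fourier:
  assumes "set_integrable lborel torus \<phi>"
  shows "set_integrable lborel torus (inv_fourier_integrand \<phi> x)"
proof -
  have "set_integrable lborel torus (\<lambda>k. (exp (- \<i> * of_real (k \<bullet> emb x)) / of_real ((2 * pi) ^ CARD('a))) * \<phi> k)"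
    by (rule set_integrable_bound_mult[OF assms, of _ "1 / (2 * pi) ^ CARD('a)"]) (auto simp: norm_divide norm_power norm_mult)
  thus ?thesis by (simp add: inv_fourier_integrand_def[abs_def] mult_ac)
qed

lemma inv_fourier_add:
  assumes "set_integrable lborel torus f" "set_integrable lborel torus g"
  shows "inv_fourier (\<lambda>k. f k + g k) x = inv_fourier f x + inv_fourier g x"
proof -
  have "inv_fourier_integrand (\<lambda>k. f k + g k) x = (\<lambda>k. inv_fourier_integrand f x k + inv_fourier_integrand g x k)"
    by (auto simp: inv_fourier_integrand_def algebra_simps add_divide_distrib)
  thus ?thesis
    using assms by (simp add: inv_fourier_def set_integral_add set_integrable_inv_fourier)
qed

lemma inv_fourier_cmult: "inv_fourier (\<lambda>k. c * f k) x = c * inv_fourier f x"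
proof -
  have "inv_fourier_integrand (\<lambda>k. c * f k) x = (\<lambda>k. c * inv_fourier_integrand f x k)"
    by (auto simp: inv_fourier_integrand_def algebra_simps)
  thus ?thesis
    by (simp add: inv_fourier_def set_integral_mult_right)
qed

text \<open>Symbols such as \<open>1 / ahat\<close> are only controlled off the origin, hence
  equality almost everywhere; the integrability assumptions supply measurability.\<close>

lemma inv_fourier_cong_AE:
  assumes "AE k in lborel. k \<in> torus \<longrightarrow> f k = g k"
  and "set_integrable lborel torus f" "set_integrable lborel torus g"
  shows "inv_fourier f x = inv_fourier g x"
  unfolding inv_fourier_def set_lebesgue_integral_def
proof (rule integral_cong_AE)
  show "AE k in lborel. indicator torus k *\<^sub>R inv_fourier_integrand f x k = indicator torus k *\<^sub>R inv_fourier_integrand g x k"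
    using assms(1) by eventually_elim (auto simp: inv_fourier_integrand_def indicator_def)
qed (use assms(2,3)[THEN set_integrable_inv_fourier] in \<open>simp_all add: set_integrable_def borel_measurable_integrable\<close>)

lemma norm_inv_fourier_le:
  fixes f :: "real^'d::finite \<Rightarrow> complex"
  assumes "set_integrable lborel torus f"
  shows "norm (inv_fourier f x) \<le> (LINT k:torus|lborel. norm (f k)) / (2 * pi) ^ CARD('d)"
proof -
  have "norm (inv_fourier f x) \<le> (LINT k:torus|lborel. norm (inv_fourier_integrand f x k))"
    unfolding inv_fourier_def set_lebesgue_integral_def
    by (rule order.trans[OF integral_norm_bound]) (simp add: indicator_def)
  also have "(\<lambda>k. norm (inv_fourier_integrand f x k)) = (\<lambda>k. norm (f k) / (2 * pi) ^ CARD('d))"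
    by (auto simp: inv_fourier_integrand_def norm_mult norm_divide norm_power)
  finally show ?thesis by (simp add: set_integral_divide_zero)
qed

lemma set_integral_torus_1:
  "(LINT k:(torus :: (real^'d::finite) set)|lborel. (1::real)) = (2 * pi) ^ CARD('d)"
proof -
  have "(LINT k:(torus :: (real^'d) set)|lborel. (\<Prod>j\<in>(UNIV::'d set). 1 :: complex))
      = (\<Prod>j\<in>(UNIV::'d set). LINT t:{-pi<..pi}|lborel. 1)"
    by (rule torus_vec_prod) (auto simp: set_integrable_def)
  hence "complex_of_real (LINT k:(torus :: (real^'d) set)|lborel. 1) = of_real ((2 * pi) ^ CARD('d))"
    unfolding set_integral_complex_of_real[symmetric]
    by (simp add: set_lebesgue_integral_def scaleR_conv_of_real)
  thus ?thesis by (simp only: of_real_eq_iff)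
qed

text \<open>The torus has total mass 1 after the division by
  \<open>(2 * pi) ^ CARD('d)\<close>.\<close>

lemma norm_inv_fourier_le_bound:
  fixes f :: "real^'d::finite \<Rightarrow> complex"
  assumes f: "set_integrable lborel torus f" and B: "\<And>k. k \<in> torus \<Longrightarrow> norm (f k) \<le> B"
  shows "norm (inv_fourier f x) \<le> B"
proof -
  have "(LINT k:torus|lborel. norm (f k)) \<le> (LINT k:(torus :: (real^'d) set)|lborel. B * 1)"
  proof (rule set_integral_mono)
    show "set_integrable lborel torus (\<lambda>k. norm (f k))" using f by (rule set_integrable_norm)
    have "set_integrable lborel (torus :: (real^'d) set) (\<lambda>_. norm (of_real B :: complex))"
      by (intro set_integrable_norm torus_set_integrable_const)
    have "emeasure lborel (torus :: (real^'d) set) < \<infinity>" by (rule emeasure_torus_finite)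
    thus "set_integrable lborel (torus :: (real^'d) set) (\<lambda>_. B * 1)"
      by (simp add: set_integrable_def)
  qed (use B in auto)
  also have "\<dots> = B * (2 * pi) ^ CARD('d)"
    by (subst set_integral_mult_right) (simp add: set_integral_torus_1)
  finally show ?thesis
    using norm_inv_fourier_le[OF f, of x] by (simp add: divide_simps) (auto simp: field_simps dest: order.trans)
qed

lemma AE_lborel_neq: "AE k in lborel. (k::'a::euclidean_space) \<noteq> c"
  by (rule AE_I[of _ _ "{c}"]) auto

text \<open>Fubini with the lattice sum read as an integral over counting measure. Summability is
  asked of \<open>f\<close> only; \<open>inv_fourier \<phi>\<close> is merely bounded, which admits
  the lattice Green function.\<close>

lemma conv_inv_fourier:
  fixes f :: "int^'d::finite \<Rightarrow> complex" and \<phi> :: "real^'d \<Rightarrow> complex"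
  assumes f: "l1 f" and \<phi>: "set_integrable lborel torus \<phi>"
  shows "conv f (inv_fourier \<phi>) x = inv_fourier (\<lambda>k. cfourier f k * \<phi> k) x"
proof -
  let ?M = "count_space (UNIV :: (int^'d) set)"
  let ?L = "lborel :: (real^'d) measure"
  interpret pair_sigma_finite ?M ?L
    by (intro pair_sigma_finite.intro sigma_finite_measure_count_space) unfold_locales
  define g where "g = (\<lambda>k. indicator torus k *\<^sub>R inv_fourier_integrand \<phi> x k)"
  define H where "H = (\<lambda>y k. f y * exp (\<i> * of_real (k \<bullet> emb y)) * g k)"
  have g: "integrable lborel g"
    using set_integrable_inv_fourier[OF \<phi>] by (simp add: set_integrable_def g_def)
  have gm [measurable]: "g \<in> borel_measurable borel" using borel_measurable_integrable[OF g] by simp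
  have fI: "Infinite_Set_Sum.abs_summable_on f UNIV"
    using f by (simp add: abs_summable_equivalent)
  have nH: "norm (H y k) = norm (f y) * norm (g k)" for y k
    by (simp add: H_def norm_mult)
  have intH2: "integrable lborel (\<lambda>k. H y k)" for y
  proof (rule Bochner_Integration.integrable_bound)
    show "integrable lborel (\<lambda>k. of_real (norm (f y)) * g k)" using g by simp
    show "(\<lambda>k. H y k) \<in> borel_measurable lborel" unfolding H_def by measurable
  qed (auto simp: nH norm_mult)
  have int: "integrable (?M \<Otimes>\<^sub>M ?L) (\<lambda>(y, k). H y k)"
  proof (rule Fubini_integrable)
    show "(\<lambda>(y, k). H y k) \<in> borel_measurable (?M \<Otimes>\<^sub>M ?L)"
      by (rule measurable_pair_measure_countable1) (use borel_measurable_integrable[OF intH2] in auto)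
    show "integrable ?M (\<lambda>y. LINT k|?L. norm (case (y, k) of (y, k) \<Rightarrow> H y k))"
      using fI by (simp add: nH Infinite_Set_Sum.abs_summable_on_def integrable_norm)
    show "AE y in ?M. integrable ?L (\<lambda>k. case (y, k) of (y, k) \<Rightarrow> H y k)"
      using intH2 by simp
  qed
  \<comment> \<open>Bridge between \<open>infsum\<close> and the Bochner integral over counting
    measure, which agree on absolutely summable families.\<close>
  have inf: "infsum F UNIV = (LINT y|?M. F y)" if "integrable ?M F" for F :: "_ \<Rightarrow> complex"
    using infsetsum_infsum[of F UNIV] that by (simp add: Infinite_Set_Sum.abs_summable_on_def infsetsum_def)
  have "inv_fourier (\<lambda>k. cfourier f k * \<phi> k) x = (LINT k|?L. cfourier f k * g k)"
    unfolding inv_fourier_def set_lebesgue_integral_def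
    by (rule Bochner_Integration.integral_cong) (auto simp: g_def inv_fourier_integrand_def)
  also have "\<dots> = (LINT k|?L. LINT y|?M. H y k)"
  proof (rule Bochner_Integration.integral_cong)
    fix k
    have e: "integrable ?M (\<lambda>y. f y * exp (\<i> * of_real (k \<bullet> emb y)))"
      using fI unfolding Infinite_Set_Sum.abs_summable_on_def
      by (rule Bochner_Integration.integrable_bound) (auto simp: norm_mult)
    show "cfourier f k * g k = (LINT y|?M. H y k)"
      using e by (simp add: cfourier_def inf H_def)
  qed simp
  also have "\<dots> = (LINT y|?M. LINT k|?L. H y k)"
    by (rule Fubini_integral[OF int])
  also have "(\<lambda>y. LINT k|?L. H y k) = (\<lambda>y. f y * inv_fourier \<phi> (x - y))"
  proof
    fix y
    have "(LINT k|?L. H y k) = (LINT k|?L. f y * (indicator torus k *\<^sub>R inv_fourier_integrand \<phi> (x - y) k))"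
      by (rule Bochner_Integration.integral_cong)
        (auto simp: H_def g_def inv_fourier_integrand_def emb_diff inner_diff_right exp_diff exp_minus field_simps indicator_def)
    thus "(LINT k|?L. H y k) = f y * inv_fourier \<phi> (x - y)"
      by (simp add: inv_fourier_def flip: set_lebesgue_integral_def)
  qed
  also have "(LINT y|?M. f y * inv_fourier \<phi> (x - y)) = conv f (inv_fourier \<phi>) x"
    unfolding conv_def
  proof (rule inf[symmetric])
    show "integrable ?M (\<lambda>y. f y * inv_fourier \<phi> (x - y))"
    proof (rule Bochner_Integration.integrable_bound)
      show "integrable ?M (\<lambda>y. f y * of_real ((LINT k:torus|lborel. norm (\<phi> k)) / (2 * pi) ^ CARD('d)))"
        using fI by (simp add: Infinite_Set_Sum.abs_summable_on_def)
      show "AE y in ?M. norm (f y * inv_fourier \<phi> (x - y)) \<le> norm (f y * of_real ((LINT k:torus|lborel. norm (\<phi> k)) / (2 * pi) ^ CARD('d)))"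
        by (intro AE_I2, subst (1 2) norm_mult, intro mult_left_mono)
          (simp_all only: norm_of_real norm_ge_zero, intro order.trans[OF norm_inv_fourier_le[OF \<phi>] abs_ge_self])
    qed simp
  qed
  finally show ?thesis ..
qed

section \<open>The one-dimensional heat kernel\<close>

text \<open>Symbols of order \<open>j\<close>: functions of time \<open>T\<close> and frequency \<open>k\<close> that, on the parabolic
  scale \<open>k \<approx> T powr (- 1 / 2)\<close>, have size \<open>T powr (- j / 2)\<close>. Differentiation in \<open>k\<close>
  and multiplication by \<open>T * sin k\<close> both lower the order by one, so the class is stable under
  integration by parts against \<open>exp (- T * (1 - cos k))\<close>.\<close>

inductive heat_symbol :: "int \<Rightarrow> (real \<Rightarrow> real \<Rightarrow> real) \<Rightarrow> bool" where
  const: "j \<le> 0 \<Longrightarrow> heat_symbol j (\<lambda>T k. c)"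
| add: "heat_symbol j f \<Longrightarrow> heat_symbol j g \<Longrightarrow> heat_symbol j (\<lambda>T k. f T k + g T k)"
| cmult: "heat_symbol j f \<Longrightarrow> heat_symbol j (\<lambda>T k. c * f T k)"
| time: "heat_symbol (j + 2) f \<Longrightarrow> heat_symbol j (\<lambda>T k. T * f T k)"
| sin: "heat_symbol (j - 1) f \<Longrightarrow> heat_symbol j (\<lambda>T k. sin k * f T k)"
| cos: "heat_symbol j f \<Longrightarrow> heat_symbol j (\<lambda>T k. cos k * f T k)"
| vers: "heat_symbol (j - 2) f \<Longrightarrow> heat_symbol j (\<lambda>T k. (1 - cos k) * f T k)"

lemma heat_symbol_mono: "heat_symbol j f \<Longrightarrow> i \<le> j \<Longrightarrow> heat_symbol i f"
  by (induction arbitrary: i rule: heat_symbol.induct) (auto intro: heat_symbol.intros)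

lemma heat_symbol_power: "heat_symbol (2 * int m) (\<lambda>T k. (1 - cos k) ^ m)"
proof (induction m)
  case 0
  show ?case using heat_symbol.const[of 0 1] by simp
next
  case (Suc m)
  have "heat_symbol (2 * int (Suc m)) (\<lambda>T k. (1 - cos k) * (1 - cos k) ^ m)"
    by (intro heat_symbol.vers) (use Suc in simp)
  thus ?case by simp
qed

text \<open>Product rule, case by case: differentiating \<open>sin k\<close> gives up the one order
  that this factor contributed, \<open>1 - cos k\<close> gives up one of two, and
  \<open>cos k\<close> even gains one, a surplus that \<open>heat_symbol_mono\<close>
  discards.\<close>

lemma heat_symbol_deriv:
  assumes "heat_symbol j f"
  shows "\<exists>f'. heat_symbol (j - 1) f' \<and> (\<forall>T k. (f T has_real_derivative f' T k) (at k))"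
  using assms
proof induction
  case (const j c)
  thus ?case
    by (intro exI[of _ "\<lambda>T k. 0"]) (auto intro!: heat_symbol.const)
next
  case (add j f g)
  then obtain f' g' where
    "heat_symbol (j - 1) f'" "\<And>T k. (f T has_real_derivative f' T k) (at k)"
    "heat_symbol (j - 1) g'" "\<And>T k. (g T has_real_derivative g' T k) (at k)" by blast
  thus ?case
    by (intro exI[of _ "\<lambda>T k. f' T k + g' T k"]) (auto intro!: heat_symbol.add derivative_eq_intros)
next
  case (cmult j f c)
  then obtain f' where
    "heat_symbol (j - 1) f'" "\<And>T k. (f T has_real_derivative f' T k) (at k)" by blast
  thus ?case
    by (intro exI[of _ "\<lambda>T k. c * f' T k"]) (auto intro!: heat_symbol.cmult derivative_eq_intros)
next
  case (time j f)
  then obtain f' where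
    "heat_symbol (j + 2 - 1) f'" "\<And>T k. (f T has_real_derivative f' T k) (at k)" by blast
  thus ?case
    by (intro exI[of _ "\<lambda>T k. T * f' T k"])
      (auto intro!: heat_symbol.time derivative_eq_intros simp: algebra_simps)
next
  case (sin j f)
  then obtain f' where f':
    "heat_symbol (j - 1 - 1) f'" "\<And>T k. (f T has_real_derivative f' T k) (at k)" by blast
  have "heat_symbol (j - 1) (\<lambda>T k. cos k * f T k + sin k * f' T k)"
    using sin f' by (intro heat_symbol.add heat_symbol.cos heat_symbol.sin) auto
  thus ?case using f'(2)
    by (intro exI[of _ "\<lambda>T k. cos k * f T k + sin k * f' T k"])
      (auto intro!: derivative_eq_intros)
next
  case (cos j f)
  then obtain f' where f':
    "heat_symbol (j - 1) f'" "\<And>T k. (f T has_real_derivative f' T k) (at k)" by blast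
  have "heat_symbol (j - 1) (\<lambda>T k. (- 1) * (sin k * f T k) + cos k * f' T k)"
    using cos f' by (intro heat_symbol.add heat_symbol.cmult heat_symbol.cos heat_symbol.sin)
      (auto intro: heat_symbol_mono[of j])
  thus ?case using f'(2)
    by (intro exI[of _ "\<lambda>T k. (- 1) * (sin k * f T k) + cos k * f' T k"])
      (auto intro!: derivative_eq_intros)
next
  case (vers j f)
  then obtain f' where f':
    "heat_symbol (j - 2 - 1) f'" "\<And>T k. (f T has_real_derivative f' T k) (at k)" by blast
  have "heat_symbol (j - 1) (\<lambda>T k. sin k * f T k + (1 - cos k) * f' T k)"
    using vers f' by (intro heat_symbol.add heat_symbol.vers heat_symbol.sin) (auto simp: algebra_simps)
  thus ?case using f'(2)
    by (intro exI[of _ "\<lambda>T k. sin k * f T k + (1 - cos k) * f' T k"])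
      (auto intro!: derivative_eq_intros)
qed

text \<open>Makes the boundary terms at \<open>- pi\<close> and \<open>pi\<close> cancel in the
  integration by parts.\<close>

lemma heat_symbol_periodic: "heat_symbol j f \<Longrightarrow> f T (- pi) = f T pi"
  by (induction rule: heat_symbol.induct) auto

section \<open>Elementary bounds for the cosine near 0\<close>

lemma one_minus_cos_le: "1 - cos x \<le> x\<^sup>2 / 2" for x :: real
proof -
  have "1 - cos x = 2 * (sin (x / 2))\<^sup>2"
    using cos_double_sin[of "x / 2"] by simp
  moreover have "(sin (x / 2))\<^sup>2 \<le> (x / 2)\<^sup>2"
    using power_mono[OF abs_sin_x_le_abs_x[of "x / 2"] abs_ge_zero, of 2] by (simp add: power_divide)
  ultimately show ?thesis by (simp add: power2_eq_square)
qed

lemma cos_taylor_4: "\<bar>1 - cos x - x\<^sup>2 / 2\<bar> \<le> x ^ 4 / 24" for x :: real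
proof -
  obtain t where t: "cos x = (\<Sum>m<4. cos_coeff m * x ^ m) + (cos (t + 1 / 2 * real 4 * pi) / fact 4) * x ^ 4"
    using Maclaurin_cos_expansion[of x 4] by auto
  have "(\<Sum>m<4. cos_coeff m * x ^ m) = 1 - x\<^sup>2 / 2"
    by (simp add: eval_nat_numeral cos_coeff_Suc sin_coeff_Suc)
  with t have "1 - cos x - x\<^sup>2 / 2 = - (cos (t + 2 * pi) * x ^ 4 / 24)"
    by (simp add: fact_numeral)
  hence "\<bar>1 - cos x - x\<^sup>2 / 2\<bar> = \<bar>cos (t + 2 * pi)\<bar> * x ^ 4 / 24" by (simp add: abs_mult)
  also have "\<dots> \<le> 1 * x ^ 4 / 24" by (intro divide_right_mono mult_right_mono) auto
  finally show ?thesis by simp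
qed

text \<open>The constant is 1/2 - 10/24, since the error of the quadratic approximation is at most
  \<open>k ^ 4 / 24\<close> and the square of \<open>pi\<close> is below 10.\<close>

lemma one_minus_cos_ge:
  fixes k :: real
  assumes "\<bar>k\<bar> \<le> pi"
  shows "1 - cos k \<ge> k\<^sup>2 / 12"
proof -
  have "\<bar>k\<bar> \<le> 3.15" using assms pi_approx by simp
  hence "k\<^sup>2 \<le> 3.15\<^sup>2" using power_mono[of "\<bar>k\<bar>" "3.15" 2] by simp
  hence "k\<^sup>2 \<le> 10" by (simp add: power2_eq_square)
  hence "k ^ 4 \<le> 10 * k\<^sup>2"
    using mult_right_mono[of "k\<^sup>2" 10 "k\<^sup>2"] by (simp add: power_add[symmetric])
  thus ?thesis using cos_taylor_4[of k] by linarith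
qed

text \<open>The size \<open>T powr (- j / 2)\<close> of a symbol, up to a polynomial in the scaled
  frequency \<open>T * k\<^sup>2\<close>, which the Gaussian factor later absorbs. Truncation by
  \<open>max 1 T\<close> keeps the estimate uniform down to T = 0.\<close>

definition heat_bounded :: "int \<Rightarrow> (real \<Rightarrow> real \<Rightarrow> real) \<Rightarrow> bool" where
  "heat_bounded j f \<longleftrightarrow> (\<exists>C M. C \<ge> 0 \<and> (\<forall>T k. T \<ge> 0 \<longrightarrow>
     \<bar>f T k\<bar> \<le> C * max 1 T powr (- of_int j / 2) * (1 + max 1 T * k\<^sup>2) ^ M))"

lemma heat_boundedI:
  assumes "C \<ge> 0"
    "\<And>T k. T \<ge> 0 \<Longrightarrow> \<bar>f T k\<bar> \<le> C * max 1 T powr (- of_int j / 2) * (1 + max 1 T * k\<^sup>2) ^ M"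
  shows "heat_bounded j f"
  using assms unfolding heat_bounded_def by blast

lemma heat_bounded_add:
  assumes "heat_bounded j f" "heat_bounded j g"
  shows "heat_bounded j (\<lambda>T k. f T k + g T k)"
proof -
  obtain C1 M1 where f: "C1 \<ge> 0"
    "\<And>T k. T \<ge> 0 \<Longrightarrow> \<bar>f T k\<bar> \<le> C1 * max 1 T powr (- of_int j / 2) * (1 + max 1 T * k\<^sup>2) ^ M1"
    using assms(1) unfolding heat_bounded_def by blast
  obtain C2 M2 where g: "C2 \<ge> 0"
    "\<And>T k. T \<ge> 0 \<Longrightarrow> \<bar>g T k\<bar> \<le> C2 * max 1 T powr (- of_int j / 2) * (1 + max 1 T * k\<^sup>2) ^ M2"
    using assms(2) unfolding heat_bounded_def by blast
  show ?thesis
  proof (rule heat_boundedI[of "C1 + C2" _ _ "M1 + M2"])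
    fix T k :: real assume T: "T \<ge> 0"
    have "C1 * max 1 T powr (- of_int j / 2) * (1 + max 1 T * k\<^sup>2) ^ M1
        \<le> C1 * max 1 T powr (- of_int j / 2) * (1 + max 1 T * k\<^sup>2) ^ (M1 + M2)"
      using f by (intro mult_left_mono power_increasing) auto
    moreover have "C2 * max 1 T powr (- of_int j / 2) * (1 + max 1 T * k\<^sup>2) ^ M2
        \<le> C2 * max 1 T powr (- of_int j / 2) * (1 + max 1 T * k\<^sup>2) ^ (M1 + M2)"
      using g by (intro mult_left_mono power_increasing) auto
    ultimately show "\<bar>f T k + g T k\<bar>
        \<le> (C1 + C2) * max 1 T powr (- of_int j / 2) * (1 + max 1 T * k\<^sup>2) ^ (M1 + M2)"
      using f(2)[OF T, of k] g(2)[OF T, of k] abs_triangle_ineq[of "f T k" "g T k"]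
      unfolding distrib_right by linarith
  qed (use f(1) g(1) in simp)
qed

lemma heat_bounded_mult:
  assumes "heat_bounded i f" "heat_bounded j g" "n = i + j"
  shows "heat_bounded n (\<lambda>T k. f T k * g T k)"
proof -
  obtain C1 M1 where f: "C1 \<ge> 0"
    "\<And>T k. T \<ge> 0 \<Longrightarrow> \<bar>f T k\<bar> \<le> C1 * max 1 T powr (- of_int i / 2) * (1 + max 1 T * k\<^sup>2) ^ M1"
    using assms(1) unfolding heat_bounded_def by blast
  obtain C2 M2 where g: "C2 \<ge> 0"
    "\<And>T k. T \<ge> 0 \<Longrightarrow> \<bar>g T k\<bar> \<le> C2 * max 1 T powr (- of_int j / 2) * (1 + max 1 T * k\<^sup>2) ^ M2"
    using assms(2) unfolding heat_bounded_def by blast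
  show ?thesis
  proof (rule heat_boundedI[of "C1 * C2" _ _ "M1 + M2"])
    fix T k :: real assume T: "T \<ge> 0"
    have ab: "max 1 T powr (- of_int i / 2) * max 1 T powr (- of_int j / 2) = max 1 T powr (- of_int n / 2)"
      by (subst powr_add[symmetric]) (simp add: assms(3) field_simps)
    have eq: "C1 * max 1 T powr (- of_int i / 2) * (1 + max 1 T * k\<^sup>2) ^ M1 *
          (C2 * max 1 T powr (- of_int j / 2) * (1 + max 1 T * k\<^sup>2) ^ M2)
        = C1 * C2 * max 1 T powr (- of_int n / 2) * (1 + max 1 T * k\<^sup>2) ^ (M1 + M2)"
      unfolding power_add ab[symmetric] by (simp only: mult_ac)
    show "\<bar>f T k * g T k\<bar> \<le> C1 * C2 * max 1 T powr (- of_int n / 2) * (1 + max 1 T * k\<^sup>2) ^ (M1 + M2)"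
      unfolding abs_mult eq[symmetric] using f g T by (intro mult_mono) auto
  qed (use f(1) g(1) in simp)
qed

lemma heat_bounded_const:
  assumes "j \<le> 0"
  shows "heat_bounded j (\<lambda>T k. c)"
proof (rule heat_boundedI[of "\<bar>c\<bar>" _ _ 0])
  fix T k :: real
  have "\<bar>c\<bar> * 1 \<le> \<bar>c\<bar> * max 1 T powr (- of_int j / 2)"
    using assms by (intro mult_left_mono ge_one_powr_ge_zero) auto
  thus "\<bar>c\<bar> \<le> \<bar>c\<bar> * max 1 T powr (- of_int j / 2) * (1 + max 1 T * k\<^sup>2) ^ 0" by simp
qed simp

lemma heat_bounded_time: "heat_bounded (- 2) (\<lambda>T k. T)"
  by (rule heat_boundedI[of 1 _ _ 0]) auto

text \<open>With u the square root of \<open>max 1 T\<close>, this is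
  \<open>2 * u * \<bar>k\<bar> \<le> 1 + u\<^sup>2 * k\<^sup>2\<close>: one power of the scaled
  frequency buys the factor 1/u.\<close>

lemma heat_bounded_sin: "heat_bounded 1 (\<lambda>T k. sin k)"
proof (rule heat_boundedI[of 1 _ _ 1])
  fix T k :: real
  define u where "u = sqrt (max 1 T)"
  have u: "u \<ge> 1" "u\<^sup>2 = max 1 T" by (auto simp: u_def)
  have "u * \<bar>k\<bar> \<ge> 0" "2 * (u * \<bar>k\<bar>) \<le> 1 + max 1 T * k\<^sup>2"
    using zero_le_power2[of "u * \<bar>k\<bar> - 1"] u by (auto simp: power2_diff power_mult_distrib)
  hence "\<bar>k\<bar> * u \<le> 1 + max 1 T * k\<^sup>2" by (simp add: mult.commute)
  hence "\<bar>k\<bar> \<le> (1 + max 1 T * k\<^sup>2) / u" using u by (simp add: pos_le_divide_eq)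
  with abs_sin_x_le_abs_x[of k] have "\<bar>sin k\<bar> \<le> (1 + max 1 T * k\<^sup>2) / u" by linarith
  also have "max 1 T powr (- 1 / 2) = inverse u"
  proof -
    have "max 1 T powr (- 1 / 2) = inverse (max 1 T powr (1 / 2))"
      by (subst powr_minus[symmetric]) simp
    also have "max 1 T powr (1 / 2) = u"
      unfolding u_def by (rule powr_half_sqrt) simp
    finally show ?thesis .
  qed
  hence "(1 + max 1 T * k\<^sup>2) / u = 1 * max 1 T powr (- of_int 1 / 2) * (1 + max 1 T * k\<^sup>2) ^ 1"
    by (simp only: divide_inverse of_int_1 mult_1_left power_one_right mult.commute)
  finally show "\<bar>sin k\<bar> \<le> 1 * max 1 T powr (- of_int 1 / 2) * (1 + max 1 T * k\<^sup>2) ^ 1" .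
qed simp

lemma heat_bounded_cos: "heat_bounded 0 (\<lambda>T k. cos k)"
  by (rule heat_boundedI[of 1 _ _ 0]) auto

lemma heat_bounded_vers: "heat_bounded 2 (\<lambda>T k. 1 - cos k)"
proof (rule heat_boundedI[of 1 _ _ 1])
  fix T k :: real
  have "\<bar>1 - cos k\<bar> \<le> k\<^sup>2" using one_minus_cos_le[of k] cos_le_one[of k] zero_le_power2[of k] by linarith
  also have "\<dots> \<le> (1 + max 1 T * k\<^sup>2) / max 1 T" by (simp add: field_simps)
  also have "max 1 T powr (- of_int 2 / 2) = inverse (max 1 T)"
    using powr_minus[of "max 1 T" 1] by simp
  hence "(1 + max 1 T * k\<^sup>2) / max 1 T = 1 * max 1 T powr (- of_int 2 / 2) * (1 + max 1 T * k\<^sup>2) ^ 1"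
    by (simp only: divide_inverse mult_1_left power_one_right mult.commute)
  finally show "\<bar>1 - cos k\<bar> \<le> 1 * max 1 T powr (- of_int 2 / 2) * (1 + max 1 T * k\<^sup>2) ^ 1" .
qed simp

lemma heat_symbol_bound: "heat_symbol j f \<Longrightarrow> heat_bounded j f"
proof (induction rule: heat_symbol.induct)
  case (cmult j f c)
  show ?case by (rule heat_bounded_mult[OF heat_bounded_const[OF order_refl] cmult.IH]) simp
next
  case (time j f)
  show ?case by (rule heat_bounded_mult[OF heat_bounded_time time.IH]) simp
next
  case (sin j f)
  show ?case by (rule heat_bounded_mult[OF heat_bounded_sin sin.IH]) simp
next
  case (cos j f)
  show ?case by (rule heat_bounded_mult[OF heat_bounded_cos cos.IH]) simp
next
  case (vers j f)
  show ?case by (rule heat_bounded_mult[OF heat_bounded_vers vers.IH]) simp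
qed (auto intro: heat_bounded_const heat_bounded_add)

lemma power_div_fact_le_exp:
  fixes z :: real
  assumes "z \<ge> 0"
  shows "z ^ M / fact M \<le> exp z"
proof -
  have "(\<Sum>n\<in>{M}. z ^ n /\<^sub>R fact n) \<le> (\<Sum>n. z ^ n /\<^sub>R fact n)"
    using assms by (intro sum_le_suminf sums_summable[OF exp_converges]) auto
  also have "\<dots> = exp z" by (rule sums_unique[OF exp_converges, symmetric])
  finally show ?thesis by (simp add: divide_inverse mult.commute)
qed

text \<open>From \<open>z ^ M / fact M \<le> exp z\<close> at \<open>z = c * (1 + y)\<close>, which
  makes B explicit.\<close>

lemma pow_exp_bounded:
  fixes c :: real
  assumes "c > 0"
  shows "\<exists>B\<ge>0. \<forall>y\<ge>0. (1 + y) ^ M * exp (- c * y) \<le> B"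
proof -
  have "((1 + y) ^ M * exp (- c * y)) \<le> fact M / c ^ M * exp c" if "y \<ge> 0" for y
  proof -
    have "(c * (1 + y)) ^ M / fact M \<le> exp (c * (1 + y))"
      using assms that by (intro power_div_fact_le_exp) auto
    hence "c ^ M * (1 + y) ^ M \<le> fact M * exp (c * (1 + y))"
      by (simp add: power_mult_distrib pos_divide_le_eq mult.commute)
    also have "exp (c * (1 + y)) = exp c * exp (c * y)"
      by (simp add: exp_add distrib_left)
    finally show ?thesis using assms by (simp add: field_simps exp_minus)
  qed
  thus ?thesis using assms by (intro exI[of _ "fact M / c ^ M * exp c"]) auto
qed

lemma set_integrable_Ioc:
  fixes g :: "real \<Rightarrow> 'a::euclidean_space"
  assumes "continuous_on {a..b} g"
  shows "set_integrable lborel {a<..b} g"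
proof (rule set_integrable_subset)
  show "set_integrable lborel {a..b} g"
    unfolding set_integrable_def by (rule borel_integrable_compact) (use assms in auto)
qed auto

lemma set_integral_Ioc_eq_integral:
  fixes g :: "real \<Rightarrow> 'a::euclidean_space"
  assumes "continuous_on {a..b} g"
  shows "(LINT k:{a<..b}|lborel. g k) = integral {a..b} g"
proof -
  have i: "set_integrable lborel {a..b} g"
    unfolding set_integrable_def by (rule borel_integrable_compact) (use assms in auto)
  have "(LINT k:{a<..b}|lborel. g k) = (LINT k:{a..b}|lborel. g k)"
    unfolding set_lebesgue_integral_def
  proof (rule integral_cong_AE)
    show "AE k in lborel. indicat_real {a<..b} k *\<^sub>R g k = indicat_real {a..b} k *\<^sub>R g k"
      using AE_lborel_neq[of a] by eventually_elim (auto simp: indicator_def)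
  qed (use i set_integrable_Ioc[OF assms] in \<open>auto simp: set_integrable_def\<close>)
  also have "\<dots> = integral {a..b} g"
    by (rule set_borel_integral_eq_integral(2)[OF i])
  finally show ?thesis .
qed

text \<open>Left without the factor \<open>1 / (2 * pi)\<close>. For f = 1 it is
  \<open>2 * pi\<close> times the probability that the continuous-time simple random walk on the
  integers, of jump rate 1, goes from 0 to n in time T.\<close>

definition heat_coeff :: "(real \<Rightarrow> real \<Rightarrow> real) \<Rightarrow> real \<Rightarrow> int \<Rightarrow> complex" where
  "heat_coeff f T n = (LINT k:{-pi<..pi}|lborel.
     exp (- \<i> * of_real (k * of_int n)) * of_real (f T k * exp (- T * (1 - cos k))))"

lemma heat_symbol_continuous:
  assumes "heat_symbol j f"
  shows "continuous_on S (f T)"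
proof -
  obtain f' where "\<And>T k. (f T has_real_derivative f' T k) (at k)"
    using heat_symbol_deriv[OF assms] by blast
  thus ?thesis by (intro DERIV_continuous_on) (auto intro: DERIV_subset)
qed

lemma continuous_on_heat_integrand:
  assumes "heat_symbol j f"
  shows "continuous_on S (\<lambda>k. exp (- \<i> * of_real (k * of_int n)) * complex_of_real (f T k * exp (- T * (1 - cos k))))"
  by (intro continuous_intros heat_symbol_continuous[OF assms])

lemma heat_coeff_eq_integral:
  assumes "heat_symbol j f"
  shows "heat_coeff f T n = integral {-pi..pi}
    (\<lambda>k. exp (- \<i> * of_real (k * of_int n)) * of_real (f T k * exp (- T * (1 - cos k))))"
  unfolding heat_coeff_def
  by (rule set_integral_Ioc_eq_integral[OF continuous_on_heat_integrand[OF assms]])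

text \<open>The Gaussian factor absorbs the polynomial and one further power of
  \<open>1 + max 1 T * k\<^sup>2\<close>, hence the \<open>Suc M\<close>. What remains is a
  Lorentzian in k, whose integral, an arctangent, supplies the extra half power of time.\<close>

lemma heat_coeff_bound_0:
  assumes f: "heat_symbol j f"
  shows "\<exists>C\<ge>0. \<forall>T n. T \<ge> 0 \<longrightarrow> norm (heat_coeff f T n) \<le> C * max 1 T powr (- (of_int j + 1) / 2)"
proof -
  obtain C M where C: "C \<ge> 0" and bd: "\<And>T k. T \<ge> 0 \<Longrightarrow>
     \<bar>f T k\<bar> \<le> C * max 1 T powr (- of_int j / 2) * (1 + max 1 T * k\<^sup>2) ^ M"
    using heat_symbol_bound[OF f] unfolding heat_bounded_def by blast
  obtain B where B: "B \<ge> 0" "\<And>y::real. y \<ge> 0 \<Longrightarrow> (1 + y) ^ Suc M * exp (- (1/12) * y) \<le> B"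
    using pow_exp_bounded[of "1/12" "Suc M"] by auto
  \<comment> \<open>The second summand covers T < 1, where the exponential is merely at most 1 but
    \<open>max 1 T * k\<^sup>2\<close> is at most \<open>pi\<^sup>2\<close>.\<close>
  define B' where "B' = B + (1 + pi\<^sup>2) ^ Suc M"
  have B': "B' \<ge> 0" using B by (simp add: B'_def)
  have key: "(1 + max 1 T * k\<^sup>2) ^ M * exp (- T * (1 - cos k)) \<le> B' / (1 + max 1 T * k\<^sup>2)"
    if T: "T \<ge> 0" and k: "\<bar>k\<bar> \<le> pi" for T k :: real
  proof -
    have pos: "1 + max 1 T * k\<^sup>2 > 0" by (auto intro!: add_pos_nonneg)
    have "(1 + max 1 T * k\<^sup>2) ^ Suc M * exp (- T * (1 - cos k)) \<le> B'"
    proof (cases "T \<ge> 1")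
      case True
      have "(1 + max 1 T * k\<^sup>2) ^ Suc M * exp (- T * (1 - cos k))
          \<le> (1 + T * k\<^sup>2) ^ Suc M * exp (- (1/12) * (T * k\<^sup>2))"
        using True mult_left_mono[OF one_minus_cos_ge[OF k] T] by (intro mult_mono) auto
      also have "\<dots> \<le> B" using T by (intro B) auto
      finally show ?thesis by (simp add: B'_def add_increasing2)
    next
      case False
      have "(1 + max 1 T * k\<^sup>2) ^ Suc M * exp (- T * (1 - cos k)) \<le> (1 + pi\<^sup>2) ^ Suc M * 1"
        using False T power_mono[OF k, of 2]
        by (intro mult_mono power_mono) (auto simp del: power_Suc)
      thus ?thesis using B by (simp add: B'_def)
    qed
    thus ?thesis using pos by (simp add: pos_le_divide_eq mult_ac)
  qed
  have "norm (heat_coeff f T n) \<le> C * B' * pi * max 1 T powr (- (of_int j + 1) / 2)" if T: "T \<ge> 0" for T n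
  proof -
    define u where "u = sqrt (max 1 T)"
    have u: "u \<ge> 1" "u\<^sup>2 = max 1 T" by (auto simp: u_def)
    define A where "A = C * max 1 T powr (- of_int j / 2) * B'"
    have A: "A \<ge> 0" using C B' by (simp add: A_def)
    have I: "((\<lambda>k. A / (1 + max 1 T * k\<^sup>2)) has_integral
        (A / u * arctan (u * pi) - A / u * arctan (u * (- pi)))) {-pi..pi}"
    proof (rule fundamental_theorem_of_calculus)
      fix x :: real
      have p: "1 + (u * x)\<^sup>2 > 0" by (auto intro!: add_pos_nonneg)
      show "((\<lambda>k. A / u * arctan (u * k)) has_vector_derivative A / (1 + max 1 T * x\<^sup>2)) (at x within {-pi..pi})"
        unfolding has_real_derivative_iff_has_vector_derivative[symmetric] u(2)[symmetric]
        using u p by (auto intro!: derivative_eq_intros simp: divide_simps power_mult_distrib)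
    qed simp
    have "norm (heat_coeff f T n) \<le> integral {-pi..pi} (\<lambda>k. A / (1 + max 1 T * k\<^sup>2))"
      unfolding heat_coeff_eq_integral[OF f]
    proof (rule integral_norm_bound_integral)
      show "(\<lambda>k. exp (- \<i> * of_real (k * of_int n)) * complex_of_real (f T k * exp (- T * (1 - cos k)))) integrable_on {-pi..pi}"
        by (rule integrable_continuous_interval[OF continuous_on_heat_integrand[OF f]])
      show "(\<lambda>k. A / (1 + max 1 T * k\<^sup>2)) integrable_on {-pi..pi}" using I by blast
      fix k :: real assume "k \<in> {-pi..pi}"
      hence k: "\<bar>k\<bar> \<le> pi" by auto
      have "norm (exp (- \<i> * of_real (k * of_int n)) * complex_of_real (f T k * exp (- T * (1 - cos k))))
          = \<bar>f T k\<bar> * exp (- T * (1 - cos k))"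
        using norm_exp_i_real(2)[of "k * of_int n"]
        by (simp only: norm_mult norm_of_real abs_mult abs_exp_cancel mult_minus_left mult_1_left)
      also have "\<dots> \<le> C * max 1 T powr (- of_int j / 2) * (1 + max 1 T * k\<^sup>2) ^ M * exp (- T * (1 - cos k))"
        by (intro mult_right_mono bd T) auto
      also have "\<dots> \<le> C * max 1 T powr (- of_int j / 2) * (B' / (1 + max 1 T * k\<^sup>2))"
        using key[OF T k] C by (simp only: mult.assoc) (intro mult_left_mono, auto)
      finally show "norm (exp (- \<i> * of_real (k * of_int n)) * complex_of_real (f T k * exp (- T * (1 - cos k))))
          \<le> A / (1 + max 1 T * k\<^sup>2)" by (simp add: A_def)
    qed
    also have "\<dots> = A / u * (2 * arctan (u * pi))"
      using integral_unique[OF I] by (simp add: arctan_minus)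
    also have "\<dots> \<le> A / u * pi"
      using A u arctan_ubound[of "u * pi"] by (intro mult_left_mono) auto
    finally have le: "norm (heat_coeff f T n) \<le> A / u * pi" .
    have iu: "max 1 T powr (- 1 / 2) = inverse u"
    proof -
      have "max 1 T powr (- 1 / 2) = inverse (max 1 T powr (1 / 2))"
        by (subst powr_minus[symmetric]) simp
      also have "max 1 T powr (1 / 2) = u"
        unfolding u_def by (rule powr_half_sqrt) simp
      finally show ?thesis .
    qed
    note le
    also have "A / u * pi = C * B' * pi * (max 1 T powr (- of_int j / 2) * max 1 T powr (- 1 / 2))"
      unfolding iu A_def by (simp only: divide_inverse mult_ac)
    also have "max 1 T powr (- of_int j / 2) * max 1 T powr (- 1 / 2) = max 1 T powr (- (of_int j + 1) / 2)"
      by (subst powr_add[symmetric]) (simp add: field_simps)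
    finally show ?thesis .
  qed
  thus ?thesis using C B' by (intro exI[of _ "C * B' * pi"]) auto
qed

text \<open>Multiplication by n becomes differentiation of
  \<open>f T k * exp (- T * (1 - cos k))\<close>: f is replaced by
  \<open>f' - T * sin k * f\<close>, again a symbol, one order lower.\<close>

lemma heat_coeff_by_parts:
  assumes f: "heat_symbol j f"
  shows "\<exists>g. heat_symbol (j - 1) g \<and>
    (\<forall>T n. \<bar>of_int n\<bar> * norm (heat_coeff f T n) = norm (heat_coeff g T n))"
proof -
  obtain f' where f': "heat_symbol (j - 1) f'" "\<And>T k. (f T has_real_derivative f' T k) (at k)"
    using heat_symbol_deriv[OF f] by blast
  define g where "g = (\<lambda>T k. f' T k + (- 1) * (T * (sin k * f T k)))"
  have g: "heat_symbol (j - 1) g"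
    unfolding g_def using f f'(1)
    by (intro heat_symbol.add heat_symbol.cmult heat_symbol.time heat_symbol.sin) auto
  have "\<bar>of_int n\<bar> * norm (heat_coeff f T n) = norm (heat_coeff g T n)" for T n
  proof -
    let ?e = "\<lambda>k. exp (- \<i> * complex_of_real (k * of_int n))"
    let ?h = "\<lambda>k. f T k * exp (- T * (1 - cos k))"
    let ?h' = "\<lambda>k. g T k * exp (- T * (1 - cos k))"
    let ?F = "\<lambda>k. ?e k * of_real (?h k)"
    let ?G = "\<lambda>k. ?e k * of_real (?h' k)"
    have ftc: "((\<lambda>k. (- \<i> * of_int n) * ?F k + ?G k) has_integral (?F pi - ?F (- pi))) {-pi..pi}"
    proof (rule fundamental_theorem_of_calculus)
      fix x :: real
      have 1: "(?e has_vector_derivative (- \<i> * of_int n) * ?e x) (at x within {-pi..pi})"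
      proof -
        have "((\<lambda>z. exp (- \<i> * (z * of_int n))) has_field_derivative (- \<i> * of_int n) * ?e x) (at (of_real x))"
          by (auto intro!: derivative_eq_intros)
        from has_vector_derivative_real_field[OF this, of "{-pi..pi}"] show ?thesis by (simp add: o_def)
      qed
      have "(?h has_real_derivative ?h' x) (at x within {-pi..pi})"
        using DERIV_subset[OF f'(2)]
        by (auto intro!: derivative_eq_intros simp: g_def algebra_simps)
      hence 2: "((\<lambda>k. complex_of_real (?h k)) has_vector_derivative of_real (?h' x)) (at x within {-pi..pi})"
        by (intro has_vector_derivative_of_real)
          (simp add: has_real_derivative_iff_has_vector_derivative)
      show "(?F has_vector_derivative ((- \<i> * of_int n) * ?F x + ?G x)) (at x within {-pi..pi})"
        using has_vector_derivative_mult[OF 1 2] by (simp add: algebra_simps)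
    qed simp
    have per: "?F pi = ?F (- pi)"
    proof -
      have "exp (- \<i> * complex_of_real (pi * of_int n)) = exp (- \<i> * complex_of_real (- pi * of_int n))"
        by (auto simp: complex_eq_iff Re_exp Im_exp sin_npi_int)
      thus ?thesis using heat_symbol_periodic[OF f, of T] by simp
    qed
    have "(?F has_integral heat_coeff f T n) {-pi..pi}"
      unfolding heat_coeff_eq_integral[OF f]
      by (intro integrable_integral integrable_continuous_interval continuous_on_heat_integrand[OF f])
    moreover have "(?G has_integral heat_coeff g T n) {-pi..pi}"
      unfolding heat_coeff_eq_integral[OF g]
      by (intro integrable_integral integrable_continuous_interval continuous_on_heat_integrand[OF g])
    ultimately have "((\<lambda>k. (- \<i> * of_int n) * ?F k + ?G k) has_integral
        (- \<i> * of_int n) * heat_coeff f T n + heat_coeff g T n) {-pi..pi}"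
      by (intro has_integral_add has_integral_mult_right)
    with ftc have "(- \<i> * of_int n) * heat_coeff f T n + heat_coeff g T n = ?F pi - ?F (- pi)"
      by (rule has_integral_unique[rotated])
    also have "\<dots> = 0" by (simp only: per diff_self)
    finally have "(- \<i> * of_int n) * heat_coeff f T n + heat_coeff g T n = 0" .
    hence "heat_coeff g T n = (\<i> * of_int n) * heat_coeff f T n" by (simp add: add_eq_0_iff)
    thus ?thesis by (simp add: norm_mult)
  qed
  with g show ?thesis by blast
qed

text \<open>Each integration by parts trades one factor n for half a power of time.\<close>

lemma heat_coeff_bound:
  assumes "heat_symbol j f"
  shows "\<exists>C\<ge>0. \<forall>T n. T \<ge> 0 \<longrightarrow>
     \<bar>of_int n\<bar> ^ N * norm (heat_coeff f T n) \<le> C * max 1 T powr ((real N - of_int j - 1) / 2)"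
  using assms
proof (induction N arbitrary: j f)
  case 0
  have "- (of_int j + 1) / 2 = (real 0 - of_int j - 1) / 2" by simp
  with heat_coeff_bound_0[OF 0] show ?case by (simp only: power_0 mult_1_left)
next
  case (Suc N)
  obtain g where g: "heat_symbol (j - 1) g"
    "\<And>T n. \<bar>of_int n\<bar> * norm (heat_coeff f T n) = norm (heat_coeff g T n)"
    using heat_coeff_by_parts[OF Suc.prems] by blast
  have "real (Suc N) - of_int j - 1 = real N - of_int (j - 1) - 1" by simp
  with Suc.IH[OF g(1)] show ?case
    by (simp only: power_Suc2 mult.assoc g(2))
qed

section \<open>The lattice Green function\<close>

lemma AE_vec_nth_neq_0: "AE k in lborel. (k :: real^'d::finite) $ j \<noteq> 0"
proof -
  have "negligible {k :: real^'d. axis j 1 \<bullet> k = 0}"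
    by (rule negligible_hyperplane) (simp add: axis_eq_0_iff)
  hence "{k :: real^'d. axis j 1 \<bullet> k = 0} \<in> null_sets (completion lborel)"
    by (simp add: negligible_iff_null_sets)
  moreover have "closed {k :: real^'d. axis j 1 \<bullet> k = 0}"
    by (intro closed_Collect_eq continuous_intros)
  ultimately have "{k :: real^'d. axis j 1 \<bullet> k = 0} \<in> null_sets lborel"
    by (subst (asm) null_sets_completion_iff) auto
  from AE_not_in[OF this] show ?thesis
    by eventually_elim (simp add: inner_axis' )
qed

lemma set_integrable_Ioc_powr:
  assumes "a > -1"
  shows "set_integrable lborel {-pi<..pi} (\<lambda>t. complex_of_real (\<bar>t\<bar> powr a))"
proof -
  have 1: "((\<lambda>t. \<bar>t\<bar> powr a) has_integral (pi powr (a+1) / (a+1))) {0..pi}"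
    by (rule has_integral_eq[OF _ has_integral_powr_from_0[OF assms]]) auto
  hence "((\<lambda>t. \<bar>- t\<bar> powr a) has_integral (pi powr (a+1) / (a+1))) {- pi..- 0}"
    by (subst has_integral_reflect_real) simp
  hence 2: "((\<lambda>t. \<bar>t\<bar> powr a) has_integral (pi powr (a+1) / (a+1))) {- pi..0}" by simp
  define I where "I = pi powr (a+1) / (a+1) + pi powr (a+1) / (a+1)"
  have "((\<lambda>t. \<bar>t\<bar> powr a) has_integral I) {-pi..pi}"
    unfolding I_def by (rule has_integral_combine[OF _ _ 2 1]) auto
  hence "((\<lambda>t. if t \<in> {-pi..pi} then \<bar>t\<bar> powr a else 0) has_integral I) UNIV"
    by (subst has_integral_restrict_UNIV)
  hence h: "((\<lambda>t. indicator {-pi..pi} t * \<bar>t\<bar> powr a) has_integral I) UNIV"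
    by (rule has_integral_eq[rotated]) (auto simp: indicator_def)
  have nn: "(\<integral>\<^sup>+t. ennreal (indicator {-pi..pi} t * \<bar>t\<bar> powr a) \<partial>lborel) = ennreal I"
    by (rule nn_integral_has_integral_lborel[OF _ _ h]) auto
  have "integrable lborel (\<lambda>t. indicator {-pi..pi} t * \<bar>t\<bar> powr a)"
    by (rule integrableI_nn_integral_finite[OF _ _ nn]) auto
  hence "set_integrable lborel {-pi..pi} (\<lambda>t. \<bar>t\<bar> powr a)" by (simp add: set_integrable_def)
  hence "set_integrable lborel {-pi<..pi} (\<lambda>t. \<bar>t\<bar> powr a)"
    by (rule set_integrable_subset) auto
  thus ?thesis
    unfolding set_integrable_def by (simp add: scaleR_conv_of_real flip: of_real_mult)
qed

text \<open>As |k| dominates every coordinate, \<open>1 / (norm k)\<^sup>2\<close> is at most the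
  product of \<open>\<bar>k $ j\<bar> powr (- 2 / d)\<close> off the coordinate hyperplanes. Each
  factor is integrable near 0 exactly when d > 2; polar coordinates are avoided.\<close>

lemma set_integrable_inverse_square:
  assumes "CARD('d::finite) > 2"
  shows "set_integrable lborel torus (\<lambda>k::real^'d. complex_of_real (1 / (norm k)\<^sup>2))"
proof (rule set_integrable_bound)
  define D where "D = real CARD('d)"
  have D: "D > 2" using assms by (simp add: D_def)
  have "- 2 / D > -1" using D by (simp add: field_simps)
  hence "\<And>j::'d. set_integrable lborel {-pi<..pi} (\<lambda>t. complex_of_real (\<bar>t\<bar> powr (- 2 / D)))"
    by (rule set_integrable_Ioc_powr)
  thus "set_integrable lborel torus (\<lambda>k::real^'d. \<Prod>j\<in>UNIV. complex_of_real (\<bar>k $ j\<bar> powr (- 2 / D)))"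
    by (rule torus_vec_prod)
  show "set_borel_measurable lborel torus (\<lambda>k::real^'d. complex_of_real (1 / (norm k)\<^sup>2))"
    unfolding set_borel_measurable_def by measurable
  have "AE k in lborel. \<forall>j. (k :: real^'d) $ j \<noteq> 0"
    using AE_vec_nth_neq_0 by (subst AE_all_countable) auto
  thus "AE k in lborel. (k :: real^'d) \<in> torus \<longrightarrow> norm (complex_of_real (1 / (norm k)\<^sup>2))
      \<le> norm (\<Prod>j\<in>UNIV. complex_of_real (\<bar>k $ j\<bar> powr (- 2 / D)))"
  proof eventually_elim
    case (elim k)
    have k: "k \<noteq> 0" using elim by auto
    have "1 / (norm k)\<^sup>2 = norm k powr - 2"
      using k by (simp add: powr_minus powr_numeral divide_inverse)
    also have "\<dots> = norm k powr ((- 2 / D) * D)" using D by simp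
    also have "\<dots> = (\<Prod>j\<in>(UNIV::'d set). norm k powr (- 2 / D))"
      using k by (simp only: powr_powr[symmetric]) (simp add: powr_realpow D_def)
    also have "\<dots> \<le> (\<Prod>j\<in>UNIV. \<bar>k $ j\<bar> powr (- 2 / D))"
      using elim D component_le_norm_cart[of k] by (intro prod_mono) (auto intro!: powr_mono2')
    finally show ?case by (simp add: prod_norm[symmetric] norm_divide norm_power)
  qed
qed

text \<open>The symbol of \<open>\<delta> - \<mu> D\<close>. It splits into a mass
  \<open>1 - \<mu>\<close> and a diffusive part with coefficient \<open>\<mu> / d\<close>, both
  nonnegative for \<mu> in [0,1]; \<open>ahat_eq\<close> makes this explicit.\<close>

definition ahat :: "real \<Rightarrow> real^'d \<Rightarrow> real" where
  "ahat \<mu> k = 1 - \<mu> * ((\<Sum>j\<in>UNIV. cos (k $ j)) / real CARD('d))"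

lemma ahat_eq: "ahat \<mu> (k::real^'d) = (1 - \<mu>) + \<mu> * ((\<Sum>j\<in>UNIV. 1 - cos (k $ j)) / real CARD('d))"
  by (simp add: ahat_def sum_subtractf field_simps)

lemma lattice_green_ahat: "lattice_green \<mu> = inv_fourier (\<lambda>k. of_real (1 / ahat \<mu> k))"
  by (simp add: lattice_green_def fourier_step_dist ahat_def)

lemma norm_vec_power2: "(norm (k::real^'d))\<^sup>2 = (\<Sum>j\<in>UNIV. (k $ j)\<^sup>2)"
  by (simp add: norm_vec_def L2_set_def sum_nonneg)

lemma ahat_ge:
  assumes "\<mu> \<ge> 0" "(k::real^'d) \<in> torus"
  shows "ahat \<mu> k \<ge> (1 - \<mu>) + \<mu> * (norm k)\<^sup>2 / (12 * real CARD('d))"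
proof -
  have "(\<Sum>j\<in>UNIV. (k $ j)\<^sup>2 / 12) \<le> (\<Sum>j\<in>UNIV. 1 - cos (k $ j))"
    using assms(2) by (intro sum_mono one_minus_cos_ge) (auto simp: torus_def abs_le_iff, smt (verit))
  hence "(norm k)\<^sup>2 / 12 \<le> (\<Sum>j\<in>UNIV. 1 - cos (k $ j))"
    by (simp add: norm_vec_power2 sum_divide_distrib)
  hence "\<mu> * ((norm k)\<^sup>2 / 12 / real CARD('d)) \<le> \<mu> * ((\<Sum>j\<in>UNIV. 1 - cos (k $ j)) / real CARD('d))"
    using assms(1) by (intro mult_left_mono divide_right_mono) auto
  thus ?thesis by (simp add: ahat_eq)
qed

lemma ahat_le:
  assumes "\<mu> \<ge> 0"
  shows "ahat \<mu> (k::real^'d) \<le> (1 - \<mu>) + \<mu> * (norm k)\<^sup>2 / (2 * real CARD('d))"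
proof -
  have "(\<Sum>j\<in>UNIV. 1 - cos (k $ j)) \<le> (\<Sum>j\<in>UNIV. (k $ j)\<^sup>2 / 2)"
    by (intro sum_mono one_minus_cos_le)
  hence "(\<Sum>j\<in>UNIV. 1 - cos (k $ j)) \<le> (norm k)\<^sup>2 / 2"
    by (simp add: norm_vec_power2 sum_divide_distrib)
  hence "\<mu> * ((\<Sum>j\<in>UNIV. 1 - cos (k $ j)) / real CARD('d)) \<le> \<mu> * ((norm k)\<^sup>2 / 2 / real CARD('d))"
    using assms(1) by (intro mult_left_mono divide_right_mono) auto
  thus ?thesis by (simp add: ahat_eq)
qed

lemma ahat_pos:
  assumes "\<mu> > 0" "\<mu> \<le> 1" "(k::real^'d) \<in> torus" "k \<noteq> 0"
  shows "ahat \<mu> k > 0"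
proof -
  have "0 < (1 - \<mu>) + \<mu> * (norm k)\<^sup>2 / (12 * real CARD('d))"
    using assms by (intro add_nonneg_pos) auto
  thus ?thesis using ahat_ge[of \<mu> k] assms by simp
qed

lemma borel_measurable_vec_nth [measurable]: "(\<lambda>k::real^'d::finite. k $ j) \<in> borel_measurable borel"
  by (intro borel_measurable_continuous_onI continuous_intros)

lemma borel_measurable_ahat [measurable]: "ahat \<mu> \<in> borel_measurable (borel :: (real^'d::finite) measure)"
  unfolding ahat_def[abs_def] by measurable

lemma set_integrable_inverse_ahat:
  assumes "CARD('d::finite) > 2" "\<mu> > 0" "\<mu> \<le> 1"
  shows "set_integrable lborel torus (\<lambda>k::real^'d. complex_of_real (1 / ahat \<mu> k))"
proof (rule set_integrable_bound)
  let ?c = "12 * real CARD('d) / \<mu>"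
  show "set_integrable lborel torus (\<lambda>k::real^'d. of_real ?c * complex_of_real (1 / (norm k)\<^sup>2))"
    by (intro set_integrable_mult_right set_integrable_inverse_square assms)
  show "set_borel_measurable lborel torus (\<lambda>k::real^'d. complex_of_real (1 / ahat \<mu> k))"
    unfolding set_borel_measurable_def by measurable
  show "AE k in lborel. (k :: real^'d) \<in> torus \<longrightarrow> norm (complex_of_real (1 / ahat \<mu> k))
      \<le> norm (of_real ?c * complex_of_real (1 / (norm k)\<^sup>2))"
    using AE_lborel_neq[of 0]
  proof eventually_elim
    case (elim k)
    show ?case
    proof
      assume k: "k \<in> torus"
      have p: "\<mu> * (norm k)\<^sup>2 / (12 * real CARD('d)) > 0" using elim assms by auto
      have "\<mu> * (norm k)\<^sup>2 / (12 * real CARD('d)) \<le> ahat \<mu> k"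
        using ahat_ge[OF _ k, of \<mu>] assms by simp
      hence "1 / ahat \<mu> k \<le> 1 / (\<mu> * (norm k)\<^sup>2 / (12 * real CARD('d)))"
        using p by (intro divide_left_mono mult_pos_pos) auto
      also have "\<dots> = ?c * (1 / (norm k)\<^sup>2)" by simp
      finally show "norm (complex_of_real (1 / ahat \<mu> k))
          \<le> norm (of_real ?c * complex_of_real (1 / (norm k)\<^sup>2))"
        using ahat_pos[OF assms(2,3) k elim] assms
        by (simp only: norm_mult norm_of_real) (simp add: abs_mult)
    qed
  qed
qed

section \<open>Explicit integrals over the half-line of times\<close>

lemma integral_FTC_atLeast:
  fixes f F :: "real \<Rightarrow> real"
  assumes "f \<in> borel_measurable borel" "\<And>x. a \<le> x \<Longrightarrow> (F has_real_derivative f x) (at x)"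
    "\<And>x. a \<le> x \<Longrightarrow> 0 \<le> f x" "(F \<longlongrightarrow> L) at_top"
  shows "set_integrable lborel {a..} f" "(LINT x:{a..}|lborel. f x) = L - F a"
proof -
  have "(\<integral>\<^sup>+x. ennreal (indicator {a..} x *\<^sub>R f x) \<partial>lborel) = (\<integral>\<^sup>+x. ennreal (f x) * indicator {a ..} x \<partial>lborel)"
    by (intro nn_integral_cong) (auto simp: indicator_def)
  also have "\<dots> = ennreal (L - F a)"
    by (rule nn_integral_FTC_atLeast[OF assms])
  finally have nn: "(\<integral>\<^sup>+x. ennreal (indicator {a..} x *\<^sub>R f x) \<partial>lborel) = ennreal (L - F a)" .
  have mono: "F a \<le> F x" if "a \<le> x" for x
    using that assms by (intro DERIV_nonneg_imp_nondecreasing[of a x F]) auto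
  have "F a \<le> L"
    by (rule tendsto_lowerbound[OF assms(4)])
      (auto intro!: eventually_mono[OF eventually_ge_at_top[of a]] mono)
  hence "has_bochner_integral lborel (\<lambda>x. indicator {a..} x *\<^sub>R f x) (L - F a)"
    using assms(1,3) by (intro has_bochner_integral_nn_integral[OF _ _ _ nn]) (auto simp: indicator_def)
  thus "set_integrable lborel {a..} f" "(LINT x:{a..}|lborel. f x) = L - F a"
    by (auto simp: has_bochner_integral_iff set_integrable_def set_lebesgue_integral_def)
qed

lemma integral_exp_atLeast:
  fixes a :: real
  assumes "a > 0"
  shows "set_integrable lborel {0..} (\<lambda>t. exp (- t * a))" "(LINT t:{0..}|lborel. exp (- t * a)) = 1 / a"
proof -
  have d: "((\<lambda>t. - exp (- t * a) / a) has_real_derivative exp (- t * a)) (at t)" for t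
    using assms by (auto intro!: derivative_eq_intros)
  have "filterlim (\<lambda>t. a * t) at_top at_top"
    by (rule filterlim_tendsto_pos_mult_at_top[OF tendsto_const assms filterlim_ident])
  hence "((\<lambda>t. exp (- (a * t))) \<longlongrightarrow> 0) at_top"
    by (rule filterlim_compose[OF exp_at_bot filterlim_compose[OF filterlim_uminus_at_bot_at_top]])
  hence "((\<lambda>t. exp (- t * a)) \<longlongrightarrow> 0) at_top" by (simp add: mult.commute)
  hence l: "((\<lambda>t. - exp (- t * a) / a) \<longlongrightarrow> - 0 / a) at_top"
    by (intro tendsto_intros) (use assms in auto)
  show "set_integrable lborel {0..} (\<lambda>t. exp (- t * a))" "(LINT t:{0..}|lborel. exp (- t * a)) = 1 / a"
    using integral_FTC_atLeast[OF _ d _ l, of 0] by auto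
qed

lemma integral_powr_atLeast:
  fixes b Y p :: real
  assumes "b > 0" "Y > 0" "p > 1"
  shows "set_integrable lborel {0..} (\<lambda>t. (b * t + Y) powr - p)"
    "(LINT t:{0..}|lborel. (b * t + Y) powr - p) = Y powr (1 - p) / (b * (p - 1))"
proof -
  let ?F = "\<lambda>t. - ((b * t + Y) powr (1 - p) / (b * (p - 1)))"
  have d: "(?F has_real_derivative (b * t + Y) powr - p) (at t)" if "0 \<le> t" for t
  proof -
    have "b * t + Y > 0" using assms that by (intro add_nonneg_pos) auto
    hence "((\<lambda>t. (b * t + Y) powr (1 - p)) has_real_derivative
        (1 - p) * (b * t + Y) powr (1 - p - of_nat 1) * b) (at t)"
      by (intro DERIV_fun_powr) (auto intro!: derivative_eq_intros)
    hence "(?F has_real_derivative - ((1 - p) * (b * t + Y) powr (1 - p - of_nat 1) * b / (b * (p - 1)))) (at t)"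
      by (intro DERIV_minus DERIV_cdivide)
    also have "- ((1 - p) * (b * t + Y) powr (1 - p - of_nat 1) * b / (b * (p - 1))) = (b * t + Y) powr - p"
      using assms by (simp add: divide_simps) (simp add: algebra_simps)
    finally show ?thesis .
  qed
  have "filterlim (\<lambda>t. Y + b * t) at_top at_top"
    by (rule filterlim_tendsto_add_at_top[OF tendsto_const
          filterlim_tendsto_pos_mult_at_top[OF tendsto_const assms(1) filterlim_ident]])
  hence "((\<lambda>t. (b * t + Y) powr (1 - p)) \<longlongrightarrow> 0) at_top"
    using assms by (intro tendsto_neg_powr) (auto simp: add.commute)
  hence l: "(?F \<longlongrightarrow> - (0 / (b * (p - 1)))) at_top"
    by (intro tendsto_intros) (use assms in auto)
  show "set_integrable lborel {0..} (\<lambda>t. (b * t + Y) powr - p)"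
    "(LINT t:{0..}|lborel. (b * t + Y) powr - p) = Y powr (1 - p) / (b * (p - 1))"
    using integral_FTC_atLeast[OF _ d _ l, of 0] by auto
qed

lemma jb_neq_0 [simp]: "jb x \<noteq> 0"
  using jb_pos[of x] by (simp del: jb_pos)

text \<open>Up to the factor \<open>(- 2) ^ sum m UNIV\<close>, the symbol of a product of second
  differences, \<open>m j\<close> of them in direction j. With the differences absorbed into the
  symbol, one estimate serves the Green function and all these differences.\<close>

definition vers_prod :: "('d \<Rightarrow> nat) \<Rightarrow> real^'d::finite \<Rightarrow> real" where
  "vers_prod m k = (\<Prod>j\<in>UNIV. (1 - cos (k $ j)) ^ m j)"

definition heat_prod :: "('d \<Rightarrow> nat) \<Rightarrow> real \<Rightarrow> int^'d::finite \<Rightarrow> complex" where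
  "heat_prod m T x = (\<Prod>j\<in>UNIV. heat_coeff (\<lambda>T k. (1 - cos k) ^ m j) T (x $ j))"

lemma borel_measurable_vers_prod [measurable]: "vers_prod m \<in> borel_measurable borel"
  unfolding vers_prod_def[abs_def] by measurable

lemma vers_prod_bounds: "0 \<le> vers_prod m k" "vers_prod m k \<le> 2 ^ sum m UNIV"
proof -
  show "0 \<le> vers_prod m k" by (auto simp: vers_prod_def intro!: prod_nonneg)
  have "vers_prod m k \<le> (\<Prod>j\<in>UNIV. 2 ^ m j)"
    unfolding vers_prod_def by (intro prod_mono conjI power_mono) (auto intro: order.trans[OF _ cos_ge_minus_one])
  thus "vers_prod m k \<le> 2 ^ sum m UNIV" by (simp add: power_sum)
qed

lemma vers_pow_bound:
  "\<exists>C\<ge>0. \<forall>T n. T \<ge> 0 \<longrightarrow> \<bar>of_int n\<bar> ^ N * norm (heat_coeff (\<lambda>T k. (1 - cos k) ^ m) T n)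
     \<le> C * max 1 T powr ((real N - 2 * real m - 1) / 2)"
  using heat_coeff_bound[OF heat_symbol_power[of m], of N] by simp

text \<open>A coordinate of maximal modulus is comparable with the norm, so decay in that coordinate
  alone yields decay in x.\<close>

lemma obtain_max_coordinate:
  fixes x :: "int^'d::finite"
  obtains i where "jb x \<le> real CARD('d) * max 1 \<bar>real_of_int (x $ i)\<bar>"
proof -
  obtain i where i: "\<And>j. \<bar>x $ j\<bar> \<le> \<bar>x $ i\<bar>"
    using Max_in[of "range (\<lambda>j. \<bar>x $ j\<bar>)"] Max_ge[of "range (\<lambda>j. \<bar>x $ j\<bar>)"] by fastforce
  have "norm (emb x) \<le> (\<Sum>j\<in>UNIV. \<bar>emb x $ j\<bar>)" by (rule norm_le_l1_cart)
  also have "\<dots> \<le> (\<Sum>j\<in>(UNIV::'d set). \<bar>real_of_int (x $ i)\<bar>)"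
    using i by (intro sum_mono) (simp, metis of_int_abs of_int_le_iff)
  also have "\<dots> \<le> real CARD('d) * max 1 \<bar>real_of_int (x $ i)\<bar>"
    by (simp add: mult_left_mono)
  finally have "norm (emb x) \<le> real CARD('d) * max 1 \<bar>real_of_int (x $ i)\<bar>" .
  moreover have "1 * 1 \<le> real CARD('d) * max 1 \<bar>real_of_int (x $ i)\<bar>"
    by (intro mult_mono) (auto simp: Suc_le_eq)
  ultimately show ?thesis using that by (auto simp: jb_def)
qed

text \<open>Two bounds are combined. Without spatial weights the time powers of the factors multiply
  to \<open>\<tau> powr - p\<close>. And \<open>N = 2 * p\<close> powers of the largest coordinate,
  all spent on its own factor, cancel this time decay exactly. The better of the two is of order
  \<open>T + (jb x)\<^sup>2\<close> to the power \<open>- p\<close>.\<close>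

lemma heat_prod_bound:
  fixes m :: "'d::finite \<Rightarrow> nat"
  defines "p \<equiv> real (CARD('d) + 2 * sum m UNIV) / 2"
  shows "\<exists>C\<ge>0. \<forall>T x. T \<ge> 0 \<longrightarrow> norm (heat_prod m T x) \<le> C * (T + (jb x)\<^sup>2) powr - p"
proof -
  define N where "N = CARD('d) + 2 * sum m UNIV"
  have pN: "p = real N / 2" by (simp add: p_def N_def)
  have "\<forall>j M. \<exists>C\<ge>0. \<forall>T n. T \<ge> 0 \<longrightarrow> \<bar>of_int n\<bar> ^ M * norm (heat_coeff (\<lambda>T k. (1 - cos k) ^ m j) T n)
     \<le> C * max 1 T powr ((real M - 2 * real (m j) - 1) / 2)"
    using vers_pow_bound by blast
  then obtain c where c: "\<And>j M. c j M \<ge> 0"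
    "\<And>j M T n. T \<ge> 0 \<Longrightarrow> \<bar>of_int n\<bar> ^ M * norm (heat_coeff (\<lambda>T k. (1 - cos k) ^ m j) T n)
     \<le> c j M * max 1 T powr ((real M - 2 * real (m j) - 1) / 2)"
    by metis
  define C where "C = (\<Prod>j\<in>UNIV. c j 0 + c j N)"
  have C: "C \<ge> 0" using c by (auto simp: C_def intro!: prod_nonneg add_nonneg_nonneg)
  define D where "D = real CARD('d)"
  have D: "D \<ge> 1" by (simp add: D_def Suc_le_eq)
  have exps: "(\<Sum>j\<in>UNIV. (- 2 * real (m j) - 1) / 2) = - p"
    by (simp add: pN N_def sum_divide_distrib[symmetric] sum_subtractf sum_negf sum_distrib_left field_simps)
  have "norm (heat_prod m T x) \<le> C * (1 + D\<^sup>2) powr p * (T + (jb x)\<^sup>2) powr - p" if T: "T \<ge> 0" for T x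
  proof -
    define \<tau> where "\<tau> = max 1 T"
    have \<tau>: "\<tau> \<ge> 1" by (simp add: \<tau>_def)
    define h where "h = (\<lambda>j. norm (heat_coeff (\<lambda>T k. (1 - cos k) ^ m j) T (x $ j)))"
    have nh: "norm (heat_prod m T x) = (\<Prod>j\<in>UNIV. h j)"
      by (simp add: heat_prod_def prod_norm[symmetric] h_def)
    have h0: "h j \<le> (c j 0 + c j N) * \<tau> powr ((- 2 * real (m j) - 1) / 2)" for j
    proof -
      have "h j \<le> c j 0 * \<tau> powr ((- 2 * real (m j) - 1) / 2)"
        using c(2)[OF T, of _ 0 j] by (simp add: h_def \<tau>_def)
      also have "\<dots> \<le> (c j 0 + c j N) * \<tau> powr ((- 2 * real (m j) - 1) / 2)"
        using c by (intro mult_right_mono) auto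
      finally show ?thesis .
    qed
    have powprod: "(\<Prod>j\<in>UNIV. \<tau> powr ((- 2 * real (m j) - 1) / 2)) = \<tau> powr - p"
      using \<tau> exps by (subst powr_sum[symmetric]) auto
    have b1: "norm (heat_prod m T x) \<le> C * \<tau> powr - p"
    proof -
      have "(\<Prod>j\<in>UNIV. h j) \<le> (\<Prod>j\<in>UNIV. (c j 0 + c j N) * \<tau> powr ((- 2 * real (m j) - 1) / 2))"
        by (intro prod_mono conjI h0) (simp add: h_def)
      also have "\<dots> = C * \<tau> powr - p"
        unfolding prod.distrib powprod C_def ..
      finally show ?thesis by (simp add: nh)
    qed
    obtain i where i: "jb x \<le> D * max 1 \<bar>real_of_int (x $ i)\<bar>"
      unfolding D_def by (rule obtain_max_coordinate)
    define X where "X = \<bar>real_of_int (x $ i)\<bar>"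
    have b2: "X ^ N * norm (heat_prod m T x) \<le> C"
    proof -
      have hi: "X ^ N * h i \<le> (c i 0 + c i N) * \<tau> powr ((- 2 * real (m i) - 1) / 2 + p)"
      proof -
        have "X ^ N * h i \<le> c i N * \<tau> powr ((real N - 2 * real (m i) - 1) / 2)"
          using c(2)[OF T, of _ N i] by (simp add: h_def X_def \<tau>_def)
        also have "\<dots> \<le> (c i 0 + c i N) * \<tau> powr ((real N - 2 * real (m i) - 1) / 2)"
          using c by (intro mult_right_mono) auto
        also have "(real N - 2 * real (m i) - 1) / 2 = (- 2 * real (m i) - 1) / 2 + p"
          by (simp add: pN field_simps)
        finally show ?thesis .
      qed
      have "X ^ N * (\<Prod>j\<in>UNIV. h j) = (X ^ N * h i) * (\<Prod>j\<in>UNIV - {i}. h j)"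
        by (subst prod.remove[of _ i]) auto
      also have "\<dots> \<le> ((c i 0 + c i N) * \<tau> powr ((- 2 * real (m i) - 1) / 2 + p)) *
          (\<Prod>j\<in>UNIV - {i}. (c j 0 + c j N) * \<tau> powr ((- 2 * real (m j) - 1) / 2))"
        using c \<tau> by (intro mult_mono hi prod_mono conjI h0)
          (auto simp: h_def X_def intro!: prod_nonneg mult_nonneg_nonneg add_nonneg_nonneg)
      also have "\<dots> = ((c i 0 + c i N) * \<tau> powr ((- 2 * real (m i) - 1) / 2) *
          (\<Prod>j\<in>UNIV - {i}. (c j 0 + c j N) * \<tau> powr ((- 2 * real (m j) - 1) / 2))) * \<tau> powr p"
        by (simp only: powr_add mult_ac)
      also have "\<dots> = (\<Prod>j\<in>UNIV. (c j 0 + c j N) * \<tau> powr ((- 2 * real (m j) - 1) / 2)) * \<tau> powr p"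
        by (subst prod.remove[of UNIV i]) auto
      also have "\<dots> = C * (\<tau> powr - p * \<tau> powr p)"
        unfolding prod.distrib powprod C_def by (simp only: mult_ac)
      also have "\<tau> powr - p * \<tau> powr p = 1" using \<tau> by (simp add: powr_add[symmetric])
      finally show ?thesis by (simp add: nh)
    qed
    \<comment> \<open>Bounds \<open>T + (jb x)\<^sup>2\<close> up to the factor
      \<open>1 + D\<^sup>2\<close>; which entry of the maximum is larger decides which of the two
      bounds is used.\<close>
    define Z where "Z = max \<tau> (max 1 X ^ 2)"
    have Z: "Z \<ge> 1" using \<tau> by (simp add: Z_def)
    have N0: "p \<ge> 0" by (simp add: pN)
    have "norm (heat_prod m T x) \<le> C * Z powr - p"
    proof (cases "max 1 X ^ 2 \<le> \<tau>")
      case True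
      thus ?thesis using b1 by (simp add: Z_def max_def)
    next
      case False
      have X1: "X > 1"
      proof (rule ccontr)
        assume "\<not> X > 1"
        hence "max 1 X = 1" by simp
        thus False using False \<tau> by simp
      qed
      have "Z = X\<^sup>2" using False X1 by (auto simp: Z_def max_def)
      hence "Z powr p = X ^ N"
        using X1 by (simp add: pN powr_powr powr_realpow flip: powr_numeral)
      hence Zp: "Z powr - p = inverse (X ^ N)" by (simp add: powr_minus)
      have "norm (heat_prod m T x) \<le> C / X ^ N"
        using b2 X1 by (simp add: pos_le_divide_eq mult.commute)
      thus ?thesis by (simp add: Zp divide_inverse)
    qed
    also have "C * Z powr - p \<le> C * ((1 + D\<^sup>2) powr p * (T + (jb x)\<^sup>2) powr - p)"
    proof (intro mult_left_mono C)
      have "(jb x)\<^sup>2 \<le> (D * max 1 X)\<^sup>2" using i by (intro power_mono) (auto simp: X_def)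
      also have "\<dots> \<le> D\<^sup>2 * Z" by (simp add: power_mult_distrib Z_def mult_left_mono)
      finally have "T + (jb x)\<^sup>2 \<le> (1 + D\<^sup>2) * Z"
        using T by (simp add: algebra_simps) (simp add: Z_def \<tau>_def add_mono)
      moreover have "T + (jb x)\<^sup>2 > 0" using T by (intro add_nonneg_pos) auto
      ultimately have "((1 + D\<^sup>2) * Z) powr - p \<le> (T + (jb x)\<^sup>2) powr - p"
        using N0 by (intro powr_mono2') auto
      hence "(1 + D\<^sup>2) powr p * ((1 + D\<^sup>2) * Z) powr - p \<le> (1 + D\<^sup>2) powr p * (T + (jb x)\<^sup>2) powr - p"
        by (intro mult_left_mono) auto
      moreover have "(1 + D\<^sup>2) powr p * ((1 + D\<^sup>2) * Z) powr - p = Z powr - p"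
      proof -
        have "1 + D\<^sup>2 > 0" by (auto intro: add_pos_nonneg)
        hence "(1 + D\<^sup>2) powr p * (1 + D\<^sup>2) powr - p = 1"
          by (subst powr_add[symmetric]) simp
        thus ?thesis using Z by (simp add: powr_mult mult.assoc[symmetric])
      qed
      ultimately show "Z powr - p \<le> (1 + D\<^sup>2) powr p * (T + (jb x)\<^sup>2) powr - p" by simp
    qed
    finally show ?thesis by (simp add: mult.assoc)
  qed
  moreover have "C * (1 + D\<^sup>2) powr p \<ge> 0" using C by simp
  ultimately show ?thesis by blast
qed

text \<open>\<open>t * ahat \<mu> k\<close> is \<open>t * (1 - \<mu>)\<close> plus the sum over j of
  \<open>(t * \<mu> / d) * (1 - cos (k $ j))\<close>, so the exponential factorizes and each
  coordinate runs at time \<open>t * \<mu> / d\<close>.\<close>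

lemma inv_fourier_heat:
  fixes x :: "int^'d::finite"
  assumes "t \<ge> 0"
  shows "inv_fourier (\<lambda>k. of_real (vers_prod m k * exp (- t * ahat \<mu> k))) x
    = of_real (exp (- t * (1 - \<mu>)) / (2 * pi) ^ CARD('d)) * heat_prod m (t * \<mu> / real CARD('d)) x"
proof -
  let ?D = "real CARD('d)"
  let ?T = "t * \<mu> / ?D"
  let ?f = "\<lambda>j k. exp (- \<i> * of_real (k * of_int (x $ j))) *
     complex_of_real ((1 - cos k) ^ m j * exp (- ?T * (1 - cos k)))"
  have int: "set_integrable lborel {-pi<..pi} (?f j)" for j
    by (intro set_integrable_Ioc continuous_intros)
  have e1: "exp (- \<i> * of_real (k \<bullet> emb x)) = (\<Prod>j\<in>UNIV. exp (- \<i> * of_real (k $ j * of_int (x $ j))))" for k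
    by (subst exp_sum[symmetric]) (simp_all add: inner_vec_def sum_distrib_left sum_negf)
  have e2: "exp (- t * ahat \<mu> k) = exp (- t * (1 - \<mu>)) * (\<Prod>j\<in>UNIV. exp (- ?T * (1 - cos (k $ j))))" for k :: "real^'d"
  proof -
    have "(\<Prod>j\<in>UNIV. exp (- ?T * (1 - cos (k $ j)))) = exp (- ?T * (\<Sum>j\<in>UNIV. 1 - cos (k $ j)))"
      by (subst exp_sum[symmetric]) (simp_all only: sum_distrib_left finite_class.finite_UNIV)
    thus ?thesis by (simp add: ahat_eq exp_add[symmetric] algebra_simps)
  qed
  have eq: "inv_fourier_integrand (\<lambda>k. of_real (vers_prod m k * exp (- t * ahat \<mu> k))) x k
    = of_real (exp (- t * (1 - \<mu>)) / (2 * pi) ^ CARD('d)) * (\<Prod>j\<in>UNIV. ?f j (k $ j))" for k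
    unfolding inv_fourier_integrand_def e1 e2 vers_prod_def
    by (simp add: prod.distrib field_simps)
  show ?thesis
    unfolding inv_fourier_def eq set_integral_mult_right torus_vec_prod(2)[OF int] heat_prod_def heat_coeff_def ..
qed

text \<open>Fubini for \<open>1 / ahat = \<integral> exp (- t * ahat) dt\<close>. The integral of
  the modulus over t reproduces \<open>1 / ahat\<close>, so the integrability of the latter on the
  torus, hence d > 2, justifies the exchange; the origin is a null set.\<close>

lemma inv_fourier_green_heat:
  fixes x :: "int^'d::finite"
  assumes d: "CARD('d) > 2" and \<mu>: "\<mu> > 0" "\<mu> \<le> 1"
  shows "inv_fourier (\<lambda>k. of_real (vers_prod m k / ahat \<mu> k)) x
    = (LINT t:{0..}|lborel. inv_fourier (\<lambda>k. of_real (vers_prod m k * exp (- t * ahat \<mu> k))) x)"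
proof -
  let ?K = "lborel :: (real^'d) measure" and ?T = "lborel :: real measure"
  define g where "g = (\<lambda>k. indicator torus k *\<^sub>R inv_fourier_integrand (\<lambda>k. of_real (vers_prod m k)) x k)"
  define H where "H = (\<lambda>k t. g k * of_real (indicator {0..} t * exp (- t * ahat \<mu> k)))"
  have gm [measurable]: "g \<in> borel_measurable borel"
    unfolding g_def inv_fourier_integrand_def by measurable
  have nI: "norm (inv_fourier_integrand (\<lambda>k. of_real (vers_prod m k)) x k) = vers_prod m k / (2 * pi) ^ CARD('d)" for k
    using vers_prod_bounds[of m k] by (simp add: inv_fourier_integrand_def norm_mult norm_divide norm_power)
  have ex: "integrable ?T (\<lambda>t. indicator {0..} t * exp (- t * ahat \<mu> k))"
    "(LINT t|?T. indicator {0..} t * exp (- t * ahat \<mu> k)) = 1 / ahat \<mu> k" if "k \<in> torus" "k \<noteq> 0" for k :: "real^'d"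
    using integral_exp_atLeast[OF ahat_pos[OF \<mu> that]]
    by (simp_all add: set_integrable_def set_lebesgue_integral_def)
  have out: "g k = 0" if "k \<notin> torus" for k using that by (simp add: g_def)
  have nH: "norm (H k t) = norm (g k) * (indicator {0..} t * exp (- t * ahat \<mu> k))" for k t
    by (simp add: H_def norm_mult indicator_def)
  have int: "integrable (?K \<Otimes>\<^sub>M ?T) (\<lambda>(k, t). H k t)"
  proof (rule lborel_pair.Fubini_integrable)
    show "(\<lambda>(k, t). H k t) \<in> borel_measurable (?K \<Otimes>\<^sub>M ?T)"
      unfolding H_def by measurable
    have "set_integrable lborel torus (\<lambda>k::real^'d. of_real (2 ^ sum m UNIV / (2 * pi) ^ CARD('d)) * complex_of_real (1 / ahat \<mu> k))"
      by (intro set_integrable_mult_right set_integrable_inverse_ahat d \<mu>)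
    hence I: "integrable ?K (\<lambda>k. indicator torus k *\<^sub>R (of_real (2 ^ sum m UNIV / (2 * pi) ^ CARD('d)) * complex_of_real (1 / ahat \<mu> k)))"
      by (simp add: set_integrable_def)
    show "integrable ?K (\<lambda>k. LINT t|?T. norm (case (k, t) of (k, t) \<Rightarrow> H k t))"
    proof (rule Bochner_Integration.integrable_bound[OF I])
      show "(\<lambda>k. LINT t|?T. norm (case (k, t) of (k, t) \<Rightarrow> H k t)) \<in> borel_measurable ?K"
        unfolding H_def by measurable
      show "AE k in ?K. norm (LINT t|?T. norm (case (k, t) of (k, t) \<Rightarrow> H k t))
        \<le> norm (indicator torus k *\<^sub>R (of_real (2 ^ sum m UNIV / (2 * pi) ^ CARD('d)) * complex_of_real (1 / ahat \<mu> k)))"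
        using AE_lborel_neq[of 0]
      proof eventually_elim
        case (elim k)
        show ?case
        proof (cases "k \<in> torus")
          case True
          have "norm (LINT t|?T. norm (H k t)) = norm (g k) * (1 / ahat \<mu> k)"
            using ex[OF True elim] ahat_pos[OF \<mu> True elim] by (simp add: nH)
          also have "\<dots> \<le> (2 ^ sum m UNIV / (2 * pi) ^ CARD('d)) * (1 / ahat \<mu> k)"
            using True vers_prod_bounds[of m k] ahat_pos[OF \<mu> True elim]
            by (intro mult_right_mono) (auto simp: g_def nI divide_right_mono)
          finally show ?thesis
            using True ahat_pos[OF \<mu> True elim] by (simp add: norm_mult norm_divide norm_power)
        qed (simp add: nH out)
      qed
    qed
    show "AE k in ?K. integrable ?T (\<lambda>t. case (k, t) of (k, t) \<Rightarrow> H k t)"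
      using AE_lborel_neq[of 0]
    proof eventually_elim
      case (elim k)
      show ?case
      proof (cases "k \<in> torus")
        case True
        have "integrable ?T (\<lambda>t. g k * complex_of_real (indicator {0..} t * exp (- t * ahat \<mu> k)))"
          by (intro integrable_mult_right integrable_of_real ex True elim)
        thus ?thesis by (simp add: H_def)
      qed (simp add: H_def out)
    qed
  qed
  have "inv_fourier (\<lambda>k. of_real (vers_prod m k / ahat \<mu> k)) x = (LINT k|?K. g k * of_real (1 / ahat \<mu> k))"
    unfolding inv_fourier_def set_lebesgue_integral_def
    by (rule Bochner_Integration.integral_cong)
      (simp_all add: g_def inv_fourier_integrand_def scaleR_conv_of_real)
  also have "\<dots> = (LINT k|?K. LINT t|?T. H k t)"
  proof (rule integral_cong_AE)
    show "AE k in ?K. g k * of_real (1 / ahat \<mu> k) = (LINT t|?T. H k t)"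
      using AE_lborel_neq[of 0]
    proof eventually_elim
      case (elim k)
      show ?case
      proof (cases "k \<in> torus")
        case True
        have "(LINT t|?T. H k t) = g k * of_real (LINT t|?T. indicator {0..} t * exp (- t * ahat \<mu> k))"
          unfolding H_def integral_mult_right_zero integral_complex_of_real ..
        thus ?thesis using ex(2)[OF True elim] by simp
      qed (simp add: H_def out)
    qed
    show "(\<lambda>k. LINT t|?T. H k t) \<in> borel_measurable ?K" unfolding H_def by measurable
  qed measurable
  also have "\<dots> = (LINT t|?T. LINT k|?K. H k t)"
    by (rule lborel_pair.Fubini_integral[OF int, symmetric])
  also have "\<dots> = (LINT t:{0..}|lborel. inv_fourier (\<lambda>k. of_real (vers_prod m k * exp (- t * ahat \<mu> k))) x)"
    unfolding set_lebesgue_integral_def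
  proof (rule Bochner_Integration.integral_cong)
    fix t :: real
    have "(LINT k|?K. H k t) = (LINT k|?K. of_real (indicator {0..} t) * (indicator torus k *\<^sub>R inv_fourier_integrand (\<lambda>k. of_real (vers_prod m k * exp (- t * ahat \<mu> k))) x k))"
      by (rule Bochner_Integration.integral_cong) (auto simp: H_def g_def inv_fourier_integrand_def indicator_def)
    also have "\<dots> = of_real (indicator {0..} t) * inv_fourier (\<lambda>k. of_real (vers_prod m k * exp (- t * ahat \<mu> k))) x"
      unfolding inv_fourier_def set_lebesgue_integral_def by (rule integral_mult_right_zero)
    finally show "(LINT k|?K. H k t) = indicator {0..} t *\<^sub>R inv_fourier (\<lambda>k. of_real (vers_prod m k * exp (- t * ahat \<mu> k))) x"
      by (simp add: scaleR_conv_of_real)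
  qed simp
  finally show ?thesis .
qed

text \<open>Integrating \<open>(\<mu> * t / d + (jb x)\<^sup>2) powr - p\<close> over t loses one
  power of the base, i.e. two powers of \<open>jb x\<close>, and costs the factor
  \<open>d / \<mu>\<close>. It converges since d > 2 forces \<open>p > 1\<close>.\<close>

lemma green_vers_bound:
  fixes m :: "'d::finite \<Rightarrow> nat"
  assumes d: "CARD('d) > 2"
  shows "\<exists>C\<ge>0. \<forall>\<mu> x. 0 < \<mu> \<and> \<mu> \<le> 1 \<longrightarrow>
    norm (inv_fourier (\<lambda>k. of_real (vers_prod m k / ahat \<mu> k)) x)
      \<le> C / \<mu> * jb x powr - (real CARD('d) - 2 + 2 * real (sum m UNIV))"
proof -
  define p where "p = real (CARD('d) + 2 * sum m UNIV) / 2"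
  have "real CARD('d) > 2" using d by linarith
  hence p: "p > 1" by (simp add: p_def add_pos_nonneg del: of_nat_sum)
  obtain C where C: "C \<ge> 0"
    and bd: "\<And>T x. T \<ge> 0 \<Longrightarrow> norm (heat_prod m T x) \<le> C * (T + (jb x)\<^sup>2) powr - p"
    using heat_prod_bound[of m] unfolding p_def by blast
  define D where "D = real CARD('d)"
  have D: "D > 0" by (simp add: D_def)
  define P where "P = (2 * pi) ^ CARD('d)"
  have P: "P > 0" by (simp add: P_def)
  have "norm (inv_fourier (\<lambda>k. of_real (vers_prod m k / ahat \<mu> k)) x)
      \<le> (C * D / (P * (p - 1))) / \<mu> * jb x powr - (real CARD('d) - 2 + 2 * real (sum m UNIV))"
    if \<mu>: "0 < \<mu>" "\<mu> \<le> 1" for \<mu> and x :: "int^'d"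
  proof -
    let ?I = "\<lambda>t. inv_fourier (\<lambda>k::real^'d. of_real (vers_prod m k * exp (- t * ahat \<mu> k))) x"
    note ip = integral_powr_atLeast[of "\<mu> / D" "(jb x)\<^sup>2" p]
    have le: "norm (?I t) \<le> C / P * ((\<mu> / D) * t + (jb x)\<^sup>2) powr - p" if t: "t \<ge> 0" for t
    proof -
      have "norm (?I t) = exp (- t * (1 - \<mu>)) / P * norm (heat_prod m (t * \<mu> / D) x)"
        unfolding inv_fourier_heat[OF t] P_def D_def by (simp add: norm_mult norm_divide norm_power)
      also have "\<dots> \<le> 1 / P * (C * (t * \<mu> / D + (jb x)\<^sup>2) powr - p)"
        using t \<mu> P D C by (intro mult_mono divide_right_mono bd) auto
      finally show ?thesis by (simp add: mult_ac)
    qed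
    have "norm (inv_fourier (\<lambda>k. of_real (vers_prod m k / ahat \<mu> k)) x) = norm (LINT t:{0..}|lborel. ?I t)"
      by (simp only: inv_fourier_green_heat[OF d \<mu>])
    also have "\<dots> \<le> (LINT t:{0..}|lborel. C / P * ((\<mu> / D) * t + (jb x)\<^sup>2) powr - p)"
      unfolding set_lebesgue_integral_def
    \<comment> \<open>If the integrand in t were not integrable, its Bochner integral would be 0 by
      convention and the bound would be trivial, so no integrability proof is required.\<close>
    proof (cases "integrable lborel (\<lambda>t. indicator {0..} t *\<^sub>R ?I t)")
      case True
      thus "norm (LINT t|lborel. indicator {0..} t *\<^sub>R ?I t)
          \<le> (LINT t|lborel. indicator {0..} t *\<^sub>R (C / P * ((\<mu> / D) * t + (jb x)\<^sup>2) powr - p))"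
      proof (rule Bochner_Integration.integral_norm_bound_integral)
        have "set_integrable lborel {0..} (\<lambda>t. C / P * ((\<mu> / D) * t + (jb x)\<^sup>2) powr - p)"
          using ip(1) \<mu> D p by (intro set_integrable_mult_right) simp
        thus "integrable lborel (\<lambda>t. indicator {0..} t *\<^sub>R (C / P * ((\<mu> / D) * t + (jb x)\<^sup>2) powr - p))"
          by (simp add: set_integrable_def)
      qed (use le in \<open>auto simp: indicator_def\<close>)
    next
      case False
      thus "norm (LINT t|lborel. indicator {0..} t *\<^sub>R ?I t)
          \<le> (LINT t|lborel. indicator {0..} t *\<^sub>R (C / P * ((\<mu> / D) * t + (jb x)\<^sup>2) powr - p))"
        using C P by (auto simp: not_integrable_integral_eq intro!: Bochner_Integration.integral_nonneg)
    qed
    also have "\<dots> = C / P * ((jb x)\<^sup>2 powr (1 - p) / (\<mu> / D * (p - 1)))"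
      using ip(2) \<mu> D p unfolding set_integral_mult_right by simp
    also have "(jb x)\<^sup>2 powr (1 - p) = jb x powr - (real CARD('d) - 2 + 2 * real (sum m UNIV))"
    proof -
      have "(jb x)\<^sup>2 powr (1 - p) = jb x powr (2 * (1 - p))"
        by (simp add: powr_powr flip: powr_numeral)
      also have "2 * (1 - p) = - (real CARD('d) - 2 + 2 * real (sum m UNIV))"
        by (simp add: p_def field_simps)
      finally show ?thesis .
    qed
    finally show ?thesis using D \<mu> by (simp add: field_simps)
  qed
  moreover have "C * D / (P * (p - 1)) \<ge> 0" using C D P p by simp
  ultimately show ?thesis by blast
qed

section \<open>Second differences\<close>

definition sdiff :: "'d \<Rightarrow> (int^'d \<Rightarrow> complex) \<Rightarrow> int^'d \<Rightarrow> complex" where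
  "sdiff j u x = u (x + axis j 1) + u (x - axis j 1) - 2 * u x"

lemma emb_axis: "emb (axis j a) = axis j (real_of_int a)"
  by (auto simp: emb_def axis_def vec_eq_iff)

lemma inv_fourier_shift: "inv_fourier \<phi> (x + y) = inv_fourier (\<lambda>k. exp (- \<i> * of_real (k \<bullet> emb y)) * \<phi> k) x"
proof -
  have "inv_fourier_integrand \<phi> (x + y) = inv_fourier_integrand (\<lambda>k. exp (- \<i> * of_real (k \<bullet> emb y)) * \<phi> k) x"
    by (auto simp: inv_fourier_integrand_def emb_add inner_add_right exp_add[symmetric] algebra_simps)
  thus ?thesis by (simp add: inv_fourier_def)
qed

lemma sdiff_inv_fourier:
  assumes \<phi>: "set_integrable lborel torus \<phi>"
  shows "sdiff j (inv_fourier \<phi>) x = - 2 * inv_fourier (\<lambda>k. of_real (1 - cos (k $ j)) * \<phi> k) x"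
proof -
  let ?e = "\<lambda>s k. exp (- \<i> * of_real (k \<bullet> emb (axis j s))) * \<phi> k"
  have i: "set_integrable lborel torus (?e s)" for s
    by (rule set_integrable_bound_mult[OF \<phi>, of _ 1]) (auto simp: emb_axis inner_axis)
  have i2: "set_integrable lborel torus (\<lambda>k. ?e 1 k + ?e (- 1) k)"
    by (rule set_integral_add[OF i i])
  have eq: "- 2 * (of_real (1 - cos (k $ j)) * \<phi> k) = (?e 1 k + ?e (- 1) k) + (- 2) * \<phi> k" for k
  proof -
    have "exp (\<i> * of_real (k $ j)) + exp (\<i> * of_real (- (k $ j))) = 2 * complex_of_real (cos (k $ j))"
      by (simp add: complex_eq_iff Re_exp Im_exp)
    hence "?e 1 k + ?e (- 1) k = 2 * complex_of_real (cos (k $ j)) * \<phi> k"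
      by (simp add: emb_axis inner_axis distrib_right[symmetric] add.commute)
    thus ?thesis by (simp add: algebra_simps)
  qed
  have "x - axis j 1 = x + axis j (- 1)" by (simp add: vec_eq_iff axis_def)
  hence "sdiff j (inv_fourier \<phi>) x = inv_fourier (?e 1) x + inv_fourier (?e (- 1)) x - 2 * inv_fourier \<phi> x"
    unfolding sdiff_def by (simp only: inv_fourier_shift)
  also have "\<dots> = inv_fourier (\<lambda>k. (?e 1 k + ?e (- 1) k) + (- 2) * \<phi> k) x"
    by (subst inv_fourier_add[OF i2 set_integrable_mult_right[OF \<phi>]], subst inv_fourier_add[OF i i],
        subst inv_fourier_cmult) simp
  also have "\<dots> = - 2 * inv_fourier (\<lambda>k. of_real (1 - cos (k $ j)) * \<phi> k) x"
    unfolding eq[symmetric] by (rule inv_fourier_cmult)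
  finally show ?thesis .
qed

lemma vers_prod_delta: "vers_prod (\<lambda>i. if i = j then 1 else 0) k = 1 - cos (k $ j)"
proof -
  have "vers_prod (\<lambda>i. if i = j then 1 else 0) k = (\<Prod>i\<in>UNIV. if i = j then 1 - cos (k $ i) else 1)"
    unfolding vers_prod_def by (rule prod.cong) auto
  thus ?thesis by simp
qed

lemma vers_prod_add: "vers_prod (\<lambda>i. m i + n i) k = vers_prod m k * vers_prod n k"
  by (simp add: vers_prod_def power_add prod.distrib)

definition decays :: "real \<Rightarrow> real \<Rightarrow> (int^'d \<Rightarrow> complex) \<Rightarrow> bool" where
  "decays B a u \<longleftrightarrow> (\<forall>x. norm (u x) \<le> B * jb x powr - a)"

text \<open>What the convolution estimates use of the Green function: each second difference gains
  two powers. Stated for an arbitrary u, so that those estimates do not involve \<mu>.\<close>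

definition green_bounds :: "real \<Rightarrow> (int^'d::finite \<Rightarrow> complex) \<Rightarrow> bool" where
  "green_bounds c u \<longleftrightarrow> decays c (real CARD('d) - 2) u \<and> (\<forall>j. decays c (real CARD('d)) (sdiff j u)) \<and>
     (\<forall>i j. decays c (real CARD('d) + 2) (sdiff i (sdiff j u)))"

lemma green_boundsD:
  fixes u :: "int^'d::finite \<Rightarrow> complex"
  assumes "green_bounds c u"
  shows "norm (u x) \<le> c * jb x powr - (real CARD('d) - 2)"
    and "norm (sdiff j u x) \<le> c * jb x powr - real CARD('d)"
    and "norm (sdiff i (sdiff j u) x) \<le> c * jb x powr - (real CARD('d) + 2)"
  using assms by (auto simp: green_bounds_def decays_def)

text \<open>The constant in \<open>green_vers_bound\<close> degenerates like 1/\<mu>; the lower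
  bound \<open>\<mu>0\<close> restores uniformity.\<close>

lemma lattice_green_bounds:
  assumes d: "CARD('d::finite) > 2" and \<mu>0: "\<mu>0 > 0"
  shows "\<exists>c\<ge>0. \<forall>\<mu>. \<mu>0 \<le> \<mu> \<and> \<mu> \<le> 1 \<longrightarrow>
    green_bounds c (lattice_green \<mu> :: int^'d \<Rightarrow> complex)"
proof -
  define \<delta> :: "'d \<Rightarrow> 'd \<Rightarrow> nat" where "\<delta> = (\<lambda>j i. if i = j then 1 else 0)"
  have s\<delta>: "sum (\<delta> j) UNIV = 1" for j by (simp add: \<delta>_def)
  have "\<forall>m::'d \<Rightarrow> nat. \<exists>C\<ge>0. \<forall>\<mu> x. 0 < \<mu> \<and> \<mu> \<le> 1 \<longrightarrow>
    norm (inv_fourier (\<lambda>k. of_real (vers_prod m k / ahat \<mu> k)) x)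
      \<le> C / \<mu> * jb x powr - (real CARD('d) - 2 + 2 * real (sum m UNIV))"
    using green_vers_bound[OF d] by blast
  then obtain C where C: "\<And>m::'d \<Rightarrow> nat. C m \<ge> 0"
    "\<And>(m::'d \<Rightarrow> nat) \<mu> x. 0 < \<mu> \<Longrightarrow> \<mu> \<le> 1 \<Longrightarrow> norm (inv_fourier (\<lambda>k. of_real (vers_prod m k / ahat \<mu> k)) x)
      \<le> C m / \<mu> * jb x powr - (real CARD('d) - 2 + 2 * real (sum m UNIV))"
    by metis
  \<comment> \<open>One constant for all of the finitely many choices of directions; each second
    difference contributes a factor 2 from its symbol
    \<open>- 2 * (1 - cos (k $ j))\<close>.\<close>
  define c where "c = (C (\<lambda>_. 0) + (\<Sum>j\<in>UNIV. 2 * C (\<delta> j)) + (\<Sum>i\<in>UNIV. \<Sum>j\<in>UNIV. 4 * C (\<lambda>l. \<delta> i l + \<delta> j l))) / \<mu>0"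
  have ge: "C (\<lambda>_. 0) \<le> c * \<mu>0" "2 * C (\<delta> j) \<le> c * \<mu>0" "4 * C (\<lambda>l. \<delta> i l + \<delta> j l) \<le> c * \<mu>0" for i j
  proof -
    have s2: "2 * C (\<delta> j) \<le> (\<Sum>j\<in>UNIV. 2 * C (\<delta> j))"
      by (rule member_le_sum) (auto intro: C)
    have "4 * C (\<lambda>l. \<delta> i l + \<delta> j l) \<le> (\<Sum>j\<in>UNIV. 4 * C (\<lambda>l. \<delta> i l + \<delta> j l))"
      by (rule member_le_sum[of _ _ "\<lambda>j. 4 * C (\<lambda>l. \<delta> i l + \<delta> j l)"]) (auto intro: C)
    also have "\<dots> \<le> (\<Sum>i\<in>UNIV. \<Sum>j\<in>UNIV. 4 * C (\<lambda>l. \<delta> i l + \<delta> j l))"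
      by (rule member_le_sum[of _ _ "\<lambda>i. \<Sum>j\<in>UNIV. 4 * C (\<lambda>l. \<delta> i l + \<delta> j l)"]) (auto intro!: C sum_nonneg)
    finally have s3: "4 * C (\<lambda>l. \<delta> i l + \<delta> j l) \<le> (\<Sum>i\<in>UNIV. \<Sum>j\<in>UNIV. 4 * C (\<lambda>l. \<delta> i l + \<delta> j l))" .
    have n: "0 \<le> (\<Sum>j\<in>UNIV. 2 * C (\<delta> j))" "0 \<le> (\<Sum>i\<in>UNIV. \<Sum>j\<in>UNIV. 4 * C (\<lambda>l. \<delta> i l + \<delta> j l))"
      by (auto intro!: sum_nonneg C)
    show "C (\<lambda>_. 0) \<le> c * \<mu>0" "2 * C (\<delta> j) \<le> c * \<mu>0" "4 * C (\<lambda>l. \<delta> i l + \<delta> j l) \<le> c * \<mu>0"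
      using s2 s3 n C(1)[of "\<lambda>_. 0"] \<mu>0 by (simp_all add: c_def)
  qed
  have c0: "c \<ge> 0"
    using \<mu>0 unfolding c_def by (intro divide_nonneg_pos add_nonneg_nonneg sum_nonneg mult_nonneg_nonneg C(1)) auto
  have "norm (lattice_green \<mu> x) \<le> c * jb x powr - (real CARD('d) - 2) \<and>
    norm (sdiff j (lattice_green \<mu>) x) \<le> c * jb x powr - real CARD('d) \<and>
    norm (sdiff i (sdiff j (lattice_green \<mu>)) x) \<le> c * jb x powr - (real CARD('d) + 2)"
    if \<mu>: "\<mu>0 \<le> \<mu>" "\<mu> \<le> 1" for \<mu> i j and x :: "int^'d"
  proof -
    have \<mu>p: "0 < \<mu>" using \<mu> \<mu>0 by simp
    let ?G = "\<lambda>m x. inv_fourier (\<lambda>k::real^'d. of_real (vers_prod m k / ahat \<mu> k)) x"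
    have le: "K * norm (?G m x) \<le> c * jb x powr - (real CARD('d) - 2 + 2 * real (sum m UNIV))"
      if "K * C m \<le> c * \<mu>0" "K \<ge> 0" for m K
    proof -
      have "K * norm (?G m x) \<le> K * (C m / \<mu> * jb x powr - (real CARD('d) - 2 + 2 * real (sum m UNIV)))"
        using that \<mu>p \<mu> by (intro mult_left_mono C) auto
      also have "\<dots> = (K * C m) / \<mu> * jb x powr - (real CARD('d) - 2 + 2 * real (sum m UNIV))" by simp
      also have "(K * C m) / \<mu> \<le> c"
      proof -
        have "K * C m \<le> c * \<mu>" using that(1) mult_left_mono[OF \<mu>(1) c0] by simp
        thus ?thesis using \<mu>p by (simp add: pos_divide_le_eq)
      qed
      finally show ?thesis by (simp add: mult_right_mono)
    qed
    have int: "set_integrable lborel torus (\<lambda>k::real^'d. complex_of_real (vers_prod m k) * complex_of_real (1 / ahat \<mu> k))" for m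
      by (rule set_integrable_bound_mult[OF set_integrable_inverse_ahat[OF d \<mu>p \<mu>(2)], of _ "2 ^ sum m UNIV"])
        (use vers_prod_bounds[of m] in auto)
    have G0: "lattice_green \<mu> = ?G (\<lambda>_. 0)"
      by (simp add: lattice_green_ahat vers_prod_def)
    have step: "sdiff j (?G m) x = - 2 * ?G (\<lambda>l. \<delta> j l + m l) x" for j m x
    proof -
      have "(\<lambda>k::real^'d. complex_of_real (vers_prod m k / ahat \<mu> k)) = (\<lambda>k. complex_of_real (vers_prod m k) * complex_of_real (1 / ahat \<mu> k))"
        by auto
      hence "sdiff j (?G m) x = - 2 * inv_fourier (\<lambda>k. of_real (1 - cos (k $ j)) * (complex_of_real (vers_prod m k) * complex_of_real (1 / ahat \<mu> k))) x"
        using sdiff_inv_fourier[OF int, of j m] by simp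
      also have "(\<lambda>k. of_real (1 - cos (k $ j)) * (complex_of_real (vers_prod m k) * complex_of_real (1 / ahat \<mu> k)))
         = (\<lambda>k::real^'d. of_real (vers_prod (\<lambda>l. \<delta> j l + m l) k / ahat \<mu> k))"
        unfolding vers_prod_add \<delta>_def vers_prod_delta by (simp add: fun_eq_iff)
      finally show ?thesis .
    qed
    have G1: "sdiff j (lattice_green \<mu>) = (\<lambda>x. - 2 * ?G (\<delta> j) x)" for j
      unfolding G0 by (rule ext, subst step) simp
    have G2: "sdiff i (sdiff j (lattice_green \<mu>)) x = 4 * ?G (\<lambda>l. \<delta> i l + \<delta> j l) x"
    proof -
      have "sdiff i (sdiff j (lattice_green \<mu>)) x = - 2 * sdiff i (?G (\<delta> j)) x"
        unfolding G1 by (simp add: sdiff_def algebra_simps)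
      thus ?thesis unfolding step by simp
    qed
    have "norm (lattice_green \<mu> x) \<le> c * jb x powr - (real CARD('d) - 2)"
      using le[of 1 "\<lambda>_. 0"] ge(1) by (simp add: G0)
    moreover have "norm (sdiff j (lattice_green \<mu>) x) \<le> c * jb x powr - real CARD('d)"
      using le[of 2 "\<delta> j"] ge(2)[of j] s\<delta>[of j] by (simp add: G1 norm_mult del: of_nat_sum)
    moreover have "norm (sdiff i (sdiff j (lattice_green \<mu>)) x) \<le> c * jb x powr - (real CARD('d) + 2)"
      using le[of 4 "\<lambda>l. \<delta> i l + \<delta> j l"] ge(3)[of i j] s\<delta>[of j] s\<delta>[of i]
      by (simp add: G2 norm_mult sum.distrib add.commute del: of_nat_sum)
    ultimately show ?thesis by blast
  qed
  hence "green_bounds c (lattice_green \<mu> :: int^'d \<Rightarrow> complex)" if "\<mu>0 \<le> \<mu>" "\<mu> \<le> 1" for \<mu>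
    using that unfolding green_bounds_def decays_def by blast
  with c0 show ?thesis by blast
qed

section \<open>Discrete Taylor expansion\<close>

text \<open>The second difference of g(n) = f(n) + f(-n) - 2 f(0) at n is the sum of those of f at n
  and -n. Hence the increments of g are at most \<open>(2 * n + 1) * B\<close>, and these odd
  numbers sum to squares.\<close>

lemma second_difference_bound:
  fixes f :: "int \<Rightarrow> complex"
  assumes "\<And>t. \<bar>t\<bar> \<le> int N \<Longrightarrow> norm (f (t + 1) + f (t - 1) - 2 * f t) \<le> B"
  shows "norm (f (int N) + f (- int N) - 2 * f 0) \<le> (real N)\<^sup>2 * B"
proof -
  define g where "g = (\<lambda>n. f (int n) + f (- int n) - 2 * f 0)"
  have B: "B \<ge> 0" using order.trans[OF norm_ge_zero assms[of 0]] by simp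
  have "norm (g n) \<le> (real n)\<^sup>2 * B \<and> norm (g (Suc n) - g n) \<le> (2 * real n + 1) * B" if "n \<le> N" for n
    using that
  proof (induction n)
    case 0
    show ?case using assms[of 0] by (simp add: g_def algebra_simps)
  next
    case (Suc n)
    hence IH: "norm (g n) \<le> (real n)\<^sup>2 * B" "norm (g (Suc n) - g n) \<le> (2 * real n + 1) * B" by auto
    have "g (Suc n) = g n + (g (Suc n) - g n)" by simp
    hence "norm (g (Suc n)) \<le> norm (g n) + norm (g (Suc n) - g n)" using norm_triangle_ineq by metis
    also have "\<dots> \<le> (real n)\<^sup>2 * B + (2 * real n + 1) * B" using IH by simp
    also have "\<dots> = (real (Suc n))\<^sup>2 * B" by (simp add: power2_eq_square algebra_simps)
    finally have 1: "norm (g (Suc n)) \<le> (real (Suc n))\<^sup>2 * B" .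
    let ?D = "\<lambda>t. f (t + 1) + f (t - 1) - 2 * f t"
    have "g (Suc (Suc n)) - g (Suc n) = (g (Suc n) - g n) + ?D (int (Suc n)) + ?D (- int (Suc n))"
      by (simp add: g_def algebra_simps)
    also have "norm \<dots> \<le> norm (g (Suc n) - g n) + norm (?D (int (Suc n))) + norm (?D (- int (Suc n)))"
      by (intro norm_triangle_mono norm_triangle_ineq order_refl)
    also have "\<dots> \<le> (2 * real n + 1) * B + B + B"
      using Suc.prems by (intro add_mono IH assms) auto
    also have "\<dots> = (2 * real (Suc n) + 1) * B" by (simp add: algebra_simps)
    finally show ?case using 1 by blast
  qed
  thus ?thesis by (simp add: g_def)
qed

text \<open>After subtraction of \<open>n\<^sup>2 * D 0\<close> the second differences at n become
  \<open>D n + D (- n) - 2 * D 0\<close>, which \<open>second_difference_bound\<close> applied to D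
  controls. Summing twice gives a fourth power, with the crude constant 1.\<close>

lemma fourth_difference_bound:
  fixes f :: "int \<Rightarrow> complex"
  defines "D \<equiv> \<lambda>t. f (t + 1) + f (t - 1) - 2 * f t"
  assumes "\<And>t. \<bar>t\<bar> \<le> int N \<Longrightarrow> norm (D (t + 1) + D (t - 1) - 2 * D t) \<le> B"
  shows "norm (f (int N) + f (- int N) - 2 * f 0 - of_nat (N\<^sup>2) * D 0) \<le> real N ^ 4 * B"
proof -
  define h where "h = (\<lambda>n. f (int n) + f (- int n) - 2 * f 0 - of_nat (n\<^sup>2) * D 0)"
  have B: "B \<ge> 0" using order.trans[OF norm_ge_zero assms(2)[of 0]] by simp
  have "norm (h n) \<le> real n ^ 4 * B \<and> norm (h (Suc n) - h n) \<le> real (Suc n) ^ 3 * B" if "n \<le> N" for n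
    using that
  proof (induction n)
    case 0
    have "h 0 = 0" "h (Suc 0) = 0" by (simp_all add: h_def D_def)
    thus ?case using B by simp
  next
    case (Suc n)
    hence IH: "norm (h n) \<le> real n ^ 4 * B" "norm (h (Suc n) - h n) \<le> real (Suc n) ^ 3 * B" by auto
    have "h (Suc n) = h n + (h (Suc n) - h n)" by simp
    hence "norm (h (Suc n)) \<le> norm (h n) + norm (h (Suc n) - h n)" using norm_triangle_ineq by metis
    also have "\<dots> \<le> real n ^ 4 * B + real (Suc n) ^ 3 * B" using IH by simp
    also have "\<dots> \<le> real n * real (Suc n) ^ 3 * B + real (Suc n) ^ 3 * B"
    proof -
      have "real n ^ 4 = real n * real n ^ 3" by (simp add: eval_nat_numeral)
      also have "\<dots> \<le> real n * real (Suc n) ^ 3" by (intro mult_left_mono power_mono) auto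
      finally show ?thesis using B by (simp add: mult_right_mono)
    qed
    also have "\<dots> = real (Suc n) ^ 4 * B" by (simp add: eval_nat_numeral algebra_simps)
    finally have 1: "norm (h (Suc n)) \<le> real (Suc n) ^ 4 * B" .
    have "h (Suc (Suc n)) - h (Suc n) = (h (Suc n) - h n) + (D (int (Suc n)) + D (- int (Suc n)) - 2 * D 0)"
      by (simp add: h_def D_def power2_eq_square algebra_simps)
    also have "norm \<dots> \<le> norm (h (Suc n) - h n) + norm (D (int (Suc n)) + D (- int (Suc n)) - 2 * D 0)"
      by (rule norm_triangle_ineq)
    also have "\<dots> \<le> real (Suc n) ^ 3 * B + (real (Suc n))\<^sup>2 * B"
      using Suc.prems by (intro add_mono IH second_difference_bound assms) auto
    also have "\<dots> = real (Suc n) ^ 2 * real (Suc (Suc n)) * B" by (simp add: eval_nat_numeral algebra_simps)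
    also have "\<dots> \<le> real (Suc (Suc n)) ^ 2 * real (Suc (Suc n)) * B"
      using B by (intro mult_right_mono power_mono) auto
    also have "\<dots> = real (Suc (Suc n)) ^ 3 * B" by (simp add: eval_nat_numeral)
    finally show ?case using 1 by blast
  qed
  thus ?thesis by (simp add: h_def)
qed

section \<open>Reflections and paths along the coordinate axes\<close>

definition reflect :: "'d \<Rightarrow> int^'d \<Rightarrow> int^'d" where
  "reflect i y = (\<chi> j. if j = i then - (y $ j) else y $ j)"

text \<open>As J grows by one coordinate at a time, these are the corners of an axis-parallel path
  from 0 to y; the Taylor expansions below are inductions along it.\<close>

definition restrict_coords :: "'d set \<Rightarrow> int^'d \<Rightarrow> int^'d" where
  "restrict_coords J y = (\<chi> j. if j \<in> J then y $ j else 0)"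

text \<open>The part of the lattice symmetry that removes the odd Taylor terms. It is the property
  later verified for the correction built from the convolution inverse.\<close>

definition coord_even :: "(int^'d \<Rightarrow> 'a) \<Rightarrow> bool" where
  "coord_even E \<longleftrightarrow> (\<forall>i y. E (reflect i y) = E y)"

lemma reflect_reflect [simp]: "reflect i (reflect i y) = y"
  by (simp add: reflect_def vec_eq_iff)

lemma norm_emb_reflect [simp]: "norm (emb (reflect i y)) = norm (emb y)"
  unfolding norm_vec_def L2_set_def emb_def reflect_def
  by (intro arg_cong[where f = sqrt] sum.cong) auto

lemma restrict_coords_UNIV [simp]: "restrict_coords UNIV y = y"
  by (simp add: restrict_coords_def vec_eq_iff)

lemma restrict_coords_empty [simp]: "restrict_coords {} y = 0"
  by (simp add: restrict_coords_def vec_eq_iff)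

lemma restrict_coords_insert:
  "i \<notin> J \<Longrightarrow> restrict_coords (insert i J) y = restrict_coords J y + axis i (y $ i)"
  by (auto simp: restrict_coords_def vec_eq_iff axis_def)

lemma restrict_coords_reflect: "i \<notin> J \<Longrightarrow> restrict_coords J (reflect i y) = restrict_coords J y"
  by (auto simp: restrict_coords_def vec_eq_iff reflect_def)

text \<open>The path and the segments swept by symmetrization stay in the ball of radius |y|, so
  bounds on differences near x apply along all of them.\<close>

lemma norm_restrict_coords_add:
  assumes "i \<notin> J" "\<bar>t\<bar> \<le> \<bar>y $ i\<bar>"
  shows "norm (emb (restrict_coords J y + axis i t)) \<le> norm (emb y)"
  using assms
  by (intro norm_le_componentwise_cart) (auto simp: restrict_coords_def axis_def simp flip: of_int_abs)

lemma sum_reflect: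
  assumes "\<And>y. y \<in> Y \<Longrightarrow> reflect i y \<in> Y"
  shows "sum g Y = (\<Sum>y\<in>Y. g (reflect i y))"
  by (rule sum.reindex_bij_witness[of _ "reflect i" "reflect i"]) (use assms in auto)

lemma axis_add: "axis i (a + b) = axis i a + axis i (b::int)"
  by (simp add: vec_eq_iff axis_def)

lemma axis_uminus: "axis i (- a) = - axis i (a::int)"
  by (simp add: vec_eq_iff axis_def)

text \<open>Averaging over the reflection in the new coordinate turns the increment along it into a
  symmetric second difference.\<close>

lemma symmetrized_increment:
  fixes E :: "int^'d \<Rightarrow> complex"
  assumes "\<And>y. y \<in> Y \<Longrightarrow> reflect i y \<in> Y" and E: "coord_even E" and i: "i \<notin> J"
  shows "(\<Sum>y\<in>Y. E y * u (x - restrict_coords (insert i J) y)) =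
    (\<Sum>y\<in>Y. E y * ((u (x - restrict_coords J y - axis i (y $ i)) + u (x - restrict_coords J y + axis i (y $ i))) / 2))"
proof -
  let ?S = "\<Sum>y\<in>Y. E y * u (x - restrict_coords (insert i J) y)"
  let ?A = "\<Sum>y\<in>Y. E y * u (x - restrict_coords J y - axis i (y $ i))"
  let ?B = "\<Sum>y\<in>Y. E y * u (x - restrict_coords J y + axis i (y $ i))"
  have "?S = ?A" by (simp add: restrict_coords_insert[OF i] diff_diff_eq)
  moreover have "?A = ?B"
  proof -
    have r: "E (reflect i y) = E y" "reflect i y $ i = - (y $ i)" for y
      using E by (simp_all add: coord_even_def, simp add: reflect_def)
    show ?thesis
      using assms(1) by (subst sum_reflect[where i = i])
        (simp_all add: r restrict_coords_reflect[OF i] axis_uminus)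
  qed
  ultimately have "?S = (?A + ?B) / 2" by simp
  also have "\<dots> = (\<Sum>y\<in>Y. E y * ((u (x - restrict_coords J y - axis i (y $ i)) + u (x - restrict_coords J y + axis i (y $ i))) / 2))"
    by (simp add: sum.distrib[symmetric] sum_divide_distrib algebra_simps)
  finally show ?thesis .
qed

lemma line_second_difference:
  fixes u :: "int^'d \<Rightarrow> complex"
  assumes "\<And>t. \<bar>t\<bar> \<le> \<bar>m\<bar> \<Longrightarrow> norm (sdiff i u (z + axis i t)) \<le> B"
  shows "norm ((u (z - axis i m) + u (z + axis i m)) / 2 - u z) \<le> (real_of_int m)\<^sup>2 * B"
proof -
  define f where "f = (\<lambda>t. u (z + axis i t))"
  define N where "N = nat \<bar>m\<bar>"
  have "norm (f (int N) + f (- int N) - 2 * f 0) \<le> (real N)\<^sup>2 * B"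
  proof (rule second_difference_bound)
    fix t assume "\<bar>t\<bar> \<le> int N"
    hence "norm (sdiff i u (z + axis i t)) \<le> B" by (intro assms) (simp add: N_def)
    thus "norm (f (t + 1) + f (t - 1) - 2 * f t) \<le> B"
      by (simp add: f_def sdiff_def axis_add add.assoc add_diff_eq diff_conv_add_uminus axis_uminus del: add_uminus_conv_diff)
  qed
  also have "(real N)\<^sup>2 = (real_of_int m)\<^sup>2" by (simp add: N_def)
  also have "f (int N) + f (- int N) - 2 * f 0 = 2 * ((u (z - axis i m) + u (z + axis i m)) / 2 - u z)"
    by (cases "m \<ge> 0") (simp_all add: f_def N_def axis_uminus axis_def[of i 0] zero_vec_def[symmetric])
  finally have "2 * norm ((u (z - axis i m) + u (z + axis i m)) / 2 - u z) \<le> (real_of_int m)\<^sup>2 * B"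
    by (simp only: norm_mult norm_numeral)
  thus ?thesis using norm_ge_zero[of "(u (z - axis i m) + u (z + axis i m)) / 2 - u z"] by linarith
qed

lemma line_fourth_difference:
  fixes u :: "int^'d \<Rightarrow> complex"
  assumes "\<And>t. \<bar>t\<bar> \<le> \<bar>m\<bar> \<Longrightarrow> norm (sdiff i (sdiff i u) (z + axis i t)) \<le> B"
  shows "norm ((u (z - axis i m) + u (z + axis i m)) / 2 - u z - of_int (m\<^sup>2) / 2 * sdiff i u z) \<le> (real_of_int m) ^ 4 * B"
proof -
  define f where "f = (\<lambda>t. u (z + axis i t))"
  define N where "N = nat \<bar>m\<bar>"
  define D where "D = (\<lambda>t. f (t + 1) + f (t - 1) - 2 * f t)"
  have D: "D t = sdiff i u (z + axis i t)" for t
    by (simp add: D_def f_def sdiff_def axis_add add.assoc add_diff_eq diff_conv_add_uminus axis_uminus del: add_uminus_conv_diff)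
  have "norm (f (int N) + f (- int N) - 2 * f 0 - of_nat (N\<^sup>2) * D 0) \<le> real N ^ 4 * B"
  proof -
    have "norm (D (t + 1) + D (t - 1) - 2 * D t) \<le> B" if "\<bar>t\<bar> \<le> int N" for t
    proof -
    have "norm (sdiff i (sdiff i u) (z + axis i t)) \<le> B" using that by (intro assms) (simp add: N_def)
    thus ?thesis
      unfolding D by (simp add: sdiff_def[of i "sdiff i u"] axis_add add.assoc add_diff_eq diff_conv_add_uminus axis_uminus del: add_uminus_conv_diff)
    qed
    thus ?thesis unfolding D_def by (rule fourth_difference_bound)
  qed
  also have "real N ^ 4 = (real_of_int m) ^ 4" by (simp add: N_def)
  also have "f (int N) + f (- int N) - 2 * f 0 - of_nat (N\<^sup>2) * D 0 =
     2 * ((u (z - axis i m) + u (z + axis i m)) / 2 - u z - of_int (m\<^sup>2) / 2 * sdiff i u z)"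
  proof -
    have "(of_nat (N\<^sup>2) :: complex) = of_int (int (N\<^sup>2))" by simp
    also have "int (N\<^sup>2) = m\<^sup>2" by (simp add: N_def)
    finally have N2: "(of_nat (N\<^sup>2) :: complex) = of_int (m\<^sup>2)" .
    have a0: "axis i (0::int) = 0" by (simp add: vec_eq_iff axis_def)
    have "f (int N) + f (- int N) = u (z - axis i m) + u (z + axis i m)"
      by (cases "m \<ge> 0") (simp_all add: f_def N_def axis_uminus)
    moreover have "f 0 = u z" "D 0 = sdiff i u z" by (simp_all add: f_def D a0)
    ultimately show ?thesis unfolding N2 by (simp add: algebra_simps)
  qed
  finally have "2 * norm ((u (z - axis i m) + u (z + axis i m)) / 2 - u z - of_int (m\<^sup>2) / 2 * sdiff i u z) \<le> (real_of_int m) ^ 4 * B"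
    by (simp only: norm_mult norm_numeral)
  thus ?thesis
    using norm_ge_zero[of "(u (z - axis i m) + u (z + axis i m)) / 2 - u z - of_int (m\<^sup>2) / 2 * sdiff i u z"] by linarith
qed

text \<open>Induction along the axis-parallel path: averaging over reflections turns the increment
  in the new coordinate i into a symmetric one, bounded by \<open>(y $ i)\<^sup>2 * B\<close>, so no
  first-order term arises.\<close>

lemma taylor_order_2:
  fixes E u :: "int^'d \<Rightarrow> complex"
  assumes Y: "finite Y" "\<And>i y. y \<in> Y \<Longrightarrow> reflect i y \<in> Y" "\<And>y. y \<in> Y \<Longrightarrow> norm (emb y) \<le> R"
    and E: "coord_even E"
    and B: "\<And>i z. norm (emb (z - x)) \<le> R \<Longrightarrow> norm (sdiff i u z) \<le> B"
    and J: "finite J"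
  shows "norm (\<Sum>y\<in>Y. E y * (u (x - restrict_coords J y) - u x))
    \<le> (\<Sum>y\<in>Y. norm (E y) * (\<Sum>j\<in>J. (real_of_int (y $ j))\<^sup>2)) * B"
  using J
proof (induction J rule: finite_induct)
  case empty
  show ?case by simp
next
  case (insert i J)
  let ?z = "\<lambda>y. x - restrict_coords J y"
  let ?s = "\<lambda>y. (u (?z y - axis i (y $ i)) + u (?z y + axis i (y $ i))) / 2"
  have sy: "(\<Sum>y\<in>Y. E y * u (x - restrict_coords (insert i J) y)) = (\<Sum>y\<in>Y. E y * ?s y)"
    by (rule symmetrized_increment[OF Y(2) E insert.hyps(2)])
  have step: "norm (?s y - u (?z y)) \<le> (real_of_int (y $ i))\<^sup>2 * B" if "y \<in> Y" for y
  proof (rule line_second_difference)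
    fix t assume t: "\<bar>t\<bar> \<le> \<bar>y $ i\<bar>"
    have "?z y + axis i t - x = - (restrict_coords J y + axis i (- t))" by (simp add: axis_uminus)
    hence "norm (emb (?z y + axis i t - x)) \<le> norm (emb y)"
      using norm_restrict_coords_add[of i J "- t" y] insert.hyps t by (simp only: emb_uminus norm_minus_cancel) simp
    thus "norm (sdiff i u (?z y + axis i t)) \<le> B" using Y(3)[OF that] by (intro B) simp
  qed
  have eq: "(\<Sum>y\<in>Y. E y * (u (x - restrict_coords (insert i J) y) - u x))
      = (\<Sum>y\<in>Y. E y * (?s y - u (?z y))) + (\<Sum>y\<in>Y. E y * (u (?z y) - u x))"
    by (simp only: right_diff_distrib sum_subtractf sy) simp
  have "norm (\<Sum>y\<in>Y. E y * (u (x - restrict_coords (insert i J) y) - u x))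
      \<le> norm (\<Sum>y\<in>Y. E y * (?s y - u (?z y))) + norm (\<Sum>y\<in>Y. E y * (u (?z y) - u x))"
    unfolding eq by (rule norm_triangle_ineq)
  also have "\<dots> \<le> (\<Sum>y\<in>Y. norm (E y) * (real_of_int (y $ i))\<^sup>2) * B
      + (\<Sum>y\<in>Y. norm (E y) * (\<Sum>j\<in>J. (real_of_int (y $ j))\<^sup>2)) * B"
  proof -
    have "norm (\<Sum>y\<in>Y. E y * (?s y - u (?z y))) \<le> (\<Sum>y\<in>Y. norm (E y) * (real_of_int (y $ i))\<^sup>2 * B)"
    proof (rule sum_norm_le)
      fix y assume y: "y \<in> Y"
      show "norm (E y * (?s y - u (?z y))) \<le> norm (E y) * (real_of_int (y $ i))\<^sup>2 * B"
        unfolding norm_mult mult.assoc by (rule mult_left_mono[OF step[OF y] norm_ge_zero])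
    qed
    with insert.IH show ?thesis by (simp only: sum_distrib_right add_mono)
  qed
  also have "\<dots> = (\<Sum>y\<in>Y. norm (E y) * (\<Sum>j\<in>insert i J. (real_of_int (y $ j))\<^sup>2)) * B"
    using insert.hyps by (simp add: distrib_left sum.distrib distrib_right)
  finally show ?case .
qed

text \<open>In each step the quadratic term appears at the corner
  \<open>x - restrict_coords J y\<close> rather than at x. Moving it to x is a second-order
  expansion of \<open>sdiff i u\<close> against the kernel \<open>E y * (y $ i)\<^sup>2 / 2\<close>,
  which is again even; this is where mixed fourth differences come in.\<close>

lemma taylor_order_4:
  fixes E u :: "int^'d \<Rightarrow> complex"
  assumes Y: "finite Y" "\<And>i y. y \<in> Y \<Longrightarrow> reflect i y \<in> Y" "\<And>y. y \<in> Y \<Longrightarrow> norm (emb y) \<le> R"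
    and E: "coord_even E"
    and B: "\<And>i j z. norm (emb (z - x)) \<le> R \<Longrightarrow> norm (sdiff i (sdiff j u) z) \<le> B"
    and B0: "B \<ge> 0"
    and J: "finite J"
  shows "norm (\<Sum>y\<in>Y. E y * (u (x - restrict_coords J y) - u x - (\<Sum>j\<in>J. of_int ((y $ j)\<^sup>2) / 2 * sdiff j u x)))
    \<le> (\<Sum>y\<in>Y. norm (E y) * (\<Sum>j\<in>J. (real_of_int (y $ j))\<^sup>2)\<^sup>2) * B"
  using J
proof (induction J rule: finite_induct)
  case empty
  show ?case by simp
next
  case (insert i J)
  let ?z = "\<lambda>y. x - restrict_coords J y"
  let ?s = "\<lambda>y. (u (?z y - axis i (y $ i)) + u (?z y + axis i (y $ i))) / 2"
  let ?c = "\<lambda>y. of_int ((y $ i)\<^sup>2) / 2 :: complex"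
  let ?T = "\<lambda>y. (\<Sum>j\<in>J. of_int ((y $ j)\<^sup>2) / 2 * sdiff j u x)"
  let ?Q = "\<lambda>y. (\<Sum>j\<in>J. (real_of_int (y $ j))\<^sup>2)"
  let ?q = "\<lambda>y. (real_of_int (y $ i))\<^sup>2"
  have sy: "(\<Sum>y\<in>Y. E y * u (x - restrict_coords (insert i J) y)) = (\<Sum>y\<in>Y. E y * ?s y)"
    by (rule symmetrized_increment[OF Y(2) E insert.hyps(2)])
  have step: "norm (?s y - u (?z y) - ?c y * sdiff i u (?z y)) \<le> (real_of_int (y $ i)) ^ 4 * B" if "y \<in> Y" for y
  proof (rule line_fourth_difference)
    fix t assume t: "\<bar>t\<bar> \<le> \<bar>y $ i\<bar>"
    have "?z y + axis i t - x = - (restrict_coords J y + axis i (- t))" by (simp add: axis_uminus)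
    hence "norm (emb (?z y + axis i t - x)) \<le> norm (emb y)"
      using norm_restrict_coords_add[of i J "- t" y] insert.hyps t by (simp only: emb_uminus norm_minus_cancel) simp
    thus "norm (sdiff i (sdiff i u) (?z y + axis i t)) \<le> B" using Y(3)[OF that] by (intro B) simp
  qed
  have E': "coord_even (\<lambda>y. E y * ?c y)"
    using E by (auto simp: coord_even_def reflect_def)
  have "(\<Sum>y\<in>Y. E y * (u (x - restrict_coords (insert i J) y) - u x - (\<Sum>j\<in>insert i J. of_int ((y $ j)\<^sup>2) / 2 * sdiff j u x)))
      = (\<Sum>y\<in>Y. E y * u (x - restrict_coords (insert i J) y))
        - (\<Sum>y\<in>Y. E y * (u x + (?T y + ?c y * sdiff i u x)))"
    using insert.hyps by (simp add: sum_subtractf[symmetric] algebra_simps)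
  also have "\<dots> = (\<Sum>y\<in>Y. E y * (?s y - u (?z y) - ?c y * sdiff i u (?z y)))
      + (\<Sum>y\<in>Y. (E y * ?c y) * (sdiff i u (?z y) - sdiff i u x))
      + (\<Sum>y\<in>Y. E y * (u (?z y) - u x - ?T y))"
    unfolding sy sum_subtractf[symmetric] sum.distrib[symmetric]
    by (rule sum.cong) (simp_all add: field_simps)
  finally have eq: "(\<Sum>y\<in>Y. E y * (u (x - restrict_coords (insert i J) y) - u x - (\<Sum>j\<in>insert i J. of_int ((y $ j)\<^sup>2) / 2 * sdiff j u x)))
    = (\<Sum>y\<in>Y. E y * (?s y - u (?z y) - ?c y * sdiff i u (?z y)))
      + (\<Sum>y\<in>Y. (E y * ?c y) * (sdiff i u (?z y) - sdiff i u x))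
      + (\<Sum>y\<in>Y. E y * (u (?z y) - u x - ?T y))" .
  have "norm (\<Sum>y\<in>Y. E y * (u (x - restrict_coords (insert i J) y) - u x - (\<Sum>j\<in>insert i J. of_int ((y $ j)\<^sup>2) / 2 * sdiff j u x))) \<le> norm (\<Sum>y\<in>Y. E y * (?s y - u (?z y) - ?c y * sdiff i u (?z y)))
      + norm (\<Sum>y\<in>Y. (E y * ?c y) * (sdiff i u (?z y) - sdiff i u x))
      + norm (\<Sum>y\<in>Y. E y * (u (?z y) - u x - ?T y))"
    unfolding eq by (intro norm_triangle_mono norm_triangle_ineq order_refl)
  also have "\<dots> \<le> (\<Sum>y\<in>Y. norm (E y) * (real_of_int (y $ i)) ^ 4) * B
      + (\<Sum>y\<in>Y. norm (E y * ?c y) * ?Q y) * B + (\<Sum>y\<in>Y. norm (E y) * (?Q y)\<^sup>2) * B"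
  proof (rule add_mono[OF add_mono insert.IH])
    show "norm (\<Sum>y\<in>Y. E y * (?s y - u (?z y) - ?c y * sdiff i u (?z y)))
        \<le> (\<Sum>y\<in>Y. norm (E y) * (real_of_int (y $ i)) ^ 4) * B"
      unfolding sum_distrib_right
    proof (rule sum_norm_le)
      fix y assume y: "y \<in> Y"
      show "norm (E y * (?s y - u (?z y) - ?c y * sdiff i u (?z y))) \<le> norm (E y) * (real_of_int (y $ i)) ^ 4 * B"
        unfolding norm_mult mult.assoc by (rule mult_left_mono[OF step[OF y] norm_ge_zero])
    qed
    show "norm (\<Sum>y\<in>Y. (E y * ?c y) * (sdiff i u (?z y) - sdiff i u x)) \<le> (\<Sum>y\<in>Y. norm (E y * ?c y) * ?Q y) * B"
      by (rule taylor_order_2[OF Y E' B insert.hyps(1)])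
  qed
  also have "\<dots> = (\<Sum>y\<in>Y. norm (E y) * (real_of_int (y $ i)) ^ 4 + norm (E y * ?c y) * ?Q y + norm (E y) * (?Q y)\<^sup>2) * B"
    by (simp add: sum.distrib distrib_right)
  also have "\<dots> \<le> (\<Sum>y\<in>Y. norm (E y) * (\<Sum>j\<in>insert i J. (real_of_int (y $ j))\<^sup>2)\<^sup>2) * B"
  proof (intro mult_right_mono sum_mono B0)
    fix y
    have Q: "?Q y \<ge> 0" by (intro sum_nonneg) auto
    have c: "norm (?c y) = ?q y / 2" by (simp add: norm_divide norm_power)
    have "norm (E y) * (real_of_int (y $ i)) ^ 4 + norm (E y * ?c y) * ?Q y + norm (E y) * (?Q y)\<^sup>2
        = norm (E y) * ((?q y)\<^sup>2 + ?q y * ?Q y / 2 + (?Q y)\<^sup>2)"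
      unfolding norm_mult c by (simp add: algebra_simps flip: power_mult)
    \<comment> \<open>The pure, mixed and inductive errors fit together into the square of the
      enlarged sum, which is why the bound is stated as a square.\<close>
    also have "\<dots> \<le> norm (E y) * (?q y + ?Q y)\<^sup>2"
    proof (intro mult_left_mono)
      have "0 \<le> ?q y * ?Q y" using Q by simp
      thus "(?q y)\<^sup>2 + ?q y * ?Q y / 2 + (?Q y)\<^sup>2 \<le> (?q y + ?Q y)\<^sup>2"
        unfolding power2_sum by linarith
    qed simp
    also have "?q y + ?Q y = (\<Sum>j\<in>insert i J. (real_of_int (y $ j))\<^sup>2)"
      using insert.hyps by simp
    finally show "norm (E y) * (real_of_int (y $ i)) ^ 4 + norm (E y * ?c y) * ?Q y + norm (E y) * (?Q y)\<^sup>2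
       \<le> norm (E y) * (\<Sum>j\<in>insert i J. (real_of_int (y $ j))\<^sup>2)\<^sup>2" .
  qed
  finally show ?case .
qed

lemma finite_lattice_ball: "finite {y::int^'d::finite. norm (emb y) \<le> R}"
proof -
  define n where "n = \<lceil>R\<rceil>"
  have "($) ` {y::int^'d. norm (emb y) \<le> R} \<subseteq> PiE UNIV (\<lambda>_. {- n..n})"
  proof
    fix f assume "f \<in> ($) ` {y::int^'d. norm (emb y) \<le> R}"
    then obtain y :: "int^'d" where y: "f = ($) y" "norm (emb y) \<le> R" by auto
    have "\<bar>y $ j\<bar> \<le> n" for j
    proof -
      have "\<bar>real_of_int (y $ j)\<bar> \<le> R" using component_le_norm_cart[of "emb y" j] y(2) by simp
      hence "real_of_int \<bar>y $ j\<bar> \<le> of_int n" unfolding n_def of_int_abs using le_of_int_ceiling[of R] by linarith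
      thus ?thesis by linarith
    qed
    thus "f \<in> PiE UNIV (\<lambda>_. {- n..n})" using y(1) by (auto simp: abs_le_iff minus_le_iff)
  qed
  moreover have "finite (PiE (UNIV :: 'd set) (\<lambda>_. {- n..n}))" by (intro finite_PiE) auto
  ultimately have "finite (($) ` {y::int^'d. norm (emb y) \<le> R})" by (rule finite_subset)
  thus ?thesis by (rule finite_imageD) (auto simp: inj_on_def vec_eq_iff)
qed

section \<open>Convolution of kernels with vanishing moments\<close>

lemma jb_far: "norm (emb y) > norm (emb x) / 2 \<Longrightarrow> jb y \<ge> jb x / 2"
  by (auto simp: jb_def max_def)

lemma jb_near:
  assumes "norm (emb (z - x)) \<le> norm (emb x) / 2"
  shows "jb z \<ge> jb x / 2"
proof -
  have "norm (emb x) \<le> norm (emb z) + norm (emb (z - x))"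
    using norm_triangle_ineq4[of "emb z" "emb (z - x)"] by (simp add: emb_diff)
  thus ?thesis using assms by (auto simp: jb_def max_def)
qed

lemma half_powr:
  assumes "jb y \<ge> jb x / 2" "a \<ge> 0"
  shows "jb y powr - a \<le> 2 powr a * jb x powr - a"
proof -
  have "jb y powr - a \<le> (jb x / 2) powr - a"
    using assms jb_pos[of x] by (intro powr_mono2') auto
  also have "\<dots> = 2 powr a * jb x powr - a"
    by (simp add: powr_divide powr_minus field_simps)
  finally show ?thesis .
qed

lemma infsum_split_finite:
  fixes g :: "'a \<Rightarrow> complex"
  assumes "g summable_on UNIV" "finite Y"
  shows "infsum g UNIV = sum g Y + infsum g (- Y)"
proof -
  have "infsum g (Y \<union> - Y) = infsum g Y + infsum g (- Y)"
    using assms by (intro infsum_Un_disjoint) (auto intro: summable_on_subset_banach)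
  thus ?thesis using assms by simp
qed

lemma infsum_complement_bound:
  fixes g :: "int^'d::finite \<Rightarrow> complex"
  assumes e: "e > 0" and "l1 g" and M: "M \<ge> 0"
    and le: "\<And>y. y \<notin> Y \<Longrightarrow> norm (g y) \<le> M * jb y powr - (real CARD('d) + e)"
  shows "norm (infsum g (- Y)) \<le> M * jbsum TYPE('d) e"
proof -
  let ?w = "\<lambda>y::int^'d. M * jb y powr - (real CARD('d) + e)"
  have w: "?w summable_on UNIV" by (intro summable_on_cmult_right summable_jb_powr e)
  have wY: "?w summable_on (- Y)" by (rule summable_on_subset_banach[OF w]) auto
  have gY: "(\<lambda>y. norm (g y)) summable_on (- Y)" by (rule summable_on_subset_banach[OF assms(2)]) auto
  have "norm (infsum g (- Y)) \<le> (\<Sum>\<^sub>\<infinity>y\<in>- Y. norm (g y))" by (rule norm_infsum_bound[OF gY])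
  also have "\<dots> \<le> infsum ?w (- Y)" by (rule infsum_mono[OF gY wY]) (use le in auto)
  also have "\<dots> \<le> infsum ?w UNIV" by (rule infsum_mono2[OF wY w]) (use M in auto)
  also have "\<dots> = M * jbsum TYPE('d) e" by (simp add: jbsum_def infsum_cmult_right')
  finally show ?thesis .
qed

text \<open>As the total sum is 0, the sum over Y is minus the sum over the complement, where
  \<open>jb y\<close> is at least half of \<open>jb x\<close>: b powers are converted into decay in
  x, and the remaining \<open>d + e\<close> are summable.\<close>

lemma tail_sum_bound:
  fixes g :: "int^'d::finite \<Rightarrow> complex"
  assumes e: "e > 0" and b: "b \<ge> 0" and M: "M \<ge> 0" and Y: "finite Y"
    and g: "\<And>y. norm (g y) \<le> M * jb y powr - (real CARD('d) + e + b)" "infsum g UNIV = 0"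
    and far: "\<And>y. y \<notin> Y \<Longrightarrow> jb y \<ge> jb x / 2"
  shows "norm (sum g Y) \<le> M * 2 powr b * jb x powr - b * jbsum TYPE('d) e"
proof -
  have l: "l1 g" by (rule l1_bound(1)[of g M "e + b"]) (use g e b in \<open>auto simp: add.assoc\<close>)
  have "sum g Y = - infsum g (- Y)"
    using infsum_split_finite[OF l1_summable[OF l] Y] g(2) by (simp add: add_eq_0_iff2)
  hence "norm (sum g Y) = norm (infsum g (- Y))" by simp
  also have "\<dots> \<le> (M * (2 powr b * jb x powr - b)) * jbsum TYPE('d) e"
  proof (rule infsum_complement_bound[OF e l])
    fix y assume y: "y \<notin> Y"
    have "norm (g y) \<le> M * (jb y powr - b * jb y powr - (real CARD('d) + e))"
      using g(1)[of y] by (simp add: powr_add[symmetric] add_ac)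
    also have "\<dots> \<le> M * ((2 powr b * jb x powr - b) * jb y powr - (real CARD('d) + e))"
      by (intro mult_left_mono mult_right_mono half_powr far y b M) auto
    finally show "norm (g y) \<le> M * (2 powr b * jb x powr - b) * jb y powr - (real CARD('d) + e)"
      by (simp add: mult.assoc)
  qed (use M in auto)
  finally show ?thesis by (simp add: mult.assoc)
qed

text \<open>With decay \<open>d + \<sigma>\<close>, moments of order q over a ball of radius about
  |x| grow at most like |x| to the power \<open>q - \<sigma>'\<close>. Taking
  \<open>\<sigma>'\<close> below \<sigma> avoids logarithms and leaves a convergent sum.\<close>

lemma near_moment_bound:
  fixes E :: "int^'d::finite \<Rightarrow> complex"
  assumes e: "\<sigma>' < \<sigma>" and q: "\<sigma>' \<le> q" and B: "B \<ge> 0" and Y: "finite Y"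
    and E: "\<And>y. norm (E y) \<le> B * jb y powr - (real CARD('d) + \<sigma>)"
    and near: "\<And>y. y \<in> Y \<Longrightarrow> jb y \<le> jb x"
  shows "(\<Sum>y\<in>Y. norm (E y) * jb y powr q) \<le> B * jb x powr (q - \<sigma>') * jbsum TYPE('d) (\<sigma> - \<sigma>')"
proof -
  have "(\<Sum>y\<in>Y. norm (E y) * jb y powr q) \<le> (\<Sum>y\<in>Y. B * jb x powr (q - \<sigma>') * jb y powr - (real CARD('d) + (\<sigma> - \<sigma>')))"
  proof (rule sum_mono)
    fix y assume y: "y \<in> Y"
    have eqp: "jb y powr - (real CARD('d) + \<sigma>) * jb y powr q = jb y powr (q - \<sigma>') * jb y powr - (real CARD('d) + (\<sigma> - \<sigma>'))"
      by (simp only: powr_add[symmetric]) (rule arg_cong[where f = "(powr) (jb y)"], simp)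
    have "norm (E y) * jb y powr q \<le> B * jb y powr - (real CARD('d) + \<sigma>) * jb y powr q"
      by (intro mult_right_mono E) auto
    also have "\<dots> = B * (jb y powr (q - \<sigma>') * jb y powr - (real CARD('d) + (\<sigma> - \<sigma>')))"
      unfolding mult.assoc eqp ..
    also have "\<dots> \<le> B * (jb x powr (q - \<sigma>') * jb y powr - (real CARD('d) + (\<sigma> - \<sigma>')))"
      using near[OF y] q by (intro mult_left_mono mult_right_mono powr_mono2 B) auto
    finally show "norm (E y) * jb y powr q \<le> B * jb x powr (q - \<sigma>') * jb y powr - (real CARD('d) + (\<sigma> - \<sigma>'))"
      by (simp add: mult.assoc)
  qed
  also have "\<dots> = B * jb x powr (q - \<sigma>') * (\<Sum>y\<in>Y. jb y powr - (real CARD('d) + (\<sigma> - \<sigma>')))"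
    by (simp add: sum_distrib_left)
  also have "\<dots> \<le> B * jb x powr (q - \<sigma>') * jbsum TYPE('d) (\<sigma> - \<sigma>')"
    unfolding jbsum_def using e B Y
    by (intro mult_left_mono finite_sum_le_infsum summable_jb_powr) auto
  finally show ?thesis .
qed

text \<open>There are two regimes for y far from 0. If x - y is far as well, both factors decay in x
  and a part of the decay of E is kept for summation. If x - y is close to 0, E decays fully in x,
  and u, which decays too slowly to be summed, is made summable by spending \<open>2 + e\<close>
  powers of |x|. Both regimes give \<open>d - 2 + \<sigma>'\<close>.\<close>

lemma far_part_bound:
  fixes E u :: "int^'d::finite \<Rightarrow> complex"
  assumes d: "CARD('d) > 2" and s: "0 \<le> \<sigma>'" "\<sigma>' < \<sigma>" and B: "B \<ge> 0" and c: "c \<ge> 0"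
    and E: "\<And>y. norm (E y) \<le> B * jb y powr - (real CARD('d) + \<sigma>)"
    and u: "\<And>y. norm (u y) \<le> c * jb y powr - (real CARD('d) - 2)"
    and far: "\<And>y. y \<notin> Y \<Longrightarrow> jb y \<ge> jb x / 2"
  shows "norm (\<Sum>\<^sub>\<infinity>y\<in>- Y. E y * u (x - y)) \<le>
    B * c * (2 * 2 powr (real CARD('d) + \<sigma>) * jbsum TYPE('d) (\<sigma> - \<sigma>')) * jb x powr - (real CARD('d) - 2 + \<sigma>')"
proof -
  define D where "D = real CARD('d)"
  have D: "D > 2" using d by (simp add: D_def)
  define e where "e = \<sigma> - \<sigma>'"
  have e: "e > 0" using s by (simp add: e_def)
  let ?w = "\<lambda>y::int^'d. jb y powr - (D + e)"
  define K where "K = B * c * 2 powr (D + \<sigma>) * jb x powr - (D - 2 + \<sigma>')"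
  have K: "K \<ge> 0" using B c by (simp add: K_def)
  have w: "?w summable_on UNIV" unfolding D_def by (rule summable_jb_powr[OF e])
  have wx: "(\<lambda>y. ?w (x - y)) summable_on UNIV"
    using w by (subst summable_on_reindex_bij_witness[where i = "\<lambda>y. x - y" and j = "\<lambda>y. x - y" and h = ?w and T = UNIV]) auto
  have wxs: "(\<Sum>\<^sub>\<infinity>y. ?w (x - y)) = infsum ?w UNIV"
    by (rule infsum_reindex_bij_witness[where i = "\<lambda>y. x - y" and j = "\<lambda>y. x - y"]) auto
  have le: "norm (E y * u (x - y)) \<le> K * (?w y + ?w (x - y))" if y: "y \<notin> Y" for y
  proof -
    have "norm (E y * u (x - y)) \<le> (B * jb y powr - (D + \<sigma>)) * (c * jb (x - y) powr - (D - 2))"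
      unfolding norm_mult D_def using B by (intro mult_mono E u) auto
    also have "\<dots> = B * c * (jb y powr - (D + \<sigma>) * jb (x - y) powr - (D - 2))" by simp
    also have "\<dots> \<le> B * c * (2 powr (D + \<sigma>) * jb x powr - (D - 2 + \<sigma>') * (?w y + ?w (x - y)))"
    proof (intro mult_left_mono)
      show "jb y powr - (D + \<sigma>) * jb (x - y) powr - (D - 2)
        \<le> 2 powr (D + \<sigma>) * jb x powr - (D - 2 + \<sigma>') * (?w y + ?w (x - y))"
      proof (cases "jb (x - y) \<ge> jb x / 2")
        case True
        have "jb y powr - (D + \<sigma>) = jb y powr - \<sigma>' * ?w y"
          by (simp only: powr_add[symmetric]) (rule arg_cong[where f = "(powr) (jb y)"], simp add: e_def)
        hence "jb y powr - (D + \<sigma>) * jb (x - y) powr - (D - 2) = jb y powr - \<sigma>' * jb (x - y) powr - (D - 2) * ?w y"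
          by simp
        also have "\<dots> \<le> (2 powr \<sigma>' * jb x powr - \<sigma>') * (2 powr (D - 2) * jb x powr - (D - 2)) * ?w y"
          using D s by (intro mult_right_mono mult_mono half_powr far y True) auto
        also have "\<dots> = 2 powr (\<sigma>' + (D - 2)) * jb x powr - (D - 2 + \<sigma>') * ?w y"
        proof -
          have m1: "jb x powr - \<sigma>' * jb x powr - (D - 2) = jb x powr - (D - 2 + \<sigma>')"
            by (subst powr_add[symmetric]) (simp add: algebra_simps)
          have m2: "(2::real) powr \<sigma>' * 2 powr (D - 2) = 2 powr (\<sigma>' + (D - 2))"
            by (rule powr_add[symmetric])
          show ?thesis unfolding m1[symmetric] m2[symmetric] by (simp only: mult_ac)
        qed
        also have "\<dots> \<le> 2 powr (D + \<sigma>) * jb x powr - (D - 2 + \<sigma>') * (?w y + ?w (x - y))"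
          using s by (intro mult_mono mult_right_mono powr_mono) auto
        finally show ?thesis .
      next
        case False
        have "jb (x - y) powr - (D - 2) = jb (x - y) powr (2 + e) * ?w (x - y)"
          by (simp add: powr_add[symmetric])
        also have "\<dots> \<le> jb x powr (2 + e) * ?w (x - y)"
          using False e jb_pos[of x] by (intro mult_right_mono powr_mono2) (auto simp del: jb_pos)
        finally have "jb y powr - (D + \<sigma>) * jb (x - y) powr - (D - 2)
            \<le> (2 powr (D + \<sigma>) * jb x powr - (D + \<sigma>)) * (jb x powr (2 + e) * ?w (x - y))"
          using D s by (intro mult_mono half_powr far y) auto
        also have "\<dots> = 2 powr (D + \<sigma>) * (jb x powr - (D + \<sigma>) * jb x powr (2 + e)) * ?w (x - y)"
          by (simp only: mult.assoc)
        also have "jb x powr - (D + \<sigma>) * jb x powr (2 + e) = jb x powr - (D - 2 + \<sigma>')"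
          by (subst powr_add[symmetric]) (rule arg_cong[where f = "(powr) (jb x)"], simp add: e_def)
        also have "2 powr (D + \<sigma>) * jb x powr - (D - 2 + \<sigma>') * ?w (x - y)
            \<le> 2 powr (D + \<sigma>) * jb x powr - (D - 2 + \<sigma>') * (?w y + ?w (x - y))"
          by (intro mult_left_mono) auto
        finally show ?thesis .
      qed
    qed (use B c in auto)
    also have "\<dots> = K * (?w y + ?w (x - y))" by (simp add: K_def)
    finally show ?thesis .
  qed
  have sum2: "(\<lambda>y. K * (?w y + ?w (x - y))) summable_on UNIV"
    by (intro summable_on_cmult_right summable_on_add w wx)
  have sumY: "(\<lambda>y. K * (?w y + ?w (x - y))) summable_on - Y"
    by (rule summable_on_subset_banach[OF sum2]) auto
  have abs: "(\<lambda>y. norm (E y * u (x - y))) summable_on - Y"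
    by (rule summable_on_comparison_test[OF sumY]) (use le in auto)
  have "norm (\<Sum>\<^sub>\<infinity>y\<in>- Y. E y * u (x - y)) \<le> (\<Sum>\<^sub>\<infinity>y\<in>- Y. norm (E y * u (x - y)))"
    by (rule norm_infsum_bound[OF abs])
  also have "\<dots> \<le> (\<Sum>\<^sub>\<infinity>y\<in>- Y. K * (?w y + ?w (x - y)))"
    by (rule infsum_mono[OF abs sumY]) (use le in auto)
  also have "\<dots> \<le> (\<Sum>\<^sub>\<infinity>y. K * (?w y + ?w (x - y)))"
    by (rule infsum_mono2[OF sumY sum2]) (use K in \<open>auto intro!: mult_nonneg_nonneg\<close>)
  also have "\<dots> = K * (2 * jbsum TYPE('d) e)"
    unfolding infsum_cmult_right' infsum_add[OF w wx] wxs by (simp add: jbsum_def D_def)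
  finally show ?thesis by (simp add: K_def D_def e_def mult_ac)
qed

lemma conv_split:
  fixes E u :: "int^'d::finite \<Rightarrow> complex"
  assumes "l1 E" and "\<And>x. norm (u x) \<le> c" and "finite Y"
  shows "conv E u x = (\<Sum>y\<in>Y. E y * u (x - y)) + (\<Sum>\<^sub>\<infinity>y\<in>- Y. E y * u (x - y))"
  unfolding conv_def
proof (rule infsum_split_finite[OF _ assms(3)])
  have "(\<lambda>y. norm (E y) * c) summable_on UNIV" by (intro summable_on_cmult_left assms)
  hence "(\<lambda>y. norm (E y * u (x - y))) summable_on UNIV"
    by (rule summable_on_comparison_test) (auto simp: norm_mult intro!: mult_left_mono assms)
  thus "(\<lambda>y. E y * u (x - y)) summable_on UNIV" by (rule abs_summable_summable)
qed

lemma norm_emb_power2: "(norm (emb (y :: int^'d)))\<^sup>2 = (\<Sum>j\<in>UNIV. (real_of_int (y $ j))\<^sup>2)"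
  by (simp add: norm_vec_power2)

lemma norm_emb_power2_le: "(norm (emb y))\<^sup>2 \<le> jb y powr 2"
  using norm_emb_le_jb[of y] by (simp add: powr_numeral power_mono)

definition near :: "int^'d \<Rightarrow> (int^'d) set" where
  "near x = {y. norm (emb y) \<le> norm (emb x) / 2}"

lemma near_properties:
  fixes x :: "int^'d::finite"
  shows "finite (near x)" "\<And>i y. y \<in> near x \<Longrightarrow> reflect i y \<in> near x"
    "\<And>y. y \<in> near x \<Longrightarrow> norm (emb y) \<le> norm (emb x) / 2"
    "\<And>y. y \<in> near x \<Longrightarrow> jb y \<le> jb x" "\<And>y. y \<notin> near x \<Longrightarrow> jb y \<ge> jb x / 2"
proof -
  show "finite (near x)" unfolding near_def by (rule finite_lattice_ball)
  show "jb y \<le> jb x" if "y \<in> near x" for y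
    using that norm_ge_zero[of "emb x"] by (simp add: near_def jb_def max_def)
  show "jb y \<ge> jb x / 2" if "y \<notin> near x" for y
    using that by (intro jb_far) (simp add: near_def)
qed (simp_all add: near_def)

text \<open>\<open>conv E u x\<close> is split into the Taylor remainder over near y, the near mass
  of E times \<open>u x\<close>, which is a tail because the total mass is 0, and the far part. The
  first is where the order of the expansion matters; it enters as hypothesis
  \<open>T\<close>.\<close>

lemma conv_near_bound:
  fixes E u :: "int^'d::finite \<Rightarrow> complex" and x :: "int^'d" and \<sigma> \<sigma>' :: real
  defines "D \<equiv> real CARD('d)" and "Z \<equiv> jbsum TYPE('d) (\<sigma> - \<sigma>')" and "Y \<equiv> near x"
  assumes d: "CARD('d) > 2" and s: "0 \<le> \<sigma>'" "\<sigma>' < \<sigma>" and B: "B \<ge> 0" and c: "c \<ge> 0"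
    and E: "\<And>y. norm (E y) \<le> B * jb y powr - (D + \<sigma>)" and E0: "infsum E UNIV = 0"
    and u: "green_bounds c u"
    and T: "norm (\<Sum>y\<in>Y. E y * (u (x - y) - u x)) \<le> B * c * t * jb x powr - (D - 2 + \<sigma>')"
  shows "norm (conv E u x) \<le> B * c * (2 * 2 powr (D + \<sigma>) * Z + 2 powr \<sigma>' * Z + t) * jb x powr - (D - 2 + \<sigma>')"
proof -
  have D: "D > 2" using d by (simp add: D_def)
  have Z: "Z \<ge> 0" unfolding Z_def by (rule jbsum_nonneg)
  note Y = near_properties(1)[of x, folded Y_def] and far = near_properties(5)[of _ x, folded Y_def]
  have l: "l1 E" by (rule l1_bound(1)[OF E[unfolded D_def]]) (use s in auto)
  have ub: "norm (u y) \<le> c" for y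
  proof -
    have "c * jb y powr - (D - 2) \<le> c * 1" using D by (intro mult_left_mono jb_powr_le_1 c) auto
    thus ?thesis using green_boundsD(1)[OF u, of y] by (simp add: D_def)
  qed
  have F: "norm (\<Sum>\<^sub>\<infinity>y\<in>- Y. E y * u (x - y)) \<le> B * c * (2 * 2 powr (D + \<sigma>) * Z) * jb x powr - (D - 2 + \<sigma>')"
    unfolding D_def Z_def using E green_boundsD(1)[OF u] far
    by (intro far_part_bound d s B c) (auto simp: D_def)
  have S: "norm ((\<Sum>y\<in>Y. E y) * u x) \<le> B * c * (2 powr \<sigma>' * Z) * jb x powr - (D - 2 + \<sigma>')"
  proof -
    have "norm (\<Sum>y\<in>Y. E y) \<le> B * 2 powr \<sigma>' * jb x powr - \<sigma>' * Z"
      unfolding Z_def by (rule tail_sum_bound) (use E E0 s B Y far in \<open>auto simp: D_def\<close>)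
    hence "norm ((\<Sum>y\<in>Y. E y) * u x) \<le> (B * 2 powr \<sigma>' * jb x powr - \<sigma>' * Z) * (c * jb x powr - (D - 2))"
      unfolding norm_mult using B Z by (intro mult_mono green_boundsD(1)[OF u, folded D_def]) auto
    also have "\<dots> = B * c * (2 powr \<sigma>' * Z) * (jb x powr - \<sigma>' * jb x powr - (D - 2))" by simp
    also have "jb x powr - \<sigma>' * jb x powr - (D - 2) = jb x powr - (D - 2 + \<sigma>')"
      by (subst powr_add[symmetric]) (simp add: algebra_simps)
    finally show ?thesis .
  qed
  have "(\<Sum>y\<in>Y. E y * u (x - y)) = (\<Sum>y\<in>Y. E y * (u (x - y) - u x)) + (\<Sum>y\<in>Y. E y) * u x"
    by (simp add: right_diff_distrib sum_subtractf sum_distrib_right)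
  hence "norm (conv E u x) = norm ((\<Sum>y\<in>Y. E y * (u (x - y) - u x)) + (\<Sum>y\<in>Y. E y) * u x + (\<Sum>\<^sub>\<infinity>y\<in>- Y. E y * u (x - y)))"
    by (simp add: conv_split[OF l ub Y])
  also have "\<dots> \<le> norm (\<Sum>y\<in>Y. E y * (u (x - y) - u x)) + norm ((\<Sum>y\<in>Y. E y) * u x) + norm (\<Sum>\<^sub>\<infinity>y\<in>- Y. E y * u (x - y))"
    by (intro norm_triangle_mono norm_triangle_ineq order_refl)
  also have "\<dots> \<le> B * c * t * jb x powr - (D - 2 + \<sigma>') + B * c * (2 powr \<sigma>' * Z) * jb x powr - (D - 2 + \<sigma>')
     + B * c * (2 * 2 powr (D + \<sigma>) * Z) * jb x powr - (D - 2 + \<sigma>')"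
    by (intro add_mono T S F)
  also have "\<dots> = B * c * (2 * 2 powr (D + \<sigma>) * Z + 2 powr \<sigma>' * Z + t) * jb x powr - (D - 2 + \<sigma>')"
    by (simp add: algebra_simps)
  finally show ?thesis .
qed

text \<open>In \<open>conv_gain P \<sigma> \<sigma>' K\<close> the predicate \<open>P\<close> states which moments vanish besides the zeroth.\<close>

definition conv_gain :: "((int^'d::finite \<Rightarrow> complex) \<Rightarrow> bool) \<Rightarrow> real \<Rightarrow> real \<Rightarrow> real \<Rightarrow> bool" where
  "conv_gain P \<sigma> \<sigma>' K \<longleftrightarrow> (\<forall>E u B c. B \<ge> 0 \<longrightarrow> c \<ge> 0 \<longrightarrow> coord_even E \<longrightarrow>
     decays B (real CARD('d) + \<sigma>) E \<longrightarrow> infsum E UNIV = 0 \<longrightarrow> P E \<longrightarrow> green_bounds c u \<longrightarrow>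
     decays (B * c * K) (real CARD('d) - 2 + \<sigma>') (conv E u))"

lemma conv_gainD:
  fixes E u :: "int^'d::finite \<Rightarrow> complex"
  assumes "conv_gain P \<sigma> \<sigma>' K" "B \<ge> 0" "c \<ge> 0" "coord_even E"
    "\<And>x. norm (E x) \<le> B * jb x powr - (real CARD('d) + \<sigma>)" "infsum E UNIV = 0" "P E" "green_bounds c u"
  shows "norm (conv E u x) \<le> B * c * K * jb x powr - (real CARD('d) - 2 + \<sigma>')"
  using assms unfolding conv_gain_def decays_def by blast

text \<open>Only diagonal moments are listed, as coordinate evenness makes the mixed ones
  vanish.\<close>

definition second_moments_vanish :: "(int^'d \<Rightarrow> complex) \<Rightarrow> bool" where
  "second_moments_vanish E \<longleftrightarrow> (\<forall>j. (\<Sum>\<^sub>\<infinity>y. E y * of_int ((y $ j)\<^sup>2)) = 0)"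

text \<open>Near y contribute a second moment of order \<open>2 - \<sigma>'\<close> in |x|, times
  second differences of u of order \<open>- D\<close>, taken at points whose weight is at least half
  that of x.\<close>

lemma conv_decay_2:
  fixes \<sigma> \<sigma>' :: real
  assumes d: "CARD('d::finite) > 2" and s: "0 \<le> \<sigma>'" "\<sigma>' < \<sigma>" "\<sigma>' \<le> 2"
  shows "\<exists>K\<ge>0. conv_gain (\<lambda>E :: int^'d \<Rightarrow> complex. True) \<sigma> \<sigma>' K"
proof -
  define D where "D = real CARD('d)"
  have D: "D > 2" using d by (simp add: D_def)
  define Z where "Z = jbsum TYPE('d) (\<sigma> - \<sigma>')"
  have Z: "Z \<ge> 0" unfolding Z_def by (rule jbsum_nonneg)
  define K where "K = 2 * 2 powr (D + \<sigma>) * Z + 2 powr \<sigma>' * Z + 2 powr D * Z"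
  have K: "K \<ge> 0" using Z by (simp add: K_def)
  have "norm (conv E u x) \<le> B * c * K * jb x powr - (D - 2 + \<sigma>')"
    if B: "B \<ge> 0" and c: "c \<ge> 0" and ev: "coord_even E"
      and E: "\<And>y. norm (E y) \<le> B * jb y powr - (D + \<sigma>)" and E0: "infsum E UNIV = 0"
      and u: "green_bounds c u"
    for E u :: "int^'d \<Rightarrow> complex" and B c and x :: "int^'d"
    unfolding K_def D_def Z_def
  proof (rule conv_near_bound[OF d s(1,2) B c E[unfolded D_def] E0 u])
    define Y where "Y = near x"
    note Y = near_properties(1)[of x, folded Y_def] and Yr = near_properties(2)[of _ x, folded Y_def]
      and Yn = near_properties(3)[of _ x, folded Y_def] and near = near_properties(4)[of _ x, folded Y_def]
    have T: "norm (\<Sum>y\<in>Y. E y * (u (x - y) - u x)) \<le> B * c * (2 powr D * Z) * jb x powr - (D - 2 + \<sigma>')"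
    proof -
      have "norm (\<Sum>y\<in>Y. E y * (u (x - restrict_coords UNIV y) - u x))
        \<le> (\<Sum>y\<in>Y. norm (E y) * (\<Sum>j\<in>UNIV. (real_of_int (y $ j))\<^sup>2)) * (c * (2 powr D * jb x powr - D))"
      proof (rule taylor_order_2[OF Y Yr Yn ev])
        fix i z assume "norm (emb (z - x)) \<le> norm (emb x) / 2"
        hence "jb z powr - D \<le> 2 powr D * jb x powr - D" using D by (intro half_powr jb_near) auto
        thus "norm (sdiff i u z) \<le> c * (2 powr D * jb x powr - D)"
          using green_boundsD(2)[OF u, of i z, folded D_def] c by (meson mult_left_mono order_trans)
      qed auto
      also have "\<dots> \<le> (B * jb x powr (2 - \<sigma>') * Z) * (c * (2 powr D * jb x powr - D))"
      proof (rule mult_right_mono)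
        have "(\<Sum>y\<in>Y. norm (E y) * (\<Sum>j\<in>UNIV. (real_of_int (y $ j))\<^sup>2)) \<le> (\<Sum>y\<in>Y. norm (E y) * jb y powr 2)"
          unfolding norm_emb_power2[symmetric] by (intro sum_mono mult_left_mono norm_emb_power2_le) auto
        also have "\<dots> \<le> B * jb x powr (2 - \<sigma>') * Z"
          unfolding Z_def using E near by (intro near_moment_bound s B Y) (auto simp: D_def)
        finally show "(\<Sum>y\<in>Y. norm (E y) * (\<Sum>j\<in>UNIV. (real_of_int (y $ j))\<^sup>2)) \<le> B * jb x powr (2 - \<sigma>') * Z" .
      qed (use c in auto)
      also have "\<dots> = B * c * (2 powr D * Z) * (jb x powr (2 - \<sigma>') * jb x powr - D)" by simp
      also have "jb x powr (2 - \<sigma>') * jb x powr - D = jb x powr - (D - 2 + \<sigma>')"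
        by (subst powr_add[symmetric]) (simp add: algebra_simps)
      finally show ?thesis by simp
    qed
    thus "norm (\<Sum>y\<in>near x. E y * (u (x - y) - u x)) \<le> B * c * (2 powr real CARD('d) * jbsum TYPE('d) (\<sigma> - \<sigma>')) * jb x powr - (real CARD('d) - 2 + \<sigma>')"
      by (simp only: Y_def Z_def D_def)
  qed
  hence "conv_gain (\<lambda>E :: int^'d \<Rightarrow> complex. True) \<sigma> \<sigma>' K"
    unfolding conv_gain_def decays_def D_def by blast
  with K show ?thesis by blast
qed

text \<open>The quadratic Taylor terms carry the second moments of E over near y. As the full second
  moments vanish, these are tails of order \<open>- (\<sigma>' - 2)\<close> in |x|; times second
  differences of order \<open>- D\<close> they match the fourth-order remainder.\<close>

lemma conv_decay_4:
  fixes \<sigma> \<sigma>' :: real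
  assumes d: "CARD('d::finite) > 2" and s: "2 \<le> \<sigma>'" "\<sigma>' < \<sigma>" "\<sigma>' \<le> 4"
  shows "\<exists>K\<ge>0. conv_gain (second_moments_vanish :: (int^'d \<Rightarrow> complex) \<Rightarrow> bool) \<sigma> \<sigma>' K"
proof -
  define D where "D = real CARD('d)"
  have D: "D > 2" using d by (simp add: D_def)
  define Z where "Z = jbsum TYPE('d) (\<sigma> - \<sigma>')"
  have Z: "Z \<ge> 0" unfolding Z_def by (rule jbsum_nonneg)
  define t where "t = 2 powr (D + 2) * Z + D * (2 powr (\<sigma>' - 2) * Z)"
  define K where "K = 2 * 2 powr (D + \<sigma>) * Z + 2 powr \<sigma>' * Z + t"
  have K: "K \<ge> 0" using Z D by (simp add: K_def t_def)
  have "norm (conv E u x) \<le> B * c * K * jb x powr - (D - 2 + \<sigma>')"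
    if B: "B \<ge> 0" and c: "c \<ge> 0" and ev: "coord_even E"
      and E: "\<And>y. norm (E y) \<le> B * jb y powr - (D + \<sigma>)" and E0: "infsum E UNIV = 0"
      and E2: "\<And>j. (\<Sum>\<^sub>\<infinity>y. E y * of_int ((y $ j)\<^sup>2)) = 0" and u: "green_bounds c u"
    for E u :: "int^'d \<Rightarrow> complex" and B c and x :: "int^'d"
    unfolding K_def D_def Z_def
  proof (rule conv_near_bound[OF d _ s(2) B c E[unfolded D_def] E0 u])
    show "0 \<le> \<sigma>'" using s by simp
    define Y where "Y = near x"
    note Y = near_properties(1)[of x, folded Y_def] and Yr = near_properties(2)[of _ x, folded Y_def]
      and Yn = near_properties(3)[of _ x, folded Y_def] and near = near_properties(4)[of _ x, folded Y_def]
      and far = near_properties(5)[of _ x, folded Y_def]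
    let ?P = "\<lambda>y. \<Sum>j\<in>UNIV. of_int ((y $ j)\<^sup>2) / 2 * sdiff j u x"
    have T: "norm (\<Sum>y\<in>Y. E y * (u (x - y) - u x - ?P y)) \<le> B * c * (2 powr (D + 2) * Z) * jb x powr - (D - 2 + \<sigma>')"
    proof -
      have "norm (\<Sum>y\<in>Y. E y * (u (x - restrict_coords UNIV y) - u x - ?P y))
        \<le> (\<Sum>y\<in>Y. norm (E y) * (\<Sum>j\<in>UNIV. (real_of_int (y $ j))\<^sup>2)\<^sup>2) * (c * (2 powr (D + 2) * jb x powr - (D + 2)))"
      proof (rule taylor_order_4[OF Y Yr Yn ev])
        fix i j z assume "norm (emb (z - x)) \<le> norm (emb x) / 2"
        hence "jb z powr - (D + 2) \<le> 2 powr (D + 2) * jb x powr - (D + 2)" using D by (intro half_powr jb_near) auto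
        thus "norm (sdiff i (sdiff j u) z) \<le> c * (2 powr (D + 2) * jb x powr - (D + 2))"
          using green_boundsD(3)[OF u, of i j z, folded D_def] c by (meson mult_left_mono order_trans)
      qed (use c in auto)
      also have "\<dots> \<le> (B * jb x powr (4 - \<sigma>') * Z) * (c * (2 powr (D + 2) * jb x powr - (D + 2)))"
      proof (rule mult_right_mono)
        have "(\<Sum>y\<in>Y. norm (E y) * (\<Sum>j\<in>UNIV. (real_of_int (y $ j))\<^sup>2)\<^sup>2) \<le> (\<Sum>y\<in>Y. norm (E y) * jb y powr 4)"
          unfolding norm_emb_power2[symmetric]
        proof (intro sum_mono mult_left_mono)
          fix y :: "int^'d"
          have "((norm (emb y))\<^sup>2)\<^sup>2 = norm (emb y) ^ 4" by (simp flip: power_mult)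
          also have "\<dots> \<le> jb y ^ 4" by (intro power_mono norm_emb_le_jb) auto
          finally show "((norm (emb y))\<^sup>2)\<^sup>2 \<le> jb y powr 4" by (simp add: powr_numeral)
        qed auto
        also have "\<dots> \<le> B * jb x powr (4 - \<sigma>') * Z"
          unfolding Z_def using E near by (intro near_moment_bound s B Y) (auto simp: D_def)
        finally show "(\<Sum>y\<in>Y. norm (E y) * (\<Sum>j\<in>UNIV. (real_of_int (y $ j))\<^sup>2)\<^sup>2) \<le> B * jb x powr (4 - \<sigma>') * Z" .
      qed (use c in auto)
      also have "\<dots> = B * c * (2 powr (D + 2) * Z) * (jb x powr (4 - \<sigma>') * jb x powr - (D + 2))" by simp
      also have "jb x powr (4 - \<sigma>') * jb x powr - (D + 2) = jb x powr - (D - 2 + \<sigma>')"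
        by (subst powr_add[symmetric]) (simp add: algebra_simps)
      finally show ?thesis by simp
    qed
    have S2: "norm ((\<Sum>y\<in>Y. E y * of_int ((y $ j)\<^sup>2)) / 2 * sdiff j u x)
        \<le> B * c * (2 powr (\<sigma>' - 2) * Z) * jb x powr - (D - 2 + \<sigma>')" for j
    proof -
      have "norm (\<Sum>y\<in>Y. E y * of_int ((y $ j)\<^sup>2)) \<le> B * 2 powr (\<sigma>' - 2) * jb x powr - (\<sigma>' - 2) * Z"
        unfolding Z_def
      proof (rule tail_sum_bound)
        fix y :: "int^'d"
        have "norm (E y * of_int ((y $ j)\<^sup>2)) = norm (E y) * \<bar>real_of_int (y $ j)\<bar>\<^sup>2"
          by (simp add: norm_mult norm_power)
        also have "\<dots> \<le> (B * jb y powr - (D + \<sigma>)) * jb y powr 2"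
        proof (intro mult_mono E)
          show "\<bar>real_of_int (y $ j)\<bar>\<^sup>2 \<le> jb y powr 2"
            using power_mono[OF abs_nth_le_jb[of y j] abs_ge_zero, of 2] by simp
        qed (use B in auto)
        also have "\<dots> = B * jb y powr - (real CARD('d) + (\<sigma> - \<sigma>') + (\<sigma>' - 2))"
          unfolding mult.assoc powr_add[symmetric]
          by (rule arg_cong[where f = "\<lambda>a. B * jb y powr a"]) (simp add: D_def)
        finally show "norm (E y * of_int ((y $ j)\<^sup>2)) \<le> B * jb y powr - (real CARD('d) + (\<sigma> - \<sigma>') + (\<sigma>' - 2))" .
      qed (use E2[of j] s B Y far in auto)
      hence "norm ((\<Sum>y\<in>Y. E y * of_int ((y $ j)\<^sup>2)) * sdiff j u x)
         \<le> (B * 2 powr (\<sigma>' - 2) * jb x powr - (\<sigma>' - 2) * Z) * (c * jb x powr - D)"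
        unfolding norm_mult using B Z by (intro mult_mono green_boundsD(2)[OF u, folded D_def]) auto
      also have "\<dots> = B * c * (2 powr (\<sigma>' - 2) * Z) * (jb x powr - (\<sigma>' - 2) * jb x powr - D)" by simp
      also have "jb x powr - (\<sigma>' - 2) * jb x powr - D = jb x powr - (D - 2 + \<sigma>')"
        by (subst powr_add[symmetric]) (simp add: algebra_simps)
      finally have "norm ((\<Sum>y\<in>Y. E y * of_int ((y $ j)\<^sup>2)) * sdiff j u x)
         \<le> B * c * (2 powr (\<sigma>' - 2) * Z) * jb x powr - (D - 2 + \<sigma>')" .
      moreover have "norm ((\<Sum>y\<in>Y. E y * of_int ((y $ j)\<^sup>2)) / 2 * sdiff j u x)
          = norm ((\<Sum>y\<in>Y. E y * of_int ((y $ j)\<^sup>2)) * sdiff j u x) / 2"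
        by (simp only: norm_mult norm_divide norm_numeral times_divide_eq_left)
      ultimately show ?thesis
        using norm_ge_zero[of "(\<Sum>y\<in>Y. E y * of_int ((y $ j)\<^sup>2)) * sdiff j u x"] by linarith
    qed
    let ?A = "\<Sum>y\<in>Y. E y * (u (x - y) - u x - ?P y)"
    let ?Q = "\<Sum>j\<in>UNIV. (\<Sum>y\<in>Y. E y * of_int ((y $ j)\<^sup>2)) / 2 * sdiff j u x"
    have "(\<Sum>y\<in>Y. E y * ?P y) = ?Q"
      unfolding sum_distrib_left sum_distrib_right sum_divide_distrib
      by (subst sum.swap) (simp add: mult_ac)
    hence eq: "(\<Sum>y\<in>Y. E y * (u (x - y) - u x)) = ?A + ?Q"
      by (simp only: right_diff_distrib sum_subtractf) simp
    have "norm ?Q \<le> (\<Sum>j\<in>(UNIV::'d set). B * c * (2 powr (\<sigma>' - 2) * Z) * jb x powr - (D - 2 + \<sigma>'))"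
      by (rule sum_norm_le) (rule S2)
    hence Q: "norm ?Q \<le> D * (B * c * (2 powr (\<sigma>' - 2) * Z) * jb x powr - (D - 2 + \<sigma>'))"
      by (simp only: sum_constant D_def)
    have "norm (\<Sum>y\<in>Y. E y * (u (x - y) - u x)) \<le> norm ?A + norm ?Q"
      unfolding eq by (rule norm_triangle_ineq)
    also have "\<dots> \<le> B * c * (2 powr (D + 2) * Z) * jb x powr - (D - 2 + \<sigma>')
        + D * (B * c * (2 powr (\<sigma>' - 2) * Z) * jb x powr - (D - 2 + \<sigma>'))"
      by (rule add_mono[OF T Q])
    also have "\<dots> = B * c * t * jb x powr - (D - 2 + \<sigma>')" by (simp add: t_def algebra_simps)
    finally show "norm (\<Sum>y\<in>near x. E y * (u (x - y) - u x)) \<le> B * c * t * jb x powr - (real CARD('d) - 2 + \<sigma>')"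
      by (simp only: Y_def D_def)
  qed
  hence "conv_gain (second_moments_vanish :: (int^'d \<Rightarrow> complex) \<Rightarrow> bool) \<sigma> \<sigma>' K"
    unfolding conv_gain_def decays_def D_def second_moments_vanish_def by blast
  with K show ?thesis by blast
qed

section \<open>Fourier inversion\<close>

lemma integral_exp_Ioc:
  "(LINT k:{-pi<..pi}|lborel. exp (- \<i> * complex_of_real (k * of_int n))) = (if n = 0 then 2 * of_real pi else 0)"
proof -
  let ?f = "\<lambda>k. exp (- \<i> * complex_of_real (k * of_int n))"
  have "(LINT k:{-pi<..pi}|lborel. ?f k) = integral {-pi..pi} ?f"
    by (rule set_integral_Ioc_eq_integral) (intro continuous_intros)
  also have "\<dots> = (if n = 0 then 2 * of_real pi else 0)"
  proof (cases "n = 0")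
    case True
    thus ?thesis by (simp add: scaleR_conv_of_real)
  next
    case False
    have "(?f has_integral (?f pi / (- \<i> * of_int n) - ?f (- pi) / (- \<i> * of_int n))) {-pi..pi}"
    proof (rule fundamental_theorem_of_calculus)
      fix x :: real
      have "((\<lambda>z. exp (- \<i> * (z * of_int n)) / (- \<i> * of_int n)) has_field_derivative ?f x) (at (of_real x))"
        using False by (auto intro!: derivative_eq_intros simp: mult.commute[of "exp _" \<i>])
      from has_vector_derivative_real_field[OF this, of "{-pi..pi}"]
      show "((\<lambda>k. ?f k / (- \<i> * of_int n)) has_vector_derivative ?f x) (at x within {-pi..pi})"
        by (simp add: o_def)
    qed simp
    moreover have "?f pi = ?f (- pi)"
      by (auto simp: complex_eq_iff Re_exp Im_exp sin_npi_int)
    ultimately have "(?f has_integral 0) {-pi..pi}" by (simp only: diff_self)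
    thus ?thesis using False by (simp add: integral_unique)
  qed
  finally show ?thesis .
qed

text \<open>The heat kernel formula at time 0 and without differences, where the one-dimensional
  coefficients reduce to the orthogonality of characters.\<close>

lemma inv_fourier_1: "inv_fourier (\<lambda>_. 1) = (kron :: int^'d::finite \<Rightarrow> complex)"
proof
  fix x :: "int^'d"
  have hc: "heat_coeff (\<lambda>T k. (1 - cos k) ^ 0) 0 n = (if n = 0 then 2 * of_real pi else 0)" for n
    using integral_exp_Ioc[of n] by (simp add: heat_coeff_def)
  have "inv_fourier (\<lambda>_. 1) x = inv_fourier (\<lambda>k. of_real (vers_prod (\<lambda>_. 0) k * exp (- 0 * ahat 1 k))) x"
    by (simp add: vers_prod_def)
  also have "\<dots> = of_real (1 / (2 * pi) ^ CARD('d)) * (\<Prod>j\<in>UNIV. if x $ j = 0 then 2 * of_real pi else 0)"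
    by (subst inv_fourier_heat[OF order_refl]) (simp add: heat_prod_def hc[simplified])
  also have "(\<Prod>j\<in>UNIV. if x $ j = 0 then 2 * complex_of_real pi else 0) = (if x = 0 then (2 * of_real pi) ^ CARD('d) else 0)"
  proof (cases "x = 0")
    case False
    then obtain j where "x $ j \<noteq> 0" by (auto simp: vec_eq_iff)
    hence "(\<Prod>j\<in>UNIV. if x $ j = 0 then 2 * complex_of_real pi else 0) = 0"
      by (intro prod_zero) auto
    thus ?thesis using False by simp
  qed simp
  finally show "inv_fourier (\<lambda>_. 1) x = kron x"
    by (simp add: kron_def power_mult_distrib)
qed

lemma conv_kron: "conv f kron = f"
proof
  fix x
  have "conv f kron x = (\<Sum>\<^sub>\<infinity>y\<in>{x}. f y * kron (x - y))"
    unfolding conv_def by (rule infsum_cong_neutral) (auto simp: kron_def)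
  thus "conv f kron x = f x" by (simp add: kron_def)
qed

text \<open>The instance \<open>\<phi> = 1\<close> of \<open>conv_inv_fourier\<close>, as the
  inverse transform of 1 is the unit of convolution.\<close>

lemma inv_fourier_cfourier:
  fixes f :: "int^'d::finite \<Rightarrow> complex"
  assumes "l1 f"
  shows "inv_fourier (cfourier f) = f"
proof
  fix x
  show "inv_fourier (cfourier f) x = f x"
    using conv_inv_fourier[OF assms torus_set_integrable_const[of 1], of x] by (simp add: inv_fourier_1 conv_kron)
qed

lemma set_integrable_cfourier:
  fixes f :: "int^'d::finite \<Rightarrow> complex"
  assumes "l1 f"
  shows "set_integrable lborel torus (cfourier f)"
  by (rule set_integrable_torus_bounded[OF borel_measurable_cfourier[OF assms]])
    (rule norm_cfourier_le[OF assms])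

text \<open>In the Wiener lemma this turns a spectral bound below 1 into pointwise smallness of the
  iterated squares.\<close>

lemma norm_le_sup_cfourier:
  fixes f :: "int^'d::finite \<Rightarrow> complex"
  assumes "l1 f" "\<And>k. k \<in> torus \<Longrightarrow> norm (cfourier f k) \<le> B"
  shows "norm (f x) \<le> B"
  using norm_inv_fourier_le_bound[OF set_integrable_cfourier[OF assms(1)] assms(2), of x]
  by (simp add: inv_fourier_cfourier[OF assms(1)])

section \<open>A quantitative Wiener lemma for polynomially decaying kernels\<close>

text \<open>Either y or x - y has at least half the weight of x. Each term pairs one weighted norm
  with one l1 norm, never two weighted norms, which leaves room to interpolate.\<close>

lemma conv_weighted_bound:
  fixes f g :: "int^'d::finite \<Rightarrow> complex"
  assumes a: "a \<ge> 0" and l: "l1 f" "l1 g" and B: "B \<ge> 0" "B' \<ge> 0"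
    and f: "\<And>x. norm (f x) \<le> B * jb x powr - a" and g: "\<And>x. norm (g x) \<le> B' * jb x powr - a"
  shows "norm (conv f g x) \<le> 2 powr a * (B * (\<Sum>\<^sub>\<infinity>x. norm (g x)) + B' * (\<Sum>\<^sub>\<infinity>x. norm (f x))) * jb x powr - a"
proof -
  let ?h = "\<lambda>y. 2 powr a * jb x powr - a * (B * norm (g (x - y)) + B' * norm (f y))"
  have gx: "(\<lambda>y. norm (g (x - y))) summable_on UNIV"
    using l(2) by (subst summable_on_reindex_bij_witness[where i = "\<lambda>y. x - y" and j = "\<lambda>y. x - y" and h = "\<lambda>y. norm (g y)" and T = UNIV]) auto
  have gs: "(\<Sum>\<^sub>\<infinity>y. norm (g (x - y))) = (\<Sum>\<^sub>\<infinity>y. norm (g y))"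
    by (rule infsum_reindex_bij_witness[where i = "\<lambda>y. x - y" and j = "\<lambda>y. x - y"]) auto
  have le: "norm (f y * g (x - y)) \<le> ?h y" for y
  proof (cases "jb y \<ge> jb x / 2")
    case True
    have "norm (f y * g (x - y)) \<le> (B * (2 powr a * jb x powr - a)) * norm (g (x - y))"
      unfolding norm_mult
      by (intro mult_right_mono order.trans[OF f] mult_left_mono half_powr True a B) auto
    also have "\<dots> \<le> ?h y" using B by (simp add: algebra_simps)
    finally show ?thesis .
  next
    case False
    hence far: "jb (x - y) \<ge> jb x / 2" using jb_le_diff[of x y] by linarith
    have "norm (f y * g (x - y)) \<le> norm (f y) * (B' * (2 powr a * jb x powr - a))"
      unfolding norm_mult
      by (intro mult_left_mono order.trans[OF g] half_powr far a B) auto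
    also have "\<dots> \<le> ?h y" using B by (simp add: algebra_simps)
    finally show ?thesis .
  qed
  have hs: "?h summable_on UNIV"
    by (intro summable_on_cmult_right summable_on_add gx l)
  have as: "(\<lambda>y. norm (f y * g (x - y))) summable_on UNIV"
    by (rule summable_on_comparison_test[OF hs]) (use le in auto)
  have "norm (conv f g x) \<le> (\<Sum>\<^sub>\<infinity>y. norm (f y * g (x - y)))"
    unfolding conv_def by (rule norm_infsum_bound[OF as])
  also have "\<dots> \<le> infsum ?h UNIV"
    by (rule infsum_mono[OF as hs]) (use le in auto)
  also have "\<dots> = 2 powr a * jb x powr - a * (B * (\<Sum>\<^sub>\<infinity>x. norm (g x)) + B' * (\<Sum>\<^sub>\<infinity>x. norm (f x)))"
    unfolding infsum_cmult_right' by (subst infsum_add) (auto intro: summable_on_cmult_right gx l simp: infsum_cmult_right' gs)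
  finally show ?thesis by (simp add: mult_ac)
qed

text \<open>Geometric mean of the two pointwise bounds, with \<theta> chosen so that the weight
  exponent drops from \<open>d + s\<close> to the still summable \<open>d + s / 2\<close>.\<close>

lemma l1_interpolation:
  fixes f :: "int^'d::finite \<Rightarrow> complex"
  assumes s: "s > 0" and B: "B \<ge> 0" and D: "D \<ge> 0"
    and f: "\<And>x. norm (f x) \<le> B * jb x powr - (real CARD('d) + s)" "\<And>x. norm (f x) \<le> D"
  defines "\<theta> \<equiv> (real CARD('d) + s / 2) / (real CARD('d) + s)"
  shows "(\<Sum>\<^sub>\<infinity>x. norm (f x)) \<le> B powr \<theta> * D powr (1 - \<theta>) * jbsum TYPE('d) (s / 2)"
proof (rule l1_bound(2))
  fix x
  have p: "real CARD('d) + s > 0" using s by (simp add: add_nonneg_pos)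
  have \<theta>: "0 \<le> \<theta>" "\<theta> \<le> 1" using s p by (simp_all add: \<theta>_def)
  show "norm (f x) \<le> B powr \<theta> * D powr (1 - \<theta>) * jb x powr - (real CARD('d) + s / 2)"
  proof (cases "f x = 0")
    case False
    have "norm (f x) = norm (f x) powr \<theta> * norm (f x) powr (1 - \<theta>)"
      using False by (simp add: powr_add[symmetric])
    also have "\<dots> \<le> (B * jb x powr - (real CARD('d) + s)) powr \<theta> * D powr (1 - \<theta>)"
      using \<theta> by (intro mult_mono powr_mono2 f) auto
    also have "\<dots> = B powr \<theta> * D powr (1 - \<theta>) * jb x powr (- (real CARD('d) + s) * \<theta>)"
      using B by (simp add: powr_mult powr_powr)
    also have "- (real CARD('d) + s) * \<theta> = - (real CARD('d) + s / 2)"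
    proof -
      have "(real CARD('d) + s) * \<theta> = real CARD('d) + s / 2" using p by (simp add: \<theta>_def)
      thus ?thesis by (simp only: mult_minus_left)
    qed
    finally show ?thesis .
  qed simp
qed (use s in auto)

fun conv_square :: "(int^'d \<Rightarrow> complex) \<Rightarrow> nat \<Rightarrow> int^'d \<Rightarrow> complex" where
  "conv_square r 0 = r"
| "conv_square r (Suc j) = conv (conv_square r j) (conv_square r j)"

text \<open>The product of \<open>\<delta> + conv_square r i\<close> over i < j, i.e. the Neumann
  sum of the first \<open>2 ^ j\<close> convolution powers of r, arranged so that only the iterated
  squares have to be estimated.\<close>

fun conv_prod :: "(int^'d \<Rightarrow> complex) \<Rightarrow> nat \<Rightarrow> int^'d \<Rightarrow> complex" where
  "conv_prod r 0 = kron"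
| "conv_prod r (Suc j) = (\<lambda>x. conv_prod r j x + conv (conv_prod r j) (conv_square r j) x)"

lemma l1_add: "l1 f \<Longrightarrow> l1 g \<Longrightarrow> l1 (\<lambda>x. f x + g x)"
  by (rule summable_on_comparison_test[OF summable_on_add[of "\<lambda>x. norm (f x)" _ "\<lambda>x. norm (g x)"]])
    (auto intro: norm_triangle_ineq)

lemma conv_square_l1:
  fixes r :: "int^'d::finite \<Rightarrow> complex"
  assumes "l1 r"
  shows "l1 (conv_square r j)" "cfourier (conv_square r j) k = cfourier r k ^ (2 ^ j)"
proof -
  show l: "l1 (conv_square r j)" for j
    by (induction j) (auto intro: assms l1_conv)
  show "cfourier (conv_square r j) k = cfourier r k ^ (2 ^ j)"
    by (induction j) (simp_all add: cfourier_conv[OF l l] power_add[symmetric] mult_2)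
qed

text \<open>Telescoping: (1 - z)(1 + z)(1 + z^2)(1 + z^4)... collapses to 1 - z^(2^j), with z the
  transform of r.\<close>

lemma conv_prod_l1:
  fixes r :: "int^'d::finite \<Rightarrow> complex"
  assumes "l1 r"
  shows "l1 (conv_prod r j)" "(1 - cfourier r k) * cfourier (conv_prod r j) k = 1 - cfourier r k ^ (2 ^ j)"
proof -
  show l: "l1 (conv_prod r j)" for j
    by (induction j) (auto intro!: l1_kron l1_add l1_conv conv_square_l1 assms)
  show "(1 - cfourier r k) * cfourier (conv_prod r j) k = 1 - cfourier r k ^ (2 ^ j)"
  proof (induction j)
    case 0
    show ?case by (simp add: cfourier_kron)
  next
    case (Suc j)
    have "cfourier (conv_prod r (Suc j)) k = cfourier (conv_prod r j) k * (1 + cfourier r k ^ (2 ^ j))"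
      using assms by (simp add: cfourier_add l1_conv l conv_square_l1 cfourier_conv algebra_simps)
    hence "(1 - cfourier r k) * cfourier (conv_prod r (Suc j)) k
        = ((1 - cfourier r k) * cfourier (conv_prod r j) k) * (1 + cfourier r k ^ (2 ^ j))" by simp
    also have "\<dots> = 1 - (cfourier r k ^ (2 ^ j)) * (cfourier r k ^ (2 ^ j))"
      unfolding Suc.IH by (simp add: algebra_simps)
    finally show ?case by (simp add: power_add[symmetric] mult_2)
  qed
qed

text \<open>On the logarithmic scale the growth (1 + \<theta>)^j is negligible against the decay
  2^j; eventually at least half of the decay survives.\<close>

lemma summable_double_exponential:
  fixes M q \<theta> :: real
  assumes M: "M > 0" and q: "0 < q" "q < 1" and \<theta>: "0 \<le> \<theta>" "\<theta> < 1"
  shows "summable (\<lambda>j. M powr ((1 + \<theta>) ^ j) * q powr (2 ^ j))"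
proof -
  define L where "L = - ln q"
  have L: "L > 0" using q by (simp add: L_def)
  have "(\<lambda>j. ln M * ((1 + \<theta>) / 2) ^ j) \<longlonglongrightarrow> ln M * 0"
    using \<theta> by (intro tendsto_intros LIMSEQ_power_zero) auto
  hence "eventually (\<lambda>j. ln M * ((1 + \<theta>) / 2) ^ j < L / 2) sequentially"
    using L by (intro order_tendstoD) auto
  hence "eventually (\<lambda>j. norm (M powr ((1 + \<theta>) ^ j) * q powr (2 ^ j)) \<le> exp (- L / 2) ^ j) sequentially"
  proof eventually_elim
    case (elim j)
    have "ln M * (1 + \<theta>) ^ j = ln M * ((1 + \<theta>) / 2) ^ j * 2 ^ j" by (simp add: power_divide)
    also have "\<dots> \<le> L / 2 * 2 ^ j" using elim by (intro mult_right_mono) auto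
    finally have le: "ln M * (1 + \<theta>) ^ j \<le> L / 2 * 2 ^ j" .
    have "M powr ((1 + \<theta>) ^ j) * q powr (2 ^ j) = exp (ln M * (1 + \<theta>) ^ j - L * 2 ^ j)"
      using M q by (simp add: powr_def L_def exp_add[symmetric] mult.commute)
    also have "\<dots> \<le> exp (real j * (- L / 2))"
    proof -
      have "real j \<le> 2 ^ j" using of_nat_less_two_power[of j, where 'a = real] by simp
      hence "L / 2 * real j \<le> L / 2 * 2 ^ j" using L by (intro mult_left_mono) auto
      thus ?thesis using le by (simp add: mult.commute)
    qed
    also have "\<dots> = exp (- L / 2) ^ j" by (rule exp_of_nat_mult)
    finally show ?case using M q by simp
  qed
  moreover have "summable (\<lambda>j. exp (- L / 2) ^ j)" using L by (intro summable_geometric) auto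
  ultimately show ?thesis by (rule summable_comparison_test_ev)
qed

text \<open>With \<open>\<theta> < 1\<close> the exponent of the sup norm wins in the recursion
  \<open>\<beta> (Suc j) = A * \<beta> j powr (1 + \<theta>) * q powr (2 ^ j * (1 - \<theta>))\<close> for the
  weighted norms of the iterated squares (Brandenburg's trick); \<open>\<beta>\<close> below is its explicit solution.\<close>

lemma wiener_decay:
  fixes s q R :: real
  assumes s: "s > 0" and q: "q < 1" and R: "R > 0"
  shows "\<exists>K\<ge>0. \<forall>r :: int^'d::finite \<Rightarrow> complex.
    (\<forall>x. norm (r x) \<le> R * jb x powr - (real CARD('d) + s)) \<longrightarrow>
    (\<forall>k\<in>torus. norm (cfourier r k) \<le> q) \<longrightarrow>
    (\<forall>x. norm (inv_fourier (\<lambda>k. 1 / (1 - cfourier r k)) x) \<le> K * jb x powr - (real CARD('d) + s))"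
proof -
  define a where "a = real CARD('d) + s"
  have a: "a > 0" using s by (simp add: a_def add_nonneg_pos)
  define \<theta> where "\<theta> = (real CARD('d) + s / 2) / (real CARD('d) + s)"
  have \<theta>: "0 < \<theta>" "\<theta> < 1" using s by (auto simp: \<theta>_def add_nonneg_pos divide_simps)
  \<comment> \<open>Replaces q, which may be 0 or negative, by a positive number below 1, so that
    real powers and logarithms make sense.\<close>
  define p where "p = max q (1 / 2)"
  have p: "0 < p" "p < 1" "q \<le> p" using q by (auto simp: p_def)
  define Z where "Z = jbsum TYPE('d) (s / 2)"
  have Z: "Z \<ge> 0" unfolding Z_def by (rule jbsum_nonneg)
  define A where "A = max 1 (2 powr a * 2 * Z)"
  have A: "A \<ge> 1" "2 powr a * 2 * Z \<le> A" by (auto simp: A_def)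
  \<comment> \<open>Chosen so that \<beta> starts at R, the given decay constant of r. The factor
    \<open>A powr (- 1 / \<theta>)\<close> in \<beta> is the normalization that removes A from the
    recursion.\<close>
  define M where "M = R * A powr (1 / \<theta>) / p"
  have M: "M > 0" using R A p by (simp add: M_def)
  define \<beta> where "\<beta> = (\<lambda>j::nat. A powr (- 1 / \<theta>) * (M powr ((1 + \<theta>) ^ j) * p powr (2 ^ j)))"
  have \<beta>0: "\<beta> j > 0" for j using A M p by (simp add: \<beta>_def)
  have \<beta>_0: "\<beta> 0 = R"
    using A M p R by (simp add: \<beta>_def M_def powr_add[symmetric])
  have \<beta>_Suc: "A * \<beta> j * (\<beta> j powr \<theta> * (p ^ 2 ^ j) powr (1 - \<theta>)) = \<beta> (Suc j)" for j
  proof -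
    have "\<beta> j * \<beta> j powr \<theta> = \<beta> j powr (1 + \<theta>)" using \<beta>0[of j] by (simp add: powr_add)
    also have "\<dots> = A powr (- 1 / \<theta> * (1 + \<theta>)) * (M powr ((1 + \<theta>) ^ Suc j) * p powr (2 ^ j * (1 + \<theta>)))"
      using A M p by (simp add: \<beta>_def powr_mult powr_powr mult.commute)
    finally have 1: "\<beta> j * \<beta> j powr \<theta> = A powr (- 1 / \<theta> * (1 + \<theta>)) * (M powr ((1 + \<theta>) ^ Suc j) * p powr (2 ^ j * (1 + \<theta>)))" .
    have "A * A powr (- 1 / \<theta> * (1 + \<theta>)) = A powr (1 + - 1 / \<theta> * (1 + \<theta>))"
      using A by (subst powr_add) simp
    also have "1 + - 1 / \<theta> * (1 + \<theta>) = - 1 / \<theta>" using \<theta> by (simp add: field_simps)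
    finally have 2: "A * A powr (- 1 / \<theta> * (1 + \<theta>)) = A powr (- 1 / \<theta>)" .
    have "(p ^ 2 ^ j) powr (1 - \<theta>) = p powr (2 ^ j * (1 - \<theta>))"
      using p by (simp add: powr_powr flip: powr_realpow)
    hence "p powr (2 ^ j * (1 + \<theta>)) * (p ^ 2 ^ j) powr (1 - \<theta>) = p powr (2 ^ j * (1 + \<theta>) + 2 ^ j * (1 - \<theta>))"
      by (simp add: powr_add)
    also have "2 ^ j * (1 + \<theta>) + 2 ^ j * (1 - \<theta>) = 2 ^ Suc j" by (simp add: algebra_simps)
    finally have 3: "p powr (2 ^ j * (1 + \<theta>)) * (p ^ 2 ^ j) powr (1 - \<theta>) = p powr (2 ^ Suc j)" .
    have "A * \<beta> j * (\<beta> j powr \<theta> * (p ^ 2 ^ j) powr (1 - \<theta>))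
       = (A * A powr (- 1 / \<theta> * (1 + \<theta>))) * (M powr ((1 + \<theta>) ^ Suc j) * (p powr (2 ^ j * (1 + \<theta>)) * (p ^ 2 ^ j) powr (1 - \<theta>)))"
      using 1 by (simp only: mult.assoc) (simp only: mult.assoc[symmetric] 1)
    thus ?thesis unfolding 2 3 by (simp only: \<beta>_def)
  qed
  have \<beta>_sum: "summable \<beta>"
    unfolding \<beta>_def by (intro summable_mult summable_double_exponential M p) (use \<theta> in auto)
  define Z' where "Z' = jbsum TYPE('d) s"
  have Z': "Z' \<ge> 0" unfolding Z'_def by (rule jbsum_nonneg)
  define A' where "A' = 2 powr a * 2 * Z'"
  have A': "A' \<ge> 0" using Z' by (simp add: A'_def)
  \<comment> \<open>Bounds all finite products of \<open>1 + A' * \<beta> j\<close>, the factors by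
    which the weighted bound on \<open>conv_prod\<close> grows.\<close>
  define \<Gamma> where "\<Gamma> = exp (A' * suminf \<beta>)"
  have "norm (inv_fourier (\<lambda>k. 1 / (1 - cfourier r k)) x) \<le> \<Gamma> * jb x powr - a"
    if r: "\<And>x. norm (r x) \<le> R * jb x powr - a" and rq: "\<And>k. k \<in> torus \<Longrightarrow> norm (cfourier r k) \<le> q"
    for r :: "int^'d \<Rightarrow> complex" and x
  proof -
    have l: "l1 r" by (rule l1_bound(1)[OF r[unfolded a_def] s])
    note ls = conv_square_l1[OF l] and lp = conv_prod_l1[OF l]
    have sup: "norm (conv_square r j x) \<le> p ^ 2 ^ j" for j x
    proof (rule norm_le_sup_cfourier[OF ls(1)])
      fix k :: "real^'d" assume "k \<in> torus"
      hence "norm (cfourier r k) \<le> p" using rq p by fastforce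
      thus "norm (cfourier (conv_square r j) k) \<le> p ^ 2 ^ j"
        unfolding ls(2) norm_power by (intro power_mono) auto
    qed
    have sq: "norm (conv_square r j x) \<le> \<beta> j * jb x powr - a" for j x
    proof (induction j arbitrary: x)
      case 0
      show ?case using r[of x] by (simp add: \<beta>_0)
    next
      case (Suc j)
      let ?S = "\<Sum>\<^sub>\<infinity>x. norm (conv_square r j x)"
      have S: "?S \<le> \<beta> j powr \<theta> * (p ^ 2 ^ j) powr (1 - \<theta>) * Z"
        unfolding Z_def \<theta>_def using Suc.IH \<beta>0[of j] p s sup
        by (intro l1_interpolation) (auto simp: a_def)
      have "norm (conv_square r (Suc j) x) \<le> 2 powr a * (\<beta> j * ?S + \<beta> j * ?S) * jb x powr - a"
        unfolding conv_square.simps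
        using Suc.IH \<beta>0[of j] a by (intro conv_weighted_bound ls) auto
      also have "\<dots> = (2 powr a * 2 * \<beta> j) * ?S * jb x powr - a" by simp
      also have "\<dots> \<le> (2 powr a * 2 * \<beta> j) * (\<beta> j powr \<theta> * (p ^ 2 ^ j) powr (1 - \<theta>) * Z) * jb x powr - a"
        using \<beta>0[of j] by (intro mult_right_mono mult_left_mono S) auto
      also have "\<dots> = (2 powr a * 2 * Z) * (\<beta> j * (\<beta> j powr \<theta> * (p ^ 2 ^ j) powr (1 - \<theta>))) * jb x powr - a"
        by simp
      also have "\<dots> \<le> A * (\<beta> j * (\<beta> j powr \<theta> * (p ^ 2 ^ j) powr (1 - \<theta>))) * jb x powr - a"
        using \<beta>0[of j] by (intro mult_right_mono A) auto
      also have "\<dots> = \<beta> (Suc j) * jb x powr - a" by (simp only: \<beta>_Suc[symmetric] mult.assoc)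
      finally show ?case .
    qed
    define \<gamma> where "\<gamma> = (\<lambda>J. exp (A' * (\<Sum>j<J. \<beta> j)))"
    have pr: "norm (conv_prod r J x) \<le> \<gamma> J * jb x powr - a" for J x
    proof (induction J arbitrary: x)
      case 0
      show ?case by (auto simp: \<gamma>_def kron_def)
    next
      case (Suc J)
      let ?S = "\<Sum>\<^sub>\<infinity>x. norm (conv_square r J x)" and ?P = "\<Sum>\<^sub>\<infinity>x. norm (conv_prod r J x)"
      have g0: "\<gamma> J > 0" by (simp add: \<gamma>_def)
      have S: "?S \<le> \<beta> J * Z'" unfolding Z'_def by (rule l1_bound(2)[OF sq[unfolded a_def] s])
      have P: "?P \<le> \<gamma> J * Z'" unfolding Z'_def by (rule l1_bound(2)[OF Suc.IH[unfolded a_def] s])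
      have "norm (conv (conv_prod r J) (conv_square r J) x) \<le> 2 powr a * (\<gamma> J * ?S + \<beta> J * ?P) * jb x powr - a"
        using a g0 \<beta>0[of J] by (intro conv_weighted_bound ls lp Suc.IH sq) auto
      also have "\<dots> \<le> 2 powr a * (\<gamma> J * (\<beta> J * Z') + \<beta> J * (\<gamma> J * Z')) * jb x powr - a"
        using g0 \<beta>0[of J] by (intro mult_right_mono mult_left_mono add_mono S P) auto
      also have "\<dots> = A' * \<beta> J * \<gamma> J * jb x powr - a" by (simp add: A'_def)
      finally have "norm (conv (conv_prod r J) (conv_square r J) x) \<le> A' * \<beta> J * \<gamma> J * jb x powr - a" .
      hence "norm (conv_prod r (Suc J) x) \<le> \<gamma> J * jb x powr - a + A' * \<beta> J * \<gamma> J * jb x powr - a"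
        unfolding conv_prod.simps by (intro norm_triangle_mono Suc.IH)
      also have "\<dots> = \<gamma> J * (1 + A' * \<beta> J) * jb x powr - a" by (simp add: algebra_simps)
      also have "\<dots> \<le> \<gamma> J * exp (A' * \<beta> J) * jb x powr - a"
        using g0 by (intro mult_right_mono mult_left_mono exp_ge_add_one_self) auto
      also have "\<gamma> J * exp (A' * \<beta> J) = \<gamma> (Suc J)" by (simp add: \<gamma>_def distrib_left exp_add)
      finally show ?case .
    qed
    have \<gamma>: "\<gamma> J \<le> \<Gamma>" for J
      unfolding \<gamma>_def \<Gamma>_def using A' \<beta>_sum \<beta>0
      by (auto intro!: mult_left_mono sum_le_suminf intro: less_imp_le)
    let ?b = "\<lambda>k. 1 / (1 - cfourier r k)"
    have den: "norm (?b k) \<le> 1 / (1 - q)" if "k \<in> torus" for k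
    proof -
      have "1 - q \<le> norm (1 - cfourier r k)"
        using rq[OF that] norm_triangle_ineq2[of 1 "cfourier r k"] by simp
      thus ?thesis using q by (simp add: norm_divide frac_le)
    qed
    have meas: "?b \<in> borel_measurable borel"
      using borel_measurable_cfourier[OF l] by measurable
    have bi: "set_integrable lborel torus ?b"
      by (rule set_integrable_torus_bounded[OF meas den])
    \<comment> \<open>On the torus 1 / (1 - z) is the partial Neumann sum plus z^(2^J) / (1 - z).
      The remainder is small uniformly in x and vanishes as J grows, so no decay in x is asked of
      it.\<close>
    have le: "norm (inv_fourier ?b x) \<le> \<Gamma> * jb x powr - a + p ^ J / (1 - q)" for J
    proof -
      have m2: "(\<lambda>k. cfourier r k ^ 2 ^ J) \<in> borel_measurable borel"
        using borel_measurable_cfourier[OF l] by measurable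
      have pw: "norm (cfourier r k ^ 2 ^ J) \<le> p ^ J" if "k \<in> torus" for k
      proof -
        have "norm (cfourier r k) ^ 2 ^ J \<le> p ^ 2 ^ J"
          using rq[OF that] p by (intro power_mono) auto
        also have "\<dots> \<le> p ^ J" using p less_exp[of J] by (intro power_decreasing) auto
        finally show ?thesis by (simp add: norm_power)
      qed
      have bi2: "set_integrable lborel torus (\<lambda>k. cfourier r k ^ 2 ^ J * ?b k)"
        by (rule set_integrable_bound_mult[OF bi m2 pw])
      have "inv_fourier ?b x = inv_fourier (\<lambda>k. cfourier (conv_prod r J) k + cfourier r k ^ 2 ^ J * ?b k) x"
      proof (rule inv_fourier_cong_AE[OF _ bi set_integral_add(1)[OF set_integrable_cfourier[OF lp(1)] bi2]])
        show "AE k in lborel. k \<in> torus \<longrightarrow> ?b k = cfourier (conv_prod r J) k + cfourier r k ^ 2 ^ J * ?b k"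
        proof (intro AE_I2 impI)
          fix k :: "real^'d" assume "k \<in> torus"
          hence "1 - cfourier r k \<noteq> 0" using rq[of k] q by auto
          thus "?b k = cfourier (conv_prod r J) k + cfourier r k ^ 2 ^ J * ?b k"
            using lp(2)[of k J] by (simp add: field_simps)
        qed
      qed
      also have "\<dots> = conv_prod r J x + inv_fourier (\<lambda>k. cfourier r k ^ 2 ^ J * ?b k) x"
        by (subst inv_fourier_add[OF set_integrable_cfourier[OF lp(1)] bi2])
          (simp add: inv_fourier_cfourier[OF lp(1)])
      also have "norm \<dots> \<le> \<gamma> J * jb x powr - a + p ^ J * (1 / (1 - q))"
      proof (intro norm_triangle_mono pr norm_inv_fourier_le_bound bi2)
        fix k :: "real^'d" assume k: "k \<in> torus"
        show "norm (cfourier r k ^ 2 ^ J * ?b k) \<le> p ^ J * (1 / (1 - q))"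
          unfolding norm_mult using p q by (intro mult_mono pw den k) auto
      qed
      also have "\<dots> \<le> \<Gamma> * jb x powr - a + p ^ J * (1 / (1 - q))"
        by (intro add_mono mult_right_mono \<gamma>) (use q in auto)
      finally show ?thesis by simp
    qed
    have "(\<lambda>J. \<Gamma> * jb x powr - a + p ^ J / (1 - q)) \<longlonglongrightarrow> \<Gamma> * jb x powr - a + 0 / (1 - q)"
      using p q by (intro tendsto_intros LIMSEQ_power_zero) auto
    hence "(\<lambda>J. \<Gamma> * jb x powr - a + p ^ J / (1 - q)) \<longlonglongrightarrow> \<Gamma> * jb x powr - a" by simp
    thus ?thesis by (rule LIMSEQ_le_const) (use le in auto)
  qed
  moreover have "\<Gamma> \<ge> 0" by (simp add: \<Gamma>_def)
  ultimately show ?thesis unfolding a_def by blast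
qed

section \<open>Moments and Fourier transform of the kernel\<close>

lemma lattice_symmetric_reflect:
  assumes "lattice_symmetric f"
  shows "f (reflect i y) = f y"
proof -
  have "f (\<chi> j. (if j = i then - 1 else 1) * y $ id j) = f y"
    using assms permutes_id[of UNIV] unfolding lattice_symmetric_def
    by (elim allE[of _ id] allE[of _ "\<lambda>j. if j = i then - 1 else 1"] allE[of _ y]) auto
  moreover have "(\<chi> j. (if j = i then - 1 else 1) * y $ id j) = reflect i y"
    by (simp add: reflect_def vec_eq_iff)
  ultimately show ?thesis by simp
qed

text \<open>Transposing coordinates makes all d diagonal second moments equal, so that the single
  parameter \<mu> can cancel them all.\<close>

lemma lattice_symmetric_second_moment:
  fixes f :: "int^'d::finite \<Rightarrow> real"
  assumes "lattice_symmetric f"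
  shows "(\<Sum>\<^sub>\<infinity>x. f x * (real_of_int (x $ i))\<^sup>2) = (\<Sum>\<^sub>\<infinity>x. f x * (real_of_int (x $ j))\<^sup>2)"
proof -
  let ?p = "Transposition.transpose i j"
  define T where "T = (\<lambda>x::int^'d. \<chi> l. x $ ?p l)"
  have T: "f (T x) = f x" for x
  proof -
    have "f (\<chi> l. 1 * x $ ?p l) = f x"
      using assms permutes_swap_id[of i UNIV j] unfolding lattice_symmetric_def
      by (elim allE[of _ ?p] allE[of _ "\<lambda>_. 1"] allE[of _ x]) auto
    thus ?thesis by (simp add: T_def)
  qed
  have TT: "T (T x) = x" for x by (simp add: T_def vec_eq_iff)
  show ?thesis
    by (rule infsum_reindex_bij_witness[where i = T and j = T])
      (auto simp: TT T, simp add: T_def)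
qed

lemma infsum_finite_sum:
  fixes g :: "'i \<Rightarrow> 'a \<Rightarrow> real"
  assumes "finite I" "\<And>i. i \<in> I \<Longrightarrow> g i summable_on A"
  shows "(\<lambda>x. \<Sum>i\<in>I. g i x) summable_on A" "(\<Sum>\<^sub>\<infinity>x\<in>A. \<Sum>i\<in>I. g i x) = (\<Sum>i\<in>I. infsum (g i) A)"
proof -
  have "(\<lambda>x. \<Sum>i\<in>I. g i x) summable_on A \<and> (\<Sum>\<^sub>\<infinity>x\<in>A. \<Sum>i\<in>I. g i x) = (\<Sum>i\<in>I. infsum (g i) A)"
    using assms by (induction I rule: finite_induct) (auto simp: infsum_add intro: summable_on_add)
  thus "(\<lambda>x. \<Sum>i\<in>I. g i x) summable_on A" "(\<Sum>\<^sub>\<infinity>x\<in>A. \<Sum>i\<in>I. g i x) = (\<Sum>i\<in>I. infsum (g i) A)"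
    by auto
qed

lemma cos_taylor_powr:
  fixes t :: real
  assumes "0 \<le> a" "a \<le> 2"
  shows "\<bar>1 - cos t - t\<^sup>2 / 2\<bar> \<le> \<bar>t\<bar> powr (2 + a)"
proof (cases "\<bar>t\<bar> \<le> 1")
  case True
  show ?thesis
  proof (cases "t = 0")
    case False
    have "\<bar>1 - cos t - t\<^sup>2 / 2\<bar> \<le> t ^ 4 / 24" by (rule cos_taylor_4)
    also have "\<dots> \<le> \<bar>t\<bar> ^ 4" by simp
    also have "\<dots> = \<bar>t\<bar> powr 4" using False by (simp add: powr_numeral)
    also have "\<dots> \<le> \<bar>t\<bar> powr (2 + a)" using True assms by (intro powr_mono') auto
    finally show ?thesis .
  qed simp
next
  case False
  have "\<bar>1 - cos t - t\<^sup>2 / 2\<bar> \<le> t\<^sup>2"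
    using one_minus_cos_le[of t] cos_le_one[of t] zero_le_power2[of t] unfolding abs_le_iff by linarith
  also have "\<dots> = \<bar>t\<bar> powr 2" using False by (simp add: powr_numeral)
  also have "\<dots> \<le> \<bar>t\<bar> powr (2 + a)" using False assms by (intro powr_mono) auto
  finally show ?thesis .
qed

text \<open>Will bound 1/\<lambda> from above independently of F; the summand 1 makes positivity
  immediate from \<open>jbsum_nonneg\<close>.\<close>

definition denom_bound :: "'d::finite itself \<Rightarrow> real \<Rightarrow> real \<Rightarrow> real" where
  "denom_bound T K1 \<rho> = K1 * jbsum T (2 + \<rho>) + K1 * jbsum T \<rho> + 1"

locale decaying_kernel =
  fixes F :: "int^'d::finite \<Rightarrow> real" and K1 K2 \<rho> :: real
  assumes d: "CARD('d) > 2" and K1: "K1 > 0" and K2: "K2 > 0" and \<rho>: "\<rho> > 0"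
    and sym: "lattice_symmetric F"
    and decay: "\<And>x. \<bar>F x\<bar> \<le> K1 * jb x powr - (real CARD('d) + 2 + \<rho>)"
    and F0: "Re (fourier F 0) \<ge> 0"
    and infrared: "\<And>k. k \<in> torus \<Longrightarrow> Re (fourier F k) - Re (fourier F 0) \<ge> K2 * (norm k)\<^sup>2"
begin

abbreviation "f \<equiv> \<lambda>x. complex_of_real (F x)"
abbreviation "R k \<equiv> Re (fourier F k)"

lemma fourier_F: "fourier F k = of_real (R k)" "cfourier f k = of_real (R k)"
  using fourier_symmetric_real[OF sym, of k] by (simp_all add: fourier_cfourier)

lemma norm_fourier_F: "norm (fourier F k) = \<bar>R k\<bar>"
  using arg_cong[OF fourier_F(1), of norm k] by (simp only: norm_of_real)

lemma weighted_summable: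
  assumes "0 \<le> a" "a < 2 + \<rho>"
  shows "(\<lambda>x. \<bar>F x\<bar> * jb x powr a) summable_on UNIV"
    and "(\<Sum>\<^sub>\<infinity>x. \<bar>F x\<bar> * jb x powr a) \<le> K1 * jbsum TYPE('d) (2 + \<rho> - a)"
proof -
  have "norm (complex_of_real (\<bar>F x\<bar> * jb x powr a)) \<le> K1 * jb x powr - (real CARD('d) + (2 + \<rho> - a))" for x
  proof -
    have "\<bar>F x\<bar> * jb x powr a \<le> (K1 * jb x powr - (real CARD('d) + 2 + \<rho>)) * jb x powr a"
      by (intro mult_right_mono decay) auto
    also have "\<dots> = K1 * jb x powr - (real CARD('d) + (2 + \<rho> - a))"
      unfolding mult.assoc powr_add[symmetric] by (rule arg_cong[where f = "\<lambda>a. K1 * jb x powr a"]) simp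
    finally show ?thesis by (simp add: abs_mult norm_mult)
  qed
  from l1_bound[OF this] assms
  show "(\<lambda>x. \<bar>F x\<bar> * jb x powr a) summable_on UNIV"
    and "(\<Sum>\<^sub>\<infinity>x. \<bar>F x\<bar> * jb x powr a) \<le> K1 * jbsum TYPE('d) (2 + \<rho> - a)"
    by (simp_all add: abs_mult norm_mult)
qed

lemma l1_f: "l1 f"
  using weighted_summable(1)[of 0] \<rho> by simp

lemma F_decay_norm: "norm (f x) \<le> K1 * jb x powr - (real CARD('d) + 2 + \<rho>)"
  using decay[of x] by simp

lemma coordinate_moment_summable:
  "(\<lambda>x. \<bar>F x\<bar> * (real_of_int (x $ j))\<^sup>2) summable_on UNIV" "(\<lambda>x. F x * (real_of_int (x $ j))\<^sup>2) summable_on UNIV"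
proof -
  show 1: "(\<lambda>x. \<bar>F x\<bar> * (real_of_int (x $ j))\<^sup>2) summable_on UNIV"
  proof (rule summable_on_comparison_test[OF weighted_summable(1)[of 2]])
    fix x :: "int^'d"
    show "\<bar>F x\<bar> * (real_of_int (x $ j))\<^sup>2 \<le> \<bar>F x\<bar> * jb x powr 2"
      using power_mono[OF abs_nth_le_jb[of x j] abs_ge_zero, of 2] by (intro mult_left_mono) auto
  qed (use \<rho> in auto)
  show "(\<lambda>x. F x * (real_of_int (x $ j))\<^sup>2) summable_on UNIV"
    by (rule abs_summable_summable) (use 1 in \<open>simp add: abs_mult\<close>)
qed

lemma second_moment_coordinate: "second_moment F = real CARD('d) * (\<Sum>\<^sub>\<infinity>x. F x * (real_of_int (x $ j))\<^sup>2)"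
proof -
  have "second_moment F = (\<Sum>\<^sub>\<infinity>x. \<Sum>i\<in>UNIV. F x * (real_of_int (x $ i))\<^sup>2)"
    unfolding second_moment_def norm_emb_power2 by (simp add: sum_distrib_left mult.commute)
  also have "\<dots> = (\<Sum>i\<in>UNIV. \<Sum>\<^sub>\<infinity>x. F x * (real_of_int (x $ i))\<^sup>2)"
    by (rule infsum_finite_sum(2)) (auto intro: coordinate_moment_summable)
  also have "\<dots> = (\<Sum>i\<in>(UNIV::'d set). \<Sum>\<^sub>\<infinity>x. F x * (real_of_int (x $ j))\<^sup>2)"
    by (rule sum.cong) (auto intro: lattice_symmetric_second_moment[OF sym])
  finally show ?thesis by simp
qed

lemma second_moment_abs_le: "\<bar>second_moment F\<bar> \<le> K1 * jbsum TYPE('d) \<rho>"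
proof -
  have le: "norm ((norm (emb x))\<^sup>2 * F x) \<le> \<bar>F x\<bar> * jb x powr 2" for x
    using norm_emb_power2_le[of x] by (simp add: abs_mult mult.commute mult_left_mono)
  have s: "(\<lambda>x. norm ((norm (emb x))\<^sup>2 * F x)) summable_on UNIV"
    by (rule summable_on_comparison_test[OF weighted_summable(1)[of 2] le]) (use \<rho> in auto)
  have "norm (second_moment F) \<le> (\<Sum>\<^sub>\<infinity>x. norm ((norm (emb x))\<^sup>2 * F x))"
    unfolding second_moment_def by (rule norm_infsum_bound[OF s])
  also have "\<dots> \<le> (\<Sum>\<^sub>\<infinity>x. \<bar>F x\<bar> * jb x powr 2)"
    by (rule infsum_mono[OF s weighted_summable(1)[of 2] le]) (use \<rho> in auto)
  also have "\<dots> \<le> K1 * jbsum TYPE('d) \<rho>" using weighted_summable(2)[of 2] \<rho> by simp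
  finally show ?thesis by simp
qed

lemma R0_le: "R 0 \<le> K1 * jbsum TYPE('d) (2 + \<rho>)"
proof -
  have "R 0 \<le> norm (cfourier f 0)" unfolding fourier_F(2) norm_of_real by (rule abs_ge_self)
  also have "\<dots> \<le> (\<Sum>\<^sub>\<infinity>x. norm (f x))" by (rule norm_cfourier_le[OF l1_f])
  also have "\<dots> \<le> K1 * jbsum TYPE('d) (2 + \<rho>)" using weighted_summable(2)[of 0] \<rho> by simp
  finally show ?thesis .
qed

text \<open>Termwise expansion of the real cosine series; equality of the diagonal second moments
  identifies the quadratic coefficient. One axis direction is enough for both limits at the origin
  that rely on it.\<close>

lemma fourier_axis_expansion:
  assumes a: "0 \<le> a" "a \<le> 2" "a < \<rho>"
  shows "\<bar>R (axis j t) - R 0 + t\<^sup>2 / 2 * (second_moment F / real CARD('d))\<bar> \<le> K1 * jbsum TYPE('d) (\<rho> - a) * \<bar>t\<bar> powr (2 + a)"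
proof -
  have re: "R k = (\<Sum>\<^sub>\<infinity>x. F x * cos (k \<bullet> emb x))" and
    cs: "(\<lambda>x. F x * cos (k \<bullet> emb x)) summable_on UNIV" for k
  proof -
    have "R k = (\<Sum>\<^sub>\<infinity>x. Re (f x * exp (\<i> * of_real (k \<bullet> emb x))))"
      unfolding fourier_cfourier cfourier_def by (rule infsum_Re[OF l1_char[OF l1_f], symmetric])
    thus "R k = (\<Sum>\<^sub>\<infinity>x. F x * cos (k \<bullet> emb x))" by (simp add: Re_exp)
    show "(\<lambda>x. F x * cos (k \<bullet> emb x)) summable_on UNIV"
      using summable_on_Re[OF l1_char[OF l1_f, of k]] by (simp add: Re_exp)
  qed
  have ax: "axis j t \<bullet> emb x = t * real_of_int (x $ j)" for x :: "int^'d" by (simp add: inner_axis')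
  let ?g = "\<lambda>x. F x * (cos (t * real_of_int (x $ j)) - 1 + (t * real_of_int (x $ j))\<^sup>2 / 2)"
  have s1: "(\<lambda>x. F x * cos (t * real_of_int (x $ j))) summable_on UNIV" using cs[of "axis j t"] by (simp add: ax)
  have s2: "(\<lambda>x. F x) summable_on UNIV" using cs[of 0] by simp
  have s3: "(\<lambda>x. t\<^sup>2 / 2 * (F x * (real_of_int (x $ j))\<^sup>2)) summable_on UNIV"
    by (intro summable_on_cmult_right coordinate_moment_summable)
  have R0: "R 0 = infsum F UNIV" using re[of 0] by simp
  have Rj: "R (axis j t) = (\<Sum>\<^sub>\<infinity>x. F x * cos (t * real_of_int (x $ j)))"
    using re[of "axis j t"] by (simp add: ax)
  have Mj: "second_moment F / real CARD('d) = (\<Sum>\<^sub>\<infinity>x. F x * (real_of_int (x $ j))\<^sup>2)"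
    using second_moment_coordinate[of j] by simp
  have "R (axis j t) - R 0 + t\<^sup>2 / 2 * (second_moment F / real CARD('d))
     = (\<Sum>\<^sub>\<infinity>x. F x * cos (t * real_of_int (x $ j))) - infsum F UNIV + (\<Sum>\<^sub>\<infinity>x. t\<^sup>2 / 2 * (F x * (real_of_int (x $ j))\<^sup>2))"
    unfolding R0 Rj Mj by (simp only: infsum_cmult_right')
  also have "\<dots> = (\<Sum>\<^sub>\<infinity>x. F x * cos (t * real_of_int (x $ j)) - F x + t\<^sup>2 / 2 * (F x * (real_of_int (x $ j))\<^sup>2))"
    using infsum_add[OF summable_on_add[OF s1 summable_on_uminus[THEN iffD2, OF s2]] s3]
      infsum_add[OF s1 summable_on_uminus[THEN iffD2, OF s2]]
    by (simp add: infsum_uminus)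
  also have "\<dots> = infsum ?g UNIV"
    by (rule infsum_cong) (simp add: algebra_simps power_mult_distrib)
  finally have eq: "R (axis j t) - R 0 + t\<^sup>2 / 2 * (second_moment F / real CARD('d)) = infsum ?g UNIV" .
  let ?b = "\<lambda>x. \<bar>t\<bar> powr (2 + a) * (\<bar>F x\<bar> * jb x powr (2 + a))"
  have le: "norm (?g x) \<le> ?b x" for x
  proof -
    have "norm (?g x) = \<bar>F x\<bar> * \<bar>1 - cos (t * real_of_int (x $ j)) - (t * real_of_int (x $ j))\<^sup>2 / 2\<bar>"
      by (simp add: abs_mult) (simp add: abs_if)
    also have "\<dots> \<le> \<bar>F x\<bar> * \<bar>t * real_of_int (x $ j)\<bar> powr (2 + a)"
      by (intro mult_left_mono cos_taylor_powr a) auto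
    also have "\<dots> \<le> \<bar>F x\<bar> * (\<bar>t\<bar> powr (2 + a) * jb x powr (2 + a))"
      using a by (intro mult_left_mono) (auto simp: abs_mult powr_mult intro!: mult_left_mono powr_mono2 abs_nth_le_jb)
    finally show ?thesis by (simp add: mult_ac)
  qed
  have bs: "?b summable_on UNIV" using a by (intro summable_on_cmult_right weighted_summable) auto
  have gs: "(\<lambda>x. norm (?g x)) summable_on UNIV"
    by (rule summable_on_comparison_test[OF bs]) (use le in auto)
  have "norm (infsum ?g UNIV) \<le> (\<Sum>\<^sub>\<infinity>x. norm (?g x))" by (rule norm_infsum_bound[OF gs])
  also have "\<dots> \<le> infsum ?b UNIV" by (rule infsum_mono[OF gs bs]) (use le in auto)
  also have "\<dots> = \<bar>t\<bar> powr (2 + a) * (\<Sum>\<^sub>\<infinity>x. \<bar>F x\<bar> * jb x powr (2 + a))" by (rule infsum_cmult_right')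
  also have "\<dots> \<le> \<bar>t\<bar> powr (2 + a) * (K1 * jbsum TYPE('d) (2 + \<rho> - (2 + a)))"
    using a by (intro mult_left_mono weighted_summable) auto
  finally have "norm (infsum ?g UNIV) \<le> \<bar>t\<bar> powr (2 + a) * (K1 * jbsum TYPE('d) (2 + \<rho> - (2 + a)))" .
  moreover have "2 + \<rho> - (2 + a) = \<rho> - a" by simp
  ultimately show ?thesis unfolding eq by (simp only: real_norm_def mult.commute)
qed

text \<open>Half of the admissible range: what matters later is some positive power of t in the
  error term.\<close>

definition a0 :: real where "a0 = min \<rho> 2 / 2"

lemma a0: "0 < a0" "a0 \<le> 2" "a0 < \<rho>"
  using \<rho> by (auto simp: a0_def)

lemma powr_at_right_0: "((\<lambda>t::real. t powr a0) \<longlongrightarrow> 0) (at_right 0)"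
  by (rule tendsto_zero_powrI[OF _ tendsto_const _ a0(1)])
    (auto simp: eventually_at_filter intro!: tendsto_ident_at)

lemma axis_in_torus: "0 < t \<Longrightarrow> t < pi \<Longrightarrow> axis j t \<in> torus"
  by (auto simp: torus_def axis_def)

text \<open>The infrared bound is compared with the expansion along an axis and divided by the
  square of t; as t tends to 0 from the right, the error of order \<open>t powr a0\<close>
  disappears.\<close>

lemma minus_second_moment_ge: "- second_moment F \<ge> 2 * real CARD('d) * K2"
proof -
  \<comment> \<open>Any coordinate will do; the index type is nonempty.\<close>
  obtain j :: 'd where True by blast
  define Q where "Q = K1 * jbsum TYPE('d) (\<rho> - a0)"
  have "K2 \<le> - second_moment F / (2 * real CARD('d)) + Q * t powr a0" if t: "0 < t" "t < pi" for t
  proof -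
    have "K2 * t\<^sup>2 \<le> R (axis j t) - R 0"
      using infrared[OF axis_in_torus[OF t, of j]] unfolding power2_norm_eq_inner inner_axis_axis by (simp add: power2_eq_square)
    also have "\<dots> \<le> - (t\<^sup>2 / 2 * (second_moment F / real CARD('d))) + Q * \<bar>t\<bar> powr (2 + a0)"
      using fourier_axis_expansion[of a0 j t] a0 unfolding Q_def by (simp add: abs_le_iff)
    also have "\<bar>t\<bar> powr (2 + a0) = t\<^sup>2 * t powr a0" using t by (simp add: powr_add powr_numeral)
    also have "- (t\<^sup>2 / 2 * (second_moment F / real CARD('d))) + Q * (t\<^sup>2 * t powr a0)
        = (- second_moment F / (2 * real CARD('d)) + Q * t powr a0) * t\<^sup>2" by (simp add: field_simps)
    finally show ?thesis using t by simp
  qed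
  hence "eventually (\<lambda>t. K2 \<le> - second_moment F / (2 * real CARD('d)) + Q * t powr a0) (at_right 0)"
    using eventually_at_right_field by (auto simp: eventually_at_right_field intro!: exI[of _ pi])
  moreover have "((\<lambda>t. - second_moment F / (2 * real CARD('d)) + Q * t powr a0) \<longlongrightarrow> - second_moment F / (2 * real CARD('d)) + Q * 0) (at_right 0)"
    by (intro tendsto_intros powr_at_right_0)
  ultimately have "K2 \<le> - second_moment F / (2 * real CARD('d)) + Q * 0"
    by (intro tendsto_lowerbound[of _ _ "at_right 0"]) auto
  thus ?thesis by (simp add: field_simps)
qed

lemma D2: "real CARD('d) > 2" using d by simp

lemma den_bounds: "2 * real CARD('d) * K2 \<le> R 0 - second_moment F" "R 0 - second_moment F \<le> denom_bound TYPE('d) K1 \<rho>" "R 0 - second_moment F > 0"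
proof -
  show 1: "2 * real CARD('d) * K2 \<le> R 0 - second_moment F" using minus_second_moment_ge F0 by linarith
  show "R 0 - second_moment F \<le> denom_bound TYPE('d) K1 \<rho>" using R0_le second_moment_abs_le by (simp add: denom_bound_def)
  have "0 < 2 * real CARD('d) * K2" using D2 K2 by simp
  with 1 show "R 0 - second_moment F > 0" by linarith
qed

lemma L_pos: "denom_bound TYPE('d) K1 \<rho> > 0"
  using den_bounds by linarith

lemma lam_bounds: "lam F > 0" "1 / denom_bound TYPE('d) K1 \<rho> \<le> lam F" "lam F \<le> 1 / (2 * real CARD('d) * K2)"
  using den_bounds D2 K2 L_pos by (auto simp: lam_def intro!: divide_left_mono mult_pos_pos)

text \<open>Up to the factor 1/d in the first, these identities are the vanishing of the second and
  of the zeroth moment of the difference kernel.\<close>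

lemma mu_eq: "mu F = - lam F * second_moment F" "1 - mu F = lam F * R 0"
proof -
  have "lam F * (R 0 - second_moment F) = 1" using den_bounds by (simp add: lam_def)
  thus "mu F = - lam F * second_moment F" by (simp add: mu_def algebra_simps)
  show "1 - mu F = lam F * R 0" by (simp add: mu_def)
qed

text \<open>The lower bound keeps \<mu> away from 0 uniformly in F, which
  \<open>lattice_green_bounds\<close> requires. It multiplies the lower bounds on \<lambda> and on
  minus the second moment.\<close>

lemma mu_bounds: "2 * real CARD('d) * K2 / denom_bound TYPE('d) K1 \<rho> \<le> mu F" "mu F \<le> 1" "mu F > 0" "2 * real CARD('d) * K2 / denom_bound TYPE('d) K1 \<rho> > 0"
proof -
  show 0: "2 * real CARD('d) * K2 / denom_bound TYPE('d) K1 \<rho> > 0" using D2 K2 L_pos by simp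
  have "1 / denom_bound TYPE('d) K1 \<rho> * (2 * real CARD('d) * K2) \<le> lam F * (- second_moment F)"
    using lam_bounds minus_second_moment_ge D2 K2 by (intro mult_mono) auto
  thus 1: "2 * real CARD('d) * K2 / denom_bound TYPE('d) K1 \<rho> \<le> mu F" by (simp add: mu_eq)
  show "mu F > 0" using 0 1 by linarith
  show "mu F \<le> 1" using mu_eq(2) lam_bounds(1) F0 by (metis diff_ge_0_iff_ge less_imp_le mult_nonneg_nonneg)
qed

lemma R_pos: "k \<in> torus \<Longrightarrow> k \<noteq> 0 \<Longrightarrow> R k \<ge> K2 * (norm k)\<^sup>2 \<and> R k > 0"
proof -
  assume k: "k \<in> torus" "k \<noteq> 0"
  have "0 < K2 * (norm k)\<^sup>2" using K2 k by simp
  thus ?thesis using infrared[OF k(1)] F0 by linarith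
qed

lemma fourier_F_measurable: "fourier F \<in> borel_measurable borel"
  using borel_measurable_cfourier[OF l1_f] by (simp add: fourier_cfourier[abs_def])

lemma set_integrable_inverse_fourier: "set_integrable lborel torus (\<lambda>k. 1 / fourier F k)"
proof (rule set_integrable_bound)
  show "set_integrable lborel torus (\<lambda>k::real^'d. of_real (1 / K2) * complex_of_real (1 / (norm k)\<^sup>2))"
    by (intro set_integrable_mult_right set_integrable_inverse_square d)
  show "set_borel_measurable lborel torus (\<lambda>k. 1 / fourier F k)"
    using fourier_F_measurable unfolding set_borel_measurable_def by measurable
  show "AE k in lborel. k \<in> torus \<longrightarrow> norm (1 / fourier F k) \<le> norm (of_real (1 / K2) * complex_of_real (1 / (norm k)\<^sup>2))"
    using AE_lborel_neq[of 0]
  proof eventually_elim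
    case (elim k)
    show ?case
    proof
      assume k: "k \<in> torus"
      have "norm (1 / fourier F k) = 1 / R k"
        using R_pos[OF k elim] by (simp add: norm_divide norm_fourier_F)
      also have "\<dots> \<le> 1 / (K2 * (norm k)\<^sup>2)"
        using R_pos[OF k elim] K2 elim by (intro divide_left_mono mult_pos_pos) auto
      finally show "norm (1 / fourier F k) \<le> norm (of_real (1 / K2) * complex_of_real (1 / (norm k)\<^sup>2))"
        using K2 by (simp add: norm_mult norm_divide norm_power)
    qed
  qed
qed

text \<open>F is summable and its Green function bounded. Since \<open>infsum\<close> is 0 on
  families that are not summable, this gives the equation \<open>F * G = \<delta>\<close> its
  intended meaning.\<close>

lemma green_summable: "(\<lambda>y. norm (f y * green F (x - y))) summable_on UNIV"
proof -
  let ?B = "(LINT k:torus|lborel. norm (1 / fourier F k)) / (2 * pi) ^ CARD('d)"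
  have "(\<lambda>y. norm (f y) * ?B) summable_on UNIV" by (intro summable_on_cmult_left l1_f)
  thus ?thesis
  proof (rule summable_on_comparison_test)
    show "norm (f y * green F (x - y)) \<le> norm (f y) * ?B" for y
      unfolding norm_mult green_def
      by (intro mult_left_mono norm_inv_fourier_le set_integrable_inverse_fourier norm_ge_zero)
  qed auto
qed

lemma conv_green: "conv f (green F) = kron"
proof
  fix x
  have "conv f (green F) x = inv_fourier (\<lambda>k. cfourier f k * (1 / fourier F k)) x"
    unfolding green_def by (rule conv_inv_fourier[OF l1_f set_integrable_inverse_fourier])
  also have "\<dots> = inv_fourier (\<lambda>_. 1) x"
  proof (rule inv_fourier_cong_AE)
    show "AE k in lborel. k \<in> torus \<longrightarrow> cfourier f k * (1 / fourier F k) = 1"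
      using AE_lborel_neq[of 0]
    proof eventually_elim
      case (elim k)
      show ?case
      proof
        assume "k \<in> torus"
        hence "fourier F k \<noteq> 0" using R_pos[of k] elim by auto
        thus "cfourier f k * (1 / fourier F k) = 1" by (simp add: fourier_cfourier[symmetric])
      qed
    qed
    show "set_integrable lborel torus (\<lambda>k. cfourier f k * (1 / fourier F k))"
      by (rule set_integrable_bound_mult[OF set_integrable_inverse_fourier borel_measurable_cfourier[OF l1_f]])
        (rule norm_cfourier_le[OF l1_f])
  qed (rule torus_set_integrable_const)
  finally show "conv f (green F) x = kron x" by (simp add: inv_fourier_1)
qed

end

section \<open>The difference kernel\<close>

lemma norm_axis_power2: "(norm (axis j t :: real^'d::finite))\<^sup>2 = t\<^sup>2"
  unfolding power2_norm_eq_inner inner_axis_axis by (simp add: power2_eq_square)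

lemma ahat_axis: "ahat \<mu> (axis j t :: real^'d::finite) = (1 - \<mu>) + \<mu> * (1 - cos t) / real CARD('d)"
proof -
  have "(\<Sum>i\<in>UNIV. 1 - cos ((axis j t :: real^'d) $ i)) = (\<Sum>i\<in>UNIV. if i = j then 1 - cos t else 0)"
    by (rule sum.cong) (auto simp: axis_def)
  thus ?thesis by (simp add: ahat_eq)
qed

text \<open>The support lies where \<open>jb\<close> equals 1, so any exponent a is allowed.\<close>

lemma step_dist_le: "\<bar>step_dist (x :: int^'d::finite)\<bar> \<le> jb x powr a"
proof (cases "norm (emb x) = 1")
  case True
  hence j: "jb x = 1" and v: "step_dist x = 1 / (2 * real CARD('d))"
    by (simp_all add: jb_def step_dist_def)
  have "1 \<le> real CARD('d)" by (simp add: Suc_le_eq)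
  hence "1 / (2 * real CARD('d)) \<le> 1" by (subst divide_le_eq_1_pos) linarith+
  thus ?thesis unfolding j v by simp
qed (simp add: step_dist_def)

lemma kron_le: "norm (kron x) \<le> jb x powr a"
  by (simp add: kron_def)

lemma step_dist_reflect: "step_dist (reflect i x) = step_dist x"
  by (simp add: step_dist_def)

lemma kron_reflect: "kron (reflect i (x :: int^'d)) = kron x"
proof -
  have r0: "reflect i (0 :: int^'d) = 0" by (simp add: reflect_def vec_eq_iff)
  have "reflect i x = 0 \<longleftrightarrow> x = 0"
    by (metis reflect_reflect r0)
  thus ?thesis by (simp add: kron_def)
qed

lemma step_dist_second_moment:
  "(\<Sum>\<^sub>\<infinity>x::int^'d::finite. complex_of_real (step_dist x) * of_int ((x $ j)\<^sup>2)) = 1 / of_nat CARD('d)"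
proof -
  let ?g = "\<lambda>x::int^'d. complex_of_real (step_dist x) * of_int ((x $ j)\<^sup>2)"
  have n: "axis j (1::int) \<noteq> (axis j (- 1) :: int^'d)" by (simp add: axis_eq_axis)
  have v: "?g (axis j a) = 1 / (2 * of_nat CARD('d))" if "a = 1 \<or> a = - 1" for a
    using that norm_emb_eq_1_iff[of "axis j a :: int^'d"] by (auto simp: step_dist_def axis_def)
  have "infsum ?g UNIV = infsum ?g {axis j 1, axis j (- 1)}"
    by (rule infsum_cong_neutral)
      (auto simp: step_dist_def norm_emb_eq_1_iff, auto simp: axis_def)
  also have "\<dots> = ?g (axis j 1) + ?g (axis j (- 1))" using n by simp
  also have "\<dots> = 1 / of_nat CARD('d)" by (simp only: v simp_thms) (simp add: field_simps)
  finally show ?thesis .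
qed

lemma inner_reflect: "k \<bullet> emb (reflect i x) = (\<chi> j. if j = i then - (k $ j) else k $ j) \<bullet> emb x"
  unfolding inner_vec_def by (rule sum.cong) (auto simp: reflect_def)

lemma cfourier_reflect:
  "cfourier (\<lambda>x. f (reflect i x)) k = cfourier f (\<chi> j. if j = i then - (k $ j) else k $ j)"
  unfolding cfourier_def
  by (rule infsum_reindex_bij_witness[where i = "reflect i" and j = "reflect i"])
    (simp_all add: inner_reflect[symmetric])

lemma ahat_reflect: "ahat \<mu> (\<chi> j. if j = i then - (k $ j) else k $ j) = ahat \<mu> k"
  unfolding ahat_def by (intro arg_cong[where f = "\<lambda>s. 1 - \<mu> * (s / _)"] sum.cong) auto

context decaying_kernel
begin

text \<open>The \<open>A\<close> of the overview at the value of \<mu> that belongs to F;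
  \<open>diff_kernel\<close> is its \<open>E\<close>.\<close>

definition nn_kernel :: "int^'d \<Rightarrow> complex" where
  "nn_kernel x = kron x - of_real (mu F * step_dist x)"

definition diff_kernel :: "int^'d \<Rightarrow> complex" where
  "diff_kernel x = nn_kernel x - of_real (lam F) * f x"

lemma l1_step: "l1 (\<lambda>x::int^'d. complex_of_real (step_dist x))"
  by (rule l1_bound(1)[of _ 1 1]) (auto intro: step_dist_le)

lemma l1_cmult: "l1 g \<Longrightarrow> l1 (\<lambda>x. c * g x)"
  by (simp add: norm_mult summable_on_cmult_right)

lemma nn_kernel_l1: "l1 nn_kernel"
  and cfourier_nn_kernel: "cfourier nn_kernel k = of_real (ahat (mu F) k)"
proof -
  have eq: "nn_kernel = (\<lambda>x. kron x + (- of_real (mu F)) * of_real (step_dist x))"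
    by (simp add: nn_kernel_def fun_eq_iff)
  show "l1 nn_kernel" unfolding eq by (intro l1_add l1_kron l1_cmult l1_step)
  show "cfourier nn_kernel k = of_real (ahat (mu F) k)"
    unfolding eq
    by (subst cfourier_add[OF l1_kron l1_cmult[OF l1_step]])
      (simp add: cfourier_kron cfourier_cmult[of "- of_real (mu F)", simplified] fourier_cfourier[symmetric] fourier_step_dist ahat_def)
qed

lemma diff_kernel_l1: "l1 diff_kernel"
  and cfourier_diff_kernel: "cfourier diff_kernel k = of_real (ahat (mu F) k - lam F * R k)"
proof -
  have eq: "diff_kernel = (\<lambda>x. nn_kernel x + (- of_real (lam F)) * f x)"
    by (simp add: diff_kernel_def fun_eq_iff)
  show "l1 diff_kernel" unfolding eq by (intro l1_add nn_kernel_l1 l1_cmult l1_f)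
  show "cfourier diff_kernel k = of_real (ahat (mu F) k - lam F * R k)"
    unfolding eq
    by (subst cfourier_add[OF nn_kernel_l1 l1_cmult[OF l1_f]], subst cfourier_cmult,
        subst cfourier_nn_kernel, subst fourier_F(2)) simp
qed

text \<open>The constant collects 1 for \<open>\<delta>\<close>, 1 for \<open>\<mu> D\<close>, and
  K1 times the upper bound on \<lambda>. The finite-range terms satisfy every exponent; the cap at 2
  matches the fourth-order expansion.\<close>

lemma diff_kernel_decay:
  "norm (diff_kernel x) \<le> (2 + K1 / (2 * real CARD('d) * K2)) * jb x powr - (real CARD('d) + (2 + min \<rho> 2))"
proof -
  let ?w = "jb x powr - (real CARD('d) + (2 + min \<rho> 2))"
  have "norm (diff_kernel x) \<le> norm (kron x) + norm (complex_of_real (mu F * step_dist x)) + norm (of_real (lam F) * f x)"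
    unfolding diff_kernel_def nn_kernel_def
    by (intro order.trans[OF norm_triangle_ineq4] add_mono norm_triangle_ineq4 order_refl)
  also have "norm (kron x) \<le> ?w" by (rule kron_le)
  also have "norm (complex_of_real (mu F * step_dist x)) \<le> 1 * ?w"
    unfolding norm_of_real abs_mult using mu_bounds by (intro mult_mono step_dist_le) auto
  also have "norm (of_real (lam F) * f x) \<le> 1 / (2 * real CARD('d) * K2) * (K1 * ?w)"
  proof -
    have "norm (f x) \<le> K1 * jb x powr - (real CARD('d) + 2 + \<rho>)" by (rule F_decay_norm)
    also have "\<dots> \<le> K1 * ?w" using K1 by (intro mult_left_mono jb_powr_mono) auto
    finally have "norm (f x) \<le> K1 * ?w" .
    moreover have "norm (complex_of_real (lam F)) \<le> 1 / (2 * real CARD('d) * K2)" using lam_bounds by simp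
    moreover have "0 \<le> 1 / (2 * real CARD('d) * K2)" using K2 by simp
    ultimately show ?thesis unfolding norm_mult by (intro mult_mono) (auto simp del: norm_of_real)
  qed
  finally show ?thesis by (simp add: algebra_simps)
qed

lemma diff_kernel_even: "coord_even diff_kernel"
proof -
  have "diff_kernel (reflect i y) = diff_kernel y" for i y
    unfolding diff_kernel_def nn_kernel_def
    by (simp only: kron_reflect[of i y] step_dist_reflect[of i y] lattice_symmetric_reflect[OF sym, of i y])
  thus ?thesis unfolding coord_even_def by blast
qed

lemma diff_kernel_sum: "infsum diff_kernel UNIV = 0"
proof -
  have a: "ahat (mu F) (0 :: real^'d) = 1 - mu F" by (simp add: ahat_def)
  have b: "ahat (mu F) (0 :: real^'d) - lam F * R 0 = 0"
    unfolding a mu_eq(2) by simp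
  show ?thesis
    using cfourier_diff_kernel[of 0] unfolding b cfourier_0 by simp
qed

text \<open>Per coordinate the step distribution has second moment 1/d and F has
  \<open>second_moment F / d\<close>; the first identity of \<open>mu_eq\<close> makes their
  contributions cancel, and \<open>\<delta>\<close> contributes nothing.\<close>

lemma diff_kernel_second_moment: "(\<Sum>\<^sub>\<infinity>x. diff_kernel x * of_int ((x $ j)\<^sup>2)) = 0"
proof -
  let ?q = "\<lambda>x::int^'d. of_int ((x $ j)\<^sup>2) :: complex"
  have k: "(\<Sum>\<^sub>\<infinity>x. kron x * ?q x) = 0" "(\<lambda>x. kron x * ?q x) = (\<lambda>_. 0)"
    by (auto simp: kron_def fun_eq_iff intro: infsum_0)
  have s: "(\<lambda>x. of_real (step_dist x) * ?q x) summable_on UNIV"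
  proof (rule abs_summable_summable, rule l1_bound(1)[of _ 1 1])
    fix x :: "int^'d"
    have "norm (of_real (step_dist x) * ?q x) = \<bar>step_dist x\<bar> * (real_of_int (x $ j))\<^sup>2"
      by (simp add: norm_mult norm_power)
    also have "\<dots> \<le> jb x powr - (real CARD('d) + 1 + 2) * jb x powr 2"
      using power_mono[OF abs_nth_le_jb[of x j] abs_ge_zero, of 2]
      by (intro mult_mono step_dist_le) auto
    also have "\<dots> = 1 * jb x powr - (real CARD('d) + 1)"
      by (simp only: powr_add[symmetric] mult_1_left) (rule arg_cong[where f = "(powr) (jb x)"], simp)
    finally show "norm (of_real (step_dist x) * ?q x) \<le> 1 * jb x powr - (real CARD('d) + 1)" .
  qed simp
  have fs: "(\<lambda>x. f x * ?q x) summable_on UNIV" and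
    fq: "(\<Sum>\<^sub>\<infinity>x. f x * ?q x) = of_real (second_moment F / real CARD('d))"
  proof -
    have h: "((\<lambda>x. complex_of_real (F x * (real_of_int (x $ j))\<^sup>2)) has_sum of_real (second_moment F / real CARD('d))) UNIV"
      using coordinate_moment_summable(2)[of j] second_moment_coordinate[of j]
      by (intro has_sum_of_real) simp
    have "(\<lambda>x. complex_of_real (F x * (real_of_int (x $ j))\<^sup>2)) = (\<lambda>x. f x * ?q x)" by auto
    with h show "(\<lambda>x. f x * ?q x) summable_on UNIV"
      "(\<Sum>\<^sub>\<infinity>x. f x * ?q x) = of_real (second_moment F / real CARD('d))"
      by (auto simp: has_sum_iff)
  qed
  have "(\<lambda>x. diff_kernel x * ?q x) = (\<lambda>x. (- of_real (mu F)) * (of_real (step_dist x) * ?q x) + (- of_real (lam F)) * (f x * ?q x))"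
  proof
    fix x :: "int^'d"
    have "kron x * ?q x = 0" using k(2) by meson
    thus "diff_kernel x * ?q x = (- of_real (mu F)) * (of_real (step_dist x) * ?q x) + (- of_real (lam F)) * (f x * ?q x)"
      by (simp add: diff_kernel_def nn_kernel_def algebra_simps)
  qed
  hence "(\<Sum>\<^sub>\<infinity>x. diff_kernel x * ?q x) = (- of_real (mu F)) * (1 / of_nat CARD('d)) + (- of_real (lam F)) * of_real (second_moment F / real CARD('d))"
    by (simp only: infsum_add[OF summable_on_cmult_right[OF s] summable_on_cmult_right[OF fs]] infsum_cmult_right' step_dist_second_moment fq)
  also have "\<dots> = of_real ((- mu F - lam F * second_moment F) / real CARD('d))" by (simp add: field_simps)
  also have "- mu F - lam F * second_moment F = 0" using mu_eq(1) by simp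
  finally show ?thesis by simp
qed

lemma set_integrable_green0: "set_integrable lborel torus (\<lambda>k::real^'d. complex_of_real (1 / ahat (mu F) k))"
  using mu_bounds by (intro set_integrable_inverse_ahat d) auto

lemma ahat_nonzero: "k \<in> torus \<Longrightarrow> k \<noteq> 0 \<Longrightarrow> ahat (mu F) k > 0"
  using mu_bounds by (intro ahat_pos) auto

lemma conv_lattice_green:
  fixes g :: "int^'d \<Rightarrow> complex"
  shows "l1 g \<Longrightarrow> conv g (lattice_green (mu F)) x = inv_fourier (\<lambda>k. cfourier g k * of_real (1 / ahat (mu F) k)) x"
  unfolding lattice_green_ahat by (rule conv_inv_fourier[OF _ set_integrable_green0])

text \<open>The convolution theorem does not apply to \<open>diff_kernel\<close> and the
  non-summable Green function. Instead \<open>nn_kernel\<close> is convolved with the summable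
  result h, which returns \<open>diff_kernel\<close>, and transforms are taken of that identity. Not
  dividing by \<open>ahat\<close> keeps it valid at every k.\<close>

lemma cfourier_correction:
  assumes "l1 (conv diff_kernel (lattice_green (mu F)))"
  shows "of_real (ahat (mu F) k) * cfourier (conv diff_kernel (lattice_green (mu F))) k = cfourier diff_kernel k"
proof -
  let ?h = "conv diff_kernel (lattice_green (mu F))"
  let ?\<phi> = "\<lambda>k. cfourier diff_kernel k * of_real (1 / ahat (mu F) k)"
  have i: "set_integrable lborel torus ?\<phi>"
    by (rule set_integrable_bound_mult[OF set_integrable_green0 borel_measurable_cfourier[OF diff_kernel_l1]])
      (rule norm_cfourier_le[OF diff_kernel_l1])
  have h: "?h = inv_fourier ?\<phi>" using conv_lattice_green[OF diff_kernel_l1] by auto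
  have "conv nn_kernel ?h = diff_kernel"
  proof
    fix x
    have "conv nn_kernel ?h x = inv_fourier (\<lambda>k. cfourier nn_kernel k * ?\<phi> k) x"
      unfolding h by (rule conv_inv_fourier[OF nn_kernel_l1 i])
    also have "\<dots> = inv_fourier (cfourier diff_kernel) x"
    proof (rule inv_fourier_cong_AE)
      show "AE k in lborel. k \<in> torus \<longrightarrow> cfourier nn_kernel k * ?\<phi> k = cfourier diff_kernel k"
        using AE_lborel_neq[of 0]
      proof eventually_elim
        case (elim k)
        show ?case using ahat_nonzero[OF _ elim] by (auto simp: cfourier_nn_kernel)
      qed
      show "set_integrable lborel torus (\<lambda>k. cfourier nn_kernel k * ?\<phi> k)"
        by (rule set_integrable_bound_mult[OF i borel_measurable_cfourier[OF nn_kernel_l1]])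
          (rule norm_cfourier_le[OF nn_kernel_l1])
    qed (rule set_integrable_cfourier[OF diff_kernel_l1])
    finally show "conv nn_kernel ?h x = diff_kernel x"
      by (simp add: inv_fourier_cfourier[OF diff_kernel_l1])
  qed
  with cfourier_conv[OF nn_kernel_l1 assms, of k] show ?thesis
    by (simp add: cfourier_nn_kernel)
qed

text \<open>For \<mu> = 1 the identity of \<open>cfourier_correction\<close> reads 0 = 0 at the
  origin. Along an axis the numerator is O(t^(2 + a0)) by the moment conditions while
  \<open>ahat\<close> is at least of order t^2, so the transform tends to 0, and continuity
  identifies the limit.\<close>

lemma cfourier_correction_0:
  assumes l: "l1 (conv diff_kernel (lattice_green (mu F)))"
  shows "cfourier (conv diff_kernel (lattice_green (mu F))) 0 = 0"
proof -
  let ?h = "conv diff_kernel (lattice_green (mu F))"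
  obtain j :: 'd where True by blast
  define Q where "Q = K1 * jbsum TYPE('d) (\<rho> - a0)"
  \<comment> \<open>The constant of the numerator over the coefficient of t^2 in the lower bound of
    \<open>ahat_ge\<close>.\<close>
  define W where "W = (mu F / real CARD('d) + lam F * Q) * (12 * real CARD('d) / mu F)"
  have le: "norm (cfourier ?h (axis j t)) \<le> W * t powr a0" if t: "0 < t" "t < pi" for t
  proof -
    let ?k = "axis j t :: real^'d"
    have k: "?k \<in> torus" by (rule axis_in_torus[OF t])
    have p: "mu F * t\<^sup>2 / (12 * real CARD('d)) > 0" using mu_bounds t by simp
    have A: "mu F * t\<^sup>2 / (12 * real CARD('d)) \<le> ahat (mu F) ?k"
      using ahat_ge[OF less_imp_le[OF mu_bounds(3)] k] mu_bounds(2) by (simp add: norm_axis_power2)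
    define err where "err = R ?k - R 0 + t\<^sup>2 / 2 * (second_moment F / real CARD('d))"
    have err: "\<bar>err\<bar> \<le> Q * \<bar>t\<bar> powr (2 + a0)"
      unfolding err_def Q_def using a0 by (intro fourier_axis_expansion) auto
    have Rk: "R ?k = R 0 - t\<^sup>2 / 2 * (second_moment F / real CARD('d)) + err" by (simp add: err_def)
    have "ahat (mu F) ?k - lam F * R ?k
       = mu F / real CARD('d) * (1 - cos t - t\<^sup>2 / 2) - lam F * err + ((1 - mu F) - lam F * R 0)
         + (mu F + lam F * second_moment F) * (t\<^sup>2 / (2 * real CARD('d)))"
      unfolding ahat_axis Rk by (simp add: field_simps)
    also have "\<dots> = mu F / real CARD('d) * (1 - cos t - t\<^sup>2 / 2) - lam F * err"
      using mu_eq by simp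
    finally have e: "ahat (mu F) ?k - lam F * R ?k = mu F / real CARD('d) * (1 - cos t - t\<^sup>2 / 2) - lam F * err" .
    have "norm (cfourier diff_kernel ?k) \<le> mu F / real CARD('d) * \<bar>1 - cos t - t\<^sup>2 / 2\<bar> + lam F * \<bar>err\<bar>"
      unfolding cfourier_diff_kernel norm_of_real e using mu_bounds lam_bounds
      by (intro order.trans[OF abs_triangle_ineq4]) (simp add: abs_mult)
    also have "\<dots> \<le> mu F / real CARD('d) * \<bar>t\<bar> powr (2 + a0) + lam F * (Q * \<bar>t\<bar> powr (2 + a0))"
    proof -
      have c: "\<bar>1 - cos t - t\<^sup>2 / 2\<bar> \<le> \<bar>t\<bar> powr (2 + a0)" by (rule cos_taylor_powr) (use a0 in auto)
      have "0 \<le> mu F / real CARD('d)" "0 \<le> lam F" using mu_bounds lam_bounds by auto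
      thus ?thesis by (intro add_mono mult_left_mono c err)
    qed
    also have "\<dots> = (mu F / real CARD('d) + lam F * Q) * (t\<^sup>2 * t powr a0)"
    proof -
      have "\<bar>t\<bar> powr (2 + a0) = t\<^sup>2 * t powr a0" using t by (simp add: powr_add powr_numeral)
      thus ?thesis by (simp only: distrib_right mult.assoc)
    qed
    finally have N: "norm (cfourier diff_kernel ?k) \<le> (mu F / real CARD('d) + lam F * Q) * (t\<^sup>2 * t powr a0)" .
    let ?c = "mu F * t\<^sup>2 / (12 * real CARD('d))"
    have gen: "m * q / (12 * e) * (V * (12 * e / m) * T) = V * (q * T)" if "m \<noteq> 0" "e \<noteq> 0" for m e V T q :: real
      using that by (simp add: field_simps)
    have "?c * norm (cfourier ?h ?k) \<le> ahat (mu F) ?k * norm (cfourier ?h ?k)"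
      by (rule mult_right_mono[OF A]) simp
    also have "\<dots> = norm (of_real (ahat (mu F) ?k) * cfourier ?h ?k)"
      using A p by (simp only: norm_mult norm_of_real)
    also have "\<dots> = norm (cfourier diff_kernel ?k)"
      by (simp only: cfourier_correction[OF l])
    also note N
    also have "(mu F / real CARD('d) + lam F * Q) * (t\<^sup>2 * t powr a0) = ?c * (W * t powr a0)"
      unfolding W_def using mu_bounds by (intro gen[symmetric]) auto
    finally show ?thesis using p by (rule mult_left_le_imp_le)
  qed
  have "((\<lambda>t. W * t powr a0) \<longlongrightarrow> W * 0) (at_right 0)"
    by (intro tendsto_intros powr_at_right_0)
  hence w: "((\<lambda>t. W * t powr a0) \<longlongrightarrow> 0) (at_right 0)" by (simp only: mult_zero_right)
  have ev: "eventually (\<lambda>t. norm (cfourier ?h (axis j t)) \<le> W * t powr a0) (at_right 0)"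
    unfolding eventually_at_right_field by (intro exI[of _ pi] conjI pi_gt_zero allI impI le)
  have z: "((\<lambda>t. cfourier ?h (axis j t)) \<longlongrightarrow> 0) (at_right 0)"
    by (rule Lim_null_comparison[OF ev w])
  have "((\<lambda>t::real. axis j t :: real^'d) \<longlongrightarrow> 0) (at_right 0)"
  proof (rule vec_tendstoI)
    fix i
    show "((\<lambda>t. (axis j t :: real^'d) $ i) \<longlongrightarrow> 0 $ i) (at_right 0)"
      by (cases "i = j") (auto simp: axis_def intro!: tendsto_ident_at)
  qed
  hence c: "((\<lambda>t. cfourier ?h (axis j t)) \<longlongrightarrow> cfourier ?h 0) (at_right 0)"
    using continuous_on_cfourier[OF l]
    by (intro isCont_tendsto_compose[of 0 "cfourier ?h"]) (auto simp: continuous_on_eq_continuous_at)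
  show ?thesis by (rule tendsto_unique[OF _ c z]) simp
qed

end

lemma cfourier_diff: "l1 f \<Longrightarrow> l1 g \<Longrightarrow> cfourier (\<lambda>x. f x - g x) k = cfourier f k - cfourier g k"
  unfolding cfourier_def
  by (simp add: left_diff_distrib infsum_add[OF _ summable_on_uminus[THEN iffD2], unfolded infsum_uminus, simplified] l1_char)

lemma l1_diff: "l1 f \<Longrightarrow> l1 g \<Longrightarrow> l1 (\<lambda>x. f x - g x)"
  using l1_add[of f "\<lambda>x. - g x"] by simp

section \<open>Inversion of the correction and assembly of the expansion\<close>

context decaying_kernel
begin

text \<open>Mass and quadratic part are compared separately: \<open>1 - \<mu>\<close> equals
  \<lambda> F^(0), and the quadratic part of \<open>ahat\<close> is matched by the infrared bound
  multiplied by the lower bound on \<lambda>. This keeps the spectrum of \<open>\<delta> - h\<close>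
  away from 0.\<close>

lemma kernel_ratio_ge:
  assumes k: "k \<in> torus"
  shows "min 1 (2 * real CARD('d) * K2 / denom_bound TYPE('d) K1 \<rho>) * ahat (mu F) k \<le> lam F * R k"
proof -
  let ?L = "denom_bound TYPE('d) K1 \<rho>"
  define c where "c = min 1 (2 * real CARD('d) * K2 / ?L)"
  have c: "0 < c" "c \<le> 1" "c \<le> 2 * real CARD('d) * K2 / ?L" using mu_bounds(4) by (auto simp: c_def)
  have Lp: "?L > 0" by (rule L_pos)
  have "c * ahat (mu F) k \<le> c * ((1 - mu F) + mu F * (norm k)\<^sup>2 / (2 * real CARD('d)))"
    using c mu_bounds by (intro mult_left_mono ahat_le) auto
  also have "\<dots> = c * (1 - mu F) + c * (mu F * ((norm k)\<^sup>2 / (2 * real CARD('d))))"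
    by (simp add: distrib_left)
  also have "\<dots> \<le> 1 * (lam F * R 0) + (2 * real CARD('d) * K2 / ?L) * (1 * ((norm k)\<^sup>2 / (2 * real CARD('d))))"
    unfolding mu_eq(2) using c mu_bounds lam_bounds F0 K2 Lp
    by (intro add_mono mult_mono mult_nonneg_nonneg divide_nonneg_nonneg) auto
  also have "\<dots> = lam F * R 0 + 1 / ?L * (K2 * (norm k)\<^sup>2)" by simp
  also have "\<dots> \<le> lam F * R 0 + lam F * (R k - R 0)"
    using lam_bounds infrared[OF k] K2 Lp by (intro add_left_mono mult_mono) auto
  also have "\<dots> = lam F * R k" by (simp add: algebra_simps)
  finally show ?thesis by (simp only: c_def)
qed

text \<open>Constants and estimates enter as hypotheses, since they have to be fixed before F is. In
  the proof \<open>g\<close> is the convolution inverse of \<open>\<delta> - h\<close>, and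
  \<open>E'\<close> is the \<open>h'\<close> of the overview.\<close>

lemma green_expansion:
  fixes s1 s2 c k4 k2 kw :: real
  defines "C \<equiv> lattice_green (mu F) :: int^'d \<Rightarrow> complex"
  defines "B \<equiv> 2 + K1 / (2 * real CARD('d) * K2)"
  defines "H \<equiv> B * c * k4"
  defines "M \<equiv> 1 + H * jbsum TYPE('d) s2"
  defines "c0 \<equiv> min 1 (2 * real CARD('d) * K2 / denom_bound TYPE('d) K1 \<rho>)"
  assumes s: "0 < s1" "s1 < s2" "s2 < min \<rho> 2" and c: "c \<ge> 0" and k4: "k4 \<ge> 0" and k2: "k2 \<ge> 0" and kw: "kw \<ge> 0"
    and C: "green_bounds c C"
    and K4: "conv_gain (second_moments_vanish :: (int^'d \<Rightarrow> complex) \<Rightarrow> bool) (2 + min \<rho> 2) (2 + s2) k4"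
    and K2': "conv_gain (\<lambda>E :: int^'d \<Rightarrow> complex. True) s2 s1 k2"
    and Kw: "\<forall>r :: int^'d \<Rightarrow> complex.
      (\<forall>x. norm (r x) \<le> (1 + H) * jb x powr - (real CARD('d) + s2)) \<longrightarrow>
      (\<forall>k\<in>torus. norm (cfourier r k) \<le> 1 - c0 / M) \<longrightarrow>
      (\<forall>x. norm (inv_fourier (\<lambda>k. 1 / (1 - cfourier r k)) x) \<le> kw * jb x powr - (real CARD('d) + s2))"
  shows "norm (green F x - of_real (lam F) * C x)
    \<le> 1 / (2 * real CARD('d) * K2) * ((kw + 1) * c * k2) * jb x powr - (real CARD('d) - 2 + s1)"
proof -
  let ?w = "\<lambda>x::int^'d. jb x powr - (real CARD('d) + s2)"
  have B0: "B \<ge> 0" using K1 K2 by (simp add: B_def)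
  have H0: "H \<ge> 0" using B0 c k4 by (simp add: H_def)
  have M1: "M \<ge> 1"
    unfolding M_def using mult_nonneg_nonneg[OF H0 jbsum_nonneg[where 'd = 'd, of s2]] by simp
  have c0: "0 < c0" "c0 \<le> 1" using mu_bounds(4) by (auto simp: c0_def)
  define h where "h = conv diff_kernel C"
  have hd: "norm (h x) \<le> H * ?w x" for x
  proof -
    have "second_moments_vanish diff_kernel"
      unfolding second_moments_vanish_def using diff_kernel_second_moment ..
    hence "norm (h x) \<le> B * c * k4 * jb x powr - (real CARD('d) - 2 + (2 + s2))"
      unfolding h_def
      by (rule conv_gainD[OF K4 B0 c diff_kernel_even diff_kernel_decay[folded B_def] diff_kernel_sum _ C])
    also have "real CARD('d) - 2 + (2 + s2) = real CARD('d) + s2" by simp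
    finally show ?thesis by (simp only: H_def)
  qed
  have s2: "s2 > 0" using s by simp
  have hl: "l1 h" and hsum: "(\<Sum>\<^sub>\<infinity>x. norm (h x)) \<le> H * jbsum TYPE('d) s2"
    using l1_bound[OF hd s2] by auto
  have hf: "of_real (ahat (mu F) k) * cfourier h k = of_real (ahat (mu F) k - lam F * R k)" for k
    using cfourier_correction[of k] hl unfolding h_def C_def cfourier_diff_kernel by blast
  have h0: "cfourier h 0 = 0"
    using cfourier_correction_0 hl unfolding h_def C_def by blast
  have ratio: "1 - cfourier h k = of_real (lam F * R k / ahat (mu F) k)" if "k \<in> torus" "k \<noteq> 0" for k
  proof -
    have a: "ahat (mu F) k > 0" by (rule ahat_nonzero[OF that])
    have "of_real (ahat (mu F) k) * (1 - cfourier h k) = of_real (lam F * R k)"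
      using hf[of k] by (simp add: right_diff_distrib)
    thus ?thesis using a by (simp add: field_simps)
  qed
  have bounds: "\<exists>v. 1 - cfourier h k = of_real v \<and> c0 \<le> v \<and> v \<le> M" if k: "k \<in> torus" for k
  proof (cases "k = 0")
    case True
    thus ?thesis using h0 c0 M1 by (intro exI[of _ 1]) auto
  next
    case False
    let ?v = "lam F * R k / ahat (mu F) k"
    have v: "1 - cfourier h k = of_real ?v" by (rule ratio[OF k False])
    have "c0 \<le> ?v"
      using kernel_ratio_ge[OF k] ahat_nonzero[OF k False] by (simp add: c0_def pos_le_divide_eq)
    moreover have "?v \<le> M"
    proof -
      have "?v \<le> norm (1 - cfourier h k)" unfolding v norm_of_real by (rule abs_ge_self)
      also have "\<dots> \<le> norm (1::complex) + norm (cfourier h k)" by (rule norm_triangle_ineq4)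
      also have "\<dots> \<le> M" using order.trans[OF norm_cfourier_le[OF hl] hsum] by (simp add: M_def)
      finally show ?thesis .
    qed
    ultimately show ?thesis using v by blast
  qed
  \<comment> \<open>\<open>\<delta> - r\<close> is \<open>(\<delta> - h) / M\<close>. As 1 - h^
    takes values in [c0, M] on the torus, r^ takes values in [0, 1 - c0/M], which is the spectral
    gap that \<open>wiener_decay\<close> asks for.\<close>
  define r where "r = (\<lambda>x. of_real (1 - 1 / M) * kron x + of_real (1 / M) * h x)"
  have rf: "cfourier r k = 1 - (1 - cfourier h k) / of_real M" for k
    unfolding r_def
    by (subst cfourier_add[OF l1_cmult[OF l1_kron] l1_cmult[OF hl]], subst (1 2) cfourier_cmult)
      (simp add: cfourier_kron diff_divide_distrib)
  have rd: "norm (r x) \<le> (1 + H) * ?w x" for x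
  proof -
    have "norm (r x) \<le> norm (of_real (1 - 1 / M) * kron x) + norm (of_real (1 / M) * h x)"
      unfolding r_def by (rule norm_triangle_ineq)
    also have "norm (of_real (1 - 1 / M) * kron x) \<le> 1 * ?w x"
      unfolding norm_mult norm_of_real using M1 by (intro mult_mono kron_le) auto
    also have "norm (of_real (1 / M) * h x) \<le> 1 * (H * ?w x)"
      unfolding norm_mult norm_of_real using M1 by (intro mult_mono hd) auto
    finally show ?thesis by (simp add: algebra_simps)
  qed
  have rq: "norm (cfourier r k) \<le> 1 - c0 / M" if k: "k \<in> torus" for k
  proof -
    obtain v where v: "1 - cfourier h k = of_real v" "c0 \<le> v" "v \<le> M" using bounds[OF k] by blast
    have "cfourier r k = of_real (1 - v / M)" unfolding rf v(1) by simp
    hence "norm (cfourier r k) = 1 - v / M" using v M1 by (simp only: norm_of_real) (simp add: divide_le_eq)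
    also have "\<dots> \<le> 1 - c0 / M" using v M1 by (simp add: divide_right_mono)
    finally show ?thesis .
  qed
  let ?b = "\<lambda>k. 1 / (1 - cfourier h k)"
  define g where "g = inv_fourier ?b"
  have gd: "norm (g x) \<le> kw * ?w x" for x
  proof -
    have "g x = of_real (1 / M) * inv_fourier (\<lambda>k. 1 / (1 - cfourier r k)) x"
      unfolding g_def inv_fourier_cmult[symmetric] rf using M1
      by (intro arg_cong2[where f = inv_fourier]) auto
    hence "norm (g x) = 1 / M * norm (inv_fourier (\<lambda>k. 1 / (1 - cfourier r k)) x)"
      using M1 by (simp add: norm_mult norm_divide)
    also have "\<dots> \<le> 1 * (kw * ?w x)"
      using Kw rd rq M1 kw by (intro mult_mono) auto
    finally show ?thesis by simp
  qed
  have gl: "l1 g" by (rule l1_bound(1)[OF gd s2])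
  have nz: "1 - cfourier h k \<noteq> 0" and bb: "norm (?b k) \<le> 1 / c0" if k: "k \<in> torus" for k
  proof -
    obtain v where v: "1 - cfourier h k = of_real v" "c0 \<le> v" "v \<le> M" using bounds[OF k] by blast
    show "1 - cfourier h k \<noteq> 0" unfolding v(1) using v c0 by simp
    show "norm (?b k) \<le> 1 / c0" unfolding v(1) using v c0 by (simp add: norm_divide frac_le)
  qed
  have bi: "set_integrable lborel torus ?b"
    by (rule set_integrable_torus_bounded[OF _ bb]) (use borel_measurable_cfourier[OF hl] in measurable)
  define a where "a = (\<lambda>x. kron x - h x)"
  have al: "l1 a" and af: "cfourier a k = 1 - cfourier h k" for k
    unfolding a_def by (intro l1_diff l1_kron hl, simp add: cfourier_diff[OF l1_kron hl] cfourier_kron)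
  \<comment> \<open>The identity on the lattice yields the one for transforms at all k; this matters
    because reflecting k may lead out of the half-open torus.\<close>
  have "conv a g = kron"
  proof
    fix x
    have "conv a g x = inv_fourier (\<lambda>k. cfourier a k * ?b k) x"
      unfolding g_def by (rule conv_inv_fourier[OF al bi])
    also have "\<dots> = inv_fourier (\<lambda>_. 1) x"
    proof (rule inv_fourier_cong_AE)
      show "AE k in lborel. k \<in> torus \<longrightarrow> cfourier a k * ?b k = 1"
        using nz by (intro AE_I2) (simp add: af)
      show "set_integrable lborel torus (\<lambda>k. cfourier a k * ?b k)"
        by (rule set_integrable_bound_mult[OF bi borel_measurable_cfourier[OF al]]) (rule norm_cfourier_le[OF al])
    qed (rule torus_set_integrable_const)
    finally show "conv a g x = kron x" by (simp add: inv_fourier_1)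
  qed
  hence inverse: "(1 - cfourier h k) * cfourier g k = 1" for k
    using cfourier_conv[OF al gl, of k] by (simp add: af cfourier_kron)
  have gf: "cfourier g k = ?b k" if k: "k \<in> torus" for k
    using inverse[of k] nz[OF k] by (simp add: field_simps)
  \<comment> \<open>Evenness is read off the transform: h^ inherits it from E^ and A^ where A^ is
    nonzero, and reflections fix the origin.\<close>
  have geven: "g (reflect i y) = g y" for i y
  proof -
    let ?g = "\<lambda>x. g (reflect i x)"
    let ?\<sigma> = "\<lambda>k::real^'d. \<chi> j. if j = i then - (k $ j) else k $ j"
    have gl': "l1 ?g"
      using gl by (subst summable_on_reindex_bij_witness[where i = "reflect i" and j = "reflect i" and h = "\<lambda>x. norm (g x)" and T = UNIV]) auto
    have hs: "cfourier h (?\<sigma> k) = cfourier h k" if k: "k \<in> torus" for k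
    proof (cases "k = 0")
      case True
      hence "?\<sigma> k = k" by (simp add: vec_eq_iff)
      thus ?thesis by simp
    next
      case False
      have "cfourier diff_kernel (?\<sigma> k) = cfourier diff_kernel k"
        unfolding cfourier_reflect[symmetric] using diff_kernel_even by (simp add: coord_even_def)
      hence "of_real (ahat (mu F) k) * cfourier h (?\<sigma> k) = of_real (ahat (mu F) k) * cfourier h k"
        using hf[of k] hf[of "?\<sigma> k"] unfolding ahat_reflect cfourier_diff_kernel by metis
      thus ?thesis using ahat_nonzero[OF k False] by simp
    qed
    have eq: "cfourier ?g k = cfourier g k" if k: "k \<in> torus" for k
    proof -
      have "(1 - cfourier h k) * cfourier ?g k = (1 - cfourier h k) * cfourier g k"
        using inverse[of "?\<sigma> k"] inverse[of k] unfolding cfourier_reflect hs[OF k] by simp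
      thus ?thesis using nz[OF k] by simp
    qed
    have "?g = inv_fourier (cfourier ?g)" by (rule inv_fourier_cfourier[OF gl', symmetric])
    also have "\<dots> = inv_fourier (cfourier g)"
      by (rule ext, rule inv_fourier_cong_AE)
        (auto intro!: AE_I2 eq set_integrable_cfourier gl gl')
    also have "\<dots> = g" by (rule inv_fourier_cfourier[OF gl])
    finally show ?thesis by (rule fun_cong)
  qed
  define E' where "E' = (\<lambda>x. g x - kron x)"
  have E'l: "l1 E'" and E'f: "cfourier E' k = cfourier g k - 1" for k
    unfolding E'_def by (intro l1_diff l1_kron gl, simp add: cfourier_diff[OF gl l1_kron] cfourier_kron)
  have E'd: "norm (E' x) \<le> (kw + 1) * ?w x" for x
  proof -
    have "norm (E' x) \<le> norm (g x) + norm (kron x)" unfolding E'_def by (rule norm_triangle_ineq4)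
    also have "\<dots> \<le> kw * ?w x + ?w x" by (intro add_mono gd kron_le)
    finally show ?thesis by (simp add: algebra_simps)
  qed
  have z: "(0 :: real^'d) \<in> torus" by (simp add: torus_def)
  \<comment> \<open>Mean zero amounts to g^(0) = 1, which is h^(0) = 0.\<close>
  have E'0: "infsum E' UNIV = 0"
    using E'f[of 0] gf[OF z] h0 unfolding cfourier_0 by simp
  have E'e: "coord_even E'" unfolding coord_even_def E'_def by (simp only: geven kron_reflect simp_thms)
  have kw1: "kw + 1 \<ge> 0" using kw by simp
  have main: "norm (conv E' C x) \<le> (kw + 1) * c * k2 * jb x powr - (real CARD('d) - 2 + s1)"
    by (rule conv_gainD[OF K2' kw1 c E'e E'd E'0 TrueI C])
  have "green F x - of_real (lam F) * C x = of_real (lam F) * conv E' C x"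
  proof -
    let ?A = "\<lambda>k::real^'d. complex_of_real (1 / ahat (mu F) k)"
    have i1: "set_integrable lborel torus (\<lambda>k. cfourier E' k * ?A k)"
      by (rule set_integrable_bound_mult[OF set_integrable_green0 borel_measurable_cfourier[OF E'l]])
        (rule norm_cfourier_le[OF E'l])
    \<comment> \<open>From \<lambda> F^ = A^ (1 - h^) off the origin: 1/F^ = \<lambda> g^ / A^, and
      g^ is the transform of \<open>E'\<close> plus 1.\<close>
    have "green F x = inv_fourier (\<lambda>k. of_real (lam F) * (cfourier E' k * ?A k + ?A k)) x"
      unfolding green_def
    proof (rule inv_fourier_cong_AE)
      show "set_integrable lborel torus (\<lambda>k. of_real (lam F) * (cfourier E' k * ?A k + ?A k))"
        by (intro set_integrable_mult_right set_integral_add i1 set_integrable_green0)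
      show "AE k in lborel. k \<in> torus \<longrightarrow> 1 / fourier F k = of_real (lam F) * (cfourier E' k * ?A k + ?A k)"
        using AE_lborel_neq[of 0]
      proof eventually_elim
        case (elim k)
        show ?case
        proof
          assume k: "k \<in> torus"
          define v where "v = R k"
          have v: "v > 0" "fourier F k = of_real v" using R_pos[OF k elim] fourier_F(1)[of k] by (auto simp: v_def)
          have a: "ahat (mu F) k > 0" by (rule ahat_nonzero[OF k elim])
          have "cfourier E' k * ?A k + ?A k = cfourier g k * ?A k" by (simp add: E'f diff_divide_distrib)
          also have "cfourier g k = of_real (ahat (mu F) k / (lam F * v))"
            unfolding gf[OF k] ratio[OF k elim] by (simp add: v_def)
          finally show "1 / fourier F k = of_real (lam F) * (cfourier E' k * ?A k + ?A k)"
            unfolding v(2) using a v(1) lam_bounds(1) by simp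
        qed
      qed
    qed (rule set_integrable_inverse_fourier)
    also have "\<dots> = of_real (lam F) * (inv_fourier (\<lambda>k. cfourier E' k * ?A k) x + inv_fourier ?A x)"
      unfolding inv_fourier_cmult inv_fourier_add[OF i1 set_integrable_green0] ..
    also have "inv_fourier (\<lambda>k. cfourier E' k * ?A k) x = conv E' C x"
      unfolding C_def by (rule conv_lattice_green[OF E'l, symmetric])
    also have "inv_fourier ?A x = C x" by (simp add: C_def lattice_green_ahat)
    finally show ?thesis by (simp add: algebra_simps)
  qed
  hence "norm (green F x - of_real (lam F) * C x) = lam F * norm (conv E' C x)"
    using lam_bounds(1) by (simp add: norm_mult)
  also have "\<dots> \<le> 1 / (2 * real CARD('d) * K2) * ((kw + 1) * c * k2 * jb x powr - (real CARD('d) - 2 + s1))"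
    using lam_bounds main K2 by (intro mult_mono) auto
  finally show ?thesis by (simp only: mult.assoc)
qed

end

theorem theorem1p2:
  fixes K\<^sub>1 K\<^sub>2 \<rho> s d :: real
  defines "d \<equiv> real CARD('d::finite)"
  assumes "CARD('d) > 2"
    and "K\<^sub>1 > 0" and "K\<^sub>2 > 0"
    and "\<rho> > max ((d - 8) / 2) 0"
    and "d \<le> 8 \<Longrightarrow> s < min \<rho> 2"
    and "d > 8 \<Longrightarrow> s < min (\<rho> - (d - 8) / 2) 2"
  shows "\<exists>C. \<forall>F :: int ^ 'd \<Rightarrow> real.
    lattice_symmetric F
    \<and> (\<forall>x. \<bar>F x\<bar> \<le> K\<^sub>1 / max (norm (emb x)) 1 powr (d + 2 + \<rho>))
    \<and> Re (fourier F 0) \<ge> 0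
    \<and> (\<forall>k\<in>torus. Re (fourier F k) - Re (fourier F 0) \<ge> K\<^sub>2 * (norm k)\<^sup>2)
    \<longrightarrow>
      - second_moment F \<ge> 2 * d * K\<^sub>2
      \<and> lam F > 0 \<and> mu F \<in> {0<..1}
      \<and> (\<forall>x. set_integrable lborel torus (inv_fourier_integrand (\<lambda>k. 1 / fourier F k) x))
      \<and> (\<forall>x. (\<lambda>y. norm (complex_of_real (F y) * green F (x - y))) summable_on UNIV)
      \<and> conv (\<lambda>y. of_real (F y)) (green F) = kron
      \<and> (\<forall>x. norm (green F x - of_real (lam F) * lattice_green (mu F) x)
              \<le> C / max (norm (emb x)) 1 powr (d - 2 + s))"
proof -
  have card: "CARD('d) > 2" and K: "K\<^sub>1 > 0" "K\<^sub>2 > 0" and \<rho>: "\<rho> > 0"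
    using assms by auto
  define m where "m = min \<rho> 2"
  have m: "m > 0" using \<rho> by (simp add: m_def)
  have sm: "s < m"
  proof (cases "d \<le> 8")
    case True
    show ?thesis unfolding m_def by (rule \<open>d \<le> 8 \<Longrightarrow> s < min \<rho> 2\<close>[OF True])
  next
    case False
    hence "d > 8" by simp
    from \<open>d > 8 \<Longrightarrow> s < min (\<rho> - (d - 8) / 2) 2\<close>[OF this]
    have "s < \<rho> - (d - 8) / 2" "s < 2" by simp_all
    moreover have "(d - 8) / 2 \<ge> 0" using False by simp
    ultimately have "s < \<rho>" by linarith
    thus ?thesis using \<open>s < 2\<close> by (simp add: m_def)
  qed
  \<comment> \<open>s may be negative, whereas the convolution estimates ask for nonnegative gains;
    passing to \<open>max s 0\<close> only strengthens the error bound.\<close>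
  obtain s0 where s0: "s \<le> s0" "0 \<le> s0" "s0 < m"
    using sm m by (intro that[of "max s 0"]) auto
  \<comment> \<open>Midpoints that leave two strict gaps below m: one for the decay of the
    correction kernel, one for its final convolution with the Green function.\<close>
  define s1 where "s1 = (s0 + m) / 2"
  define s2 where "s2 = (s1 + m) / 2"
  have s12: "0 < s1" "s1 < s2" "s2 < m" "s \<le> s1" "m \<le> 2"
    using s0 m by (simp_all add: s1_def s2_def) (simp add: m_def)
  define L where "L = denom_bound TYPE('d) K\<^sub>1 \<rho>"
  have L: "L > 0"
    using mult_nonneg_nonneg[OF less_imp_le[OF K(1)] jbsum_nonneg[where 'd = 'd, of "2 + \<rho>"]]
      mult_nonneg_nonneg[OF less_imp_le[OF K(1)] jbsum_nonneg[where 'd = 'd, of \<rho>]]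
    by (simp add: L_def denom_bound_def)
  \<comment> \<open>The lower bound of \<open>mu_bounds\<close>, expressible before any F is
    given.\<close>
  define \<mu>0 where "\<mu>0 = 2 * d * K\<^sub>2 / L"
  have \<mu>0: "\<mu>0 > 0" using card K L by (simp add: \<mu>0_def d_def)
  obtain c where c: "c \<ge> 0"
    and C: "\<And>\<mu>. \<mu>0 \<le> \<mu> \<and> \<mu> \<le> 1 \<Longrightarrow> green_bounds c (lattice_green \<mu> :: int^'d \<Rightarrow> complex)"
    using lattice_green_bounds[OF card \<mu>0] by blast
  have "2 \<le> 2 + s2" "2 + s2 < 2 + min \<rho> 2" "2 + s2 \<le> 4" using s12 by (auto simp: m_def)
  from conv_decay_4[OF card this] obtain k4 where k4: "k4 \<ge> 0"
    and K4: "conv_gain (second_moments_vanish :: (int^'d \<Rightarrow> complex) \<Rightarrow> bool) (2 + min \<rho> 2) (2 + s2) k4"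
    by blast
  have "0 \<le> s1" "s1 < s2" "s1 \<le> 2" using s12 by auto
  from conv_decay_2[OF card this] obtain k2 where k2: "k2 \<ge> 0"
    and conv2: "conv_gain (\<lambda>E :: int^'d \<Rightarrow> complex. True) s2 s1 k2" by blast
  define H where "H = (2 + K\<^sub>1 / (2 * real CARD('d) * K\<^sub>2)) * c * k4"
  define M where "M = 1 + H * jbsum TYPE('d) s2"
  define c0 where "c0 = min 1 (2 * real CARD('d) * K\<^sub>2 / L)"
  have H: "H \<ge> 0" using K c k4 by (simp add: H_def)
  have M: "M > 0"
    unfolding M_def using mult_nonneg_nonneg[OF H jbsum_nonneg[where 'd = 'd, of s2]] by simp
  have c0: "c0 > 0" using \<mu>0 by (simp add: c0_def \<mu>0_def d_def)
  have "0 < s2" "1 - c0 / M < 1" "0 < 1 + H" using s12 c0 M H by auto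
  note wiener_decay[where 'd = 'd, OF this]
  then obtain kw where kw: "kw \<ge> 0" and Kw: "\<forall>r :: int^'d \<Rightarrow> complex.
      (\<forall>x. norm (r x) \<le> (1 + H) * jb x powr - (real CARD('d) + s2)) \<longrightarrow>
      (\<forall>k\<in>torus. norm (cfourier r k) \<le> 1 - c0 / M) \<longrightarrow>
      (\<forall>x. norm (inv_fourier (\<lambda>k. 1 / (1 - cfourier r k)) x) \<le> kw * jb x powr - (real CARD('d) + s2))"
    by (elim exE conjE)
  define A where "A = 1 / (2 * real CARD('d) * K\<^sub>2) * ((kw + 1) * c * k2)"
  have A: "A \<ge> 0" using kw c k2 K by (simp add: A_def)
  show ?thesis
  \<comment> \<open>All ingredients of A depend only on d, K1, K2, \<rho> and s; F is introduced
    after the witness, which gives the uniformity of the error constant.\<close>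
  proof (intro exI[of _ A] allI impI, elim conjE)
    fix F :: "int ^ 'd \<Rightarrow> real"
    assume F: "lattice_symmetric F" "\<forall>x. \<bar>F x\<bar> \<le> K\<^sub>1 / max (norm (emb x)) 1 powr (d + 2 + \<rho>)"
      "Re (fourier F 0) \<ge> 0" "\<forall>k\<in>torus. Re (fourier F k) - Re (fourier F 0) \<ge> K\<^sub>2 * (norm k)\<^sup>2"
    interpret decaying_kernel F K\<^sub>1 K\<^sub>2 \<rho>
    proof
      show "\<bar>F x\<bar> \<le> K\<^sub>1 * jb x powr - (real CARD('d) + 2 + \<rho>)" for x
        using F(2)[rule_format, of x] unfolding d_def jb_def powr_minus divide_inverse .
    qed (use F card K \<rho> in auto)
    have \<mu>: "\<mu>0 \<le> mu F \<and> mu F \<le> 1"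
      using mu_bounds by (simp add: \<mu>0_def L_def d_def)
    have exp: "norm (green F x - of_real (lam F) * lattice_green (mu F) x) \<le> A / max (norm (emb x)) 1 powr (d - 2 + s)" for x
    proof -
      have "norm (green F x - of_real (lam F) * lattice_green (mu F) x) \<le> A * jb x powr - (real CARD('d) - 2 + s1)"
        unfolding A_def
      proof (rule green_expansion[OF s12(1,2) _ c k4 k2 kw C[OF \<mu>] K4 conv2])
        show "s2 < min \<rho> 2" using s12(3) by (simp only: m_def)
        show "\<forall>r :: int^'d \<Rightarrow> complex.
          (\<forall>x. norm (r x) \<le> (1 + (2 + K\<^sub>1 / (2 * real CARD('d) * K\<^sub>2)) * c * k4) * jb x powr - (real CARD('d) + s2)) \<longrightarrow>
          (\<forall>k\<in>torus. norm (cfourier r k) \<le> 1 - min 1 (2 * real CARD('d) * K\<^sub>2 / denom_bound TYPE('d) K\<^sub>1 \<rho>)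
            / (1 + (2 + K\<^sub>1 / (2 * real CARD('d) * K\<^sub>2)) * c * k4 * jbsum TYPE('d) s2)) \<longrightarrow>
          (\<forall>x. norm (inv_fourier (\<lambda>k. 1 / (1 - cfourier r k)) x) \<le> kw * jb x powr - (real CARD('d) + s2))"
          using Kw unfolding H_def M_def c0_def L_def .
      qed
      also have "\<dots> \<le> A * jb x powr - (d - 2 + s)"
        using s12(4) by (intro mult_left_mono jb_powr_mono A) (simp add: d_def)
      finally show ?thesis unfolding jb_def powr_minus divide_inverse .
    qed
    show "- second_moment F \<ge> 2 * d * K\<^sub>2
      \<and> lam F > 0 \<and> mu F \<in> {0<..1}
      \<and> (\<forall>x. set_integrable lborel torus (inv_fourier_integrand (\<lambda>k. 1 / fourier F k) x))
      \<and> (\<forall>x. (\<lambda>y. norm (complex_of_real (F y) * green F (x - y))) summable_on UNIV)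
      \<and> conv (\<lambda>y. of_real (F y)) (green F) = kron
      \<and> (\<forall>x. norm (green F x - of_real (lam F) * lattice_green (mu F) x)
              \<le> A / max (norm (emb x)) 1 powr (d - 2 + s))"
    proof (intro conjI allI)
      show "- second_moment F \<ge> 2 * d * K\<^sub>2" unfolding d_def by (rule minus_second_moment_ge)
      show "mu F \<in> {0<..1}" using mu_bounds by simp
    qed (rule lam_bounds(1) set_integrable_inv_fourier[OF set_integrable_inverse_fourier] green_summable conv_green exp)+
  qed
qed

end
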